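(* Let $d\ge 1$ and let $\mathcal{B}$ be the Bourgain--Brezis--Mironescu space on $(0,1)^d$ (defined in the context). Then $\mathcal{B}$ has an isometric predual $\mathcal{B}_\ast$ with the following properties. Every $\varphi\in\mathcal{B}_\ast$ is of the form $$\varphi=\sum_{n=1}^\infty \lambda_n g_n ,$$ where $(\lambda_n)\in\ell^1$ and each atom $g_n$ is a function on $(0,1)^d$ associated with some $\varepsilon=\varepsilon_n\in(0,1]$ and a collection $\mathcal{F}_\varepsilon$ of mutually disjoint $\varepsilon$-cubes contained in $(0,1)^d$, with $|\mathcal{F}_\varepsilon|\le \varepsilon^{1-d}$, such that - $\operatorname{supp} g_n\subset \bigcup_{Q_\varepsilon\in\mathcal{F}_\varepsilon}Q_\varepsilon$ (that is, $g_n=0$ a.e. outside this union), - $|g_n|\chi_{Q_\varepsilon}\le \varepsilon^{d-1}\frac{1}{|Q_\varepsilon|}$ for every $Q_\varepsilon\in\mathcal{F}_\varepsilon$, - $\int_{Q_\varepsilon} g_n\,dx=0$ for every $Q_\varepsilon\in\mathcal{F}_\varepsilon$. The action of $f\in\mathcal{B}$ on $\varphi$ is given by $$f(\varphi)=\sum_{n=1}^\infty\lambda_n\int_{(0,1)^d} f g_n\,dx ,$$ and $$C\inf\sum_{n=1}^\infty|\lambda_n|\le\|\varphi\|_{\mathcal{B}_\ast}\le\inf\sum_{n=1}^\infty|\lambda_n| ,$$ where $C>0$ is an absolute constant and the infimum is taken over all representations $\varphi=\sum_{n=1}^\infty\lambda_n g_n$ with $(\lambda_n)\in\ell^1$ and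 each $g_n$ an atom, i.e. a function satisfying the three bulleted conditions for some $\varepsilon=\varepsilon_n\in(0,1]$ and some collection $\mathcal{F}_\varepsilon$ of mutually disjoint $\varepsilon$-cubes contained in $(0,1)^d$ with $|\mathcal{F}_\varepsilon|\le\varepsilon^{1-d}$.
   Context: An $\varepsilon$-cube is an open cube $Q_\varepsilon$ in $\mathbb{R}^d$ with sides of length $\varepsilon$ parallel to the coordinate axes; $|Q_\varepsilon|=\varepsilon^d$ is its Lebesgue measure, while $|\mathcal{F}_\varepsilon|$ denotes the cardinality of a collection $\mathcal{F}_\varepsilon$. For (complex-valued) $f\in L^1((0,1)^d)$ let $f_{Q}=\frac1{|Q|}\int_Q f\,dx$. For $0<\varepsilon\le1$ set $$[f]_\varepsilon=\varepsilon^{d-1}\sup_{\mathcal{F}_\varepsilon}\sum_{Q_\varepsilon\in\mathcal{F}_\varepsilon}\frac1{|Q_\varepsilon|}\int_{Q_\varepsilon}|f(x)-f_{Q_\varepsilon}|\,dx ,$$ where the supremum is over all collections $\mathcal{F}_\varepsilon$ of mutually disjoint $\varepsilon$-cubes contained in $(0,1)^d$ with $|\mathcal{F}_\varepsilon|\le\varepsilon^{1-d}$. Define $\|f\|_{\mathcal{B}}=\sup_{0<\varepsilon\le1}[f]_\varepsilon$ and $\mathcal{B}=\{f\in L^1((0,1)^d):\|f\|_{\mathcal{B}}<\infty\}$, with functions identified modulo additive constants, so that $\|\cdot\|_{\mathcal{B}}$ is a norm. An isometric predual of a Banach space $E$ is a Banach space $E_\ast$, which may be regarded as a closed subspace of $E^\ast$,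 such that the map sending $x\in E$ to the functional $\varphi\mapsto x(\varphi):=\varphi(x)$ on $E_\ast$ is an isometric isomorphism of $E$ onto $(E_\ast)^\ast$. Each atom $g_n$ is identified with the functional $f\mapsto\int_{(0,1)^d} f g_n\,dx$ on $\mathcal{B}$, which is well defined modulo constants since $\int g_n\,dx=0$. *)

theory Defs
  imports "HOL-Analysis.Analysis" "HOL-Algebra.Module"
begin

section \<open>Complex normed spaces on carriers, duals and isometric preduals\<close>

text \<open>
  The spaces below depend on a natural number \<open>d\<close> that is bound inside the statement, so they are
  carrier-based modules over the ring of complex numbers, not types. The fields \<open>mult\<close> and \<open>one\<close>
  that \<^typ>\<open>('a, 'b) module\<close> inherits from rings play no role.
\<close>

definition complex_ring :: "complex ring"
  where "complex_ring = \<lparr>carrier = UNIV, monoid.mult = (*), one = 1, zero = 0, add = (+)\<rparr>"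

record 'v normed_module = "(complex, 'v) module" +
  nrm :: "'v \<Rightarrow> real"

locale complex_normed_space = module complex_ring V
  for V :: "'v normed_module" (structure) +
  assumes nrm_nonneg: "x \<in> carrier V \<Longrightarrow> 0 \<le> nrm V x"
    and nrm_eq_0: "x \<in> carrier V \<Longrightarrow> nrm V x = 0 \<longleftrightarrow> x = \<zero>"
    and nrm_triangle: "x \<in> carrier V \<Longrightarrow> y \<in> carrier V \<Longrightarrow> nrm V (x \<oplus> y) \<le> nrm V x + nrm V y"
    and nrm_smult: "x \<in> carrier V \<Longrightarrow> nrm V (c \<odot>\<^bsub>V\<^esub> x) = cmod c * nrm V x"

text \<open>
  \<^locale>\<open>Metric_space\<close> demands nonnegativity and symmetry also off the carrier, hence the case split.
\<close>

definition nrm_dist :: "'v normed_module \<Rightarrow> 'v \<Rightarrow> 'v \<Rightarrow> real"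
  where "nrm_dist V x y = (if x \<in> carrier V \<and> y \<in> carrier V then nrm V (x \<ominus>\<^bsub>V\<^esub> y) else 0)"

definition complex_banach :: "'v normed_module \<Rightarrow> bool"
  where "complex_banach V \<longleftrightarrow>
    complex_normed_space V \<and> Metric_space.mcomplete (carrier V) (nrm_dist V)"

definition dual_carrier :: "'v normed_module \<Rightarrow> ('v \<Rightarrow> complex) set"
  where "dual_carrier V = {\<phi> \<in> extensional (carrier V).
    (\<forall>x\<in>carrier V. \<forall>y\<in>carrier V. \<phi> (x \<oplus>\<^bsub>V\<^esub> y) = \<phi> x + \<phi> y) \<and>
    (\<forall>c. \<forall>x\<in>carrier V. \<phi> (c \<odot>\<^bsub>V\<^esub> x) = c * \<phi> x) \<and>
    (\<exists>K. \<forall>x\<in>carrier V. cmod (\<phi> x) \<le> K * nrm V x)}"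

definition dual :: "'v normed_module \<Rightarrow> ('v \<Rightarrow> complex) normed_module"
  where "dual V =
    \<lparr>carrier = dual_carrier V,
     monoid.mult = undefined,
     one = undefined,
     zero = (\<lambda>x\<in>carrier V. 0),
     add = (\<lambda>\<phi> \<psi>. \<lambda>x\<in>carrier V. \<phi> x + \<psi> x),
     smult = (\<lambda>c \<phi>. \<lambda>x\<in>carrier V. c * \<phi> x),
     nrm = (\<lambda>\<phi>. SUP x\<in>{x \<in> carrier V. nrm V x \<le> 1}. cmod (\<phi> x))\<rparr>"

definition isometric_isomorphism :: "'v normed_module \<Rightarrow> 'w normed_module \<Rightarrow> ('v \<Rightarrow> 'w) \<Rightarrow> bool"
  where "isometric_isomorphism V W T \<longleftrightarrow>
    bij_betw T (carrier V) (carrier W) \<and>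
    (\<forall>x\<in>carrier V. \<forall>y\<in>carrier V. T (x \<oplus>\<^bsub>V\<^esub> y) = T x \<oplus>\<^bsub>W\<^esub> T y) \<and>
    (\<forall>c. \<forall>x\<in>carrier V. T (c \<odot>\<^bsub>V\<^esub> x) = c \<odot>\<^bsub>W\<^esub> T x) \<and>
    (\<forall>x\<in>carrier V. nrm W (T x) = nrm V x)"

text \<open>
  A predual of \<open>V\<close> is given by its carrier \<open>P\<close>, a closed subspace of the dual of \<open>V\<close>; its operations
  and its norm are those of the dual.
\<close>

definition isometric_predual :: "'v normed_module \<Rightarrow> ('v \<Rightarrow> complex) set \<Rightarrow> bool"
  where "isometric_predual V P \<longleftrightarrow>
    complex_banach V \<and>
    submodule P complex_ring (dual V) \<and>
    closedin (Metric_space.mtopology (carrier (dual V)) (nrm_dist (dual V))) P \<and>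
    complex_banach ((dual V)\<lparr>carrier := P\<rparr>) \<and>
    isometric_isomorphism V (dual ((dual V)\<lparr>carrier := P\<rparr>)) (\<lambda>x. \<lambda>\<phi>\<in>P. \<phi> x)"

definition nrm_sums :: "'v normed_module \<Rightarrow> (nat \<Rightarrow> 'v) \<Rightarrow> 'v \<Rightarrow> bool"
  where "nrm_sums V u s \<longleftrightarrow>
    range u \<subseteq> carrier V \<and> s \<in> carrier V \<and>
    (\<lambda>N. nrm V (s \<ominus>\<^bsub>V\<^esub> finsum V u {..<N})) \<longlonglongrightarrow> 0"


section \<open>The Bourgain--Brezis--Mironescu space\<close>

text \<open>
  Lebesgue measure on the open unit cube, whose points are the extensional functions on \<open>{..<d}\<close>.
  It is the Borel version; every Lebesgue measurable function has a Borel representative, so passing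
  to classes modulo null sets gives the same \<open>L\<^sup>1\<close>.
\<close>

definition cube_measure :: "nat \<Rightarrow> (nat \<Rightarrow> real) measure"
  where "cube_measure d = (\<Pi>\<^sub>M i\<in>{..<d}. restrict_space lborel {0<..<1})"

definition eps_cubes :: "nat \<Rightarrow> real \<Rightarrow> (nat \<Rightarrow> real) set set"
  where "eps_cubes d \<epsilon> =
    {Q. (\<exists>a. Q = (\<Pi>\<^sub>E i\<in>{..<d}. {a i<..<a i + \<epsilon>})) \<and> Q \<subseteq> (\<Pi>\<^sub>E i\<in>{..<d}. {0<..<1})}"

definition cube_families :: "nat \<Rightarrow> real \<Rightarrow> (nat \<Rightarrow> real) set set set"
  where "cube_families d \<epsilon> =
    {F. F \<subseteq> eps_cubes d \<epsilon> \<and> disjoint F \<and> finite F \<and> real (card F) \<le> \<epsilon> powi (1 - int d)}"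

definition cube_mean :: "nat \<Rightarrow> ((nat \<Rightarrow> real) \<Rightarrow> complex) \<Rightarrow> (nat \<Rightarrow> real) set \<Rightarrow> complex"
  where "cube_mean d f Q =
    (LINT x:Q|cube_measure d. f x) / complex_of_real (measure (cube_measure d) Q)"

definition mean_oscillation :: "nat \<Rightarrow> ((nat \<Rightarrow> real) \<Rightarrow> complex) \<Rightarrow> (nat \<Rightarrow> real) set \<Rightarrow> real"
  where "mean_oscillation d f Q =
    1 / measure (cube_measure d) Q * (LINT x:Q|cube_measure d. cmod (f x - cube_mean d f Q))"

definition bbm_eps :: "nat \<Rightarrow> real \<Rightarrow> ((nat \<Rightarrow> real) \<Rightarrow> complex) \<Rightarrow> ennreal"
  where "bbm_eps d \<epsilon> f = ennreal (\<epsilon> ^ (d - 1)) *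
    (SUP F\<in>cube_families d \<epsilon>. ennreal (\<Sum>Q\<in>F. mean_oscillation d f Q))"

definition bbm_norm :: "nat \<Rightarrow> ((nat \<Rightarrow> real) \<Rightarrow> complex) \<Rightarrow> ennreal"
  where "bbm_norm d f = (SUP \<epsilon>\<in>{0<..1}. bbm_eps d \<epsilon> f)"

definition bbm_functions :: "nat \<Rightarrow> ((nat \<Rightarrow> real) \<Rightarrow> complex) set"
  where "bbm_functions d = {f. integrable (cube_measure d) f \<and> bbm_norm d f < \<infinity>}"

definition bbm_rel :: "nat \<Rightarrow> ((nat \<Rightarrow> real) \<Rightarrow> complex) rel"
  where "bbm_rel d = {(f, g). f \<in> bbm_functions d \<and> g \<in> bbm_functions d \<and>
    (\<exists>c. AE x in cube_measure d. f x = g x + c)}"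

definition bbm_class :: "nat \<Rightarrow> ((nat \<Rightarrow> real) \<Rightarrow> complex) \<Rightarrow> ((nat \<Rightarrow> real) \<Rightarrow> complex) set"
  where "bbm_class d f = bbm_rel d `` {f}"

definition bbm_rep :: "((nat \<Rightarrow> real) \<Rightarrow> complex) set \<Rightarrow> (nat \<Rightarrow> real) \<Rightarrow> complex"
  where "bbm_rep X = (SOME f. f \<in> X)"

definition bbm_space :: "nat \<Rightarrow> ((nat \<Rightarrow> real) \<Rightarrow> complex) set normed_module"
  where "bbm_space d =
    \<lparr>carrier = bbm_functions d // bbm_rel d,
     monoid.mult = undefined,
     one = undefined,
     zero = bbm_class d (\<lambda>x. 0),
     add = (\<lambda>X Y. bbm_class d (\<lambda>x. bbm_rep X x + bbm_rep Y x)),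
     smult = (\<lambda>c X. bbm_class d (\<lambda>x. c * bbm_rep X x)),
     nrm = (\<lambda>X. enn2real (bbm_norm d (bbm_rep X)))\<rparr>"


section \<open>Atoms\<close>

definition bbm_atom :: "nat \<Rightarrow> ((nat \<Rightarrow> real) \<Rightarrow> complex) \<Rightarrow> bool"
  where "bbm_atom d g \<longleftrightarrow> g \<in> borel_measurable (cube_measure d) \<and>
    (\<exists>\<epsilon>\<in>{0<..1}. \<exists>F\<in>cube_families d \<epsilon>.
      (AE x in cube_measure d. x \<notin> \<Union>F \<longrightarrow> g x = 0) \<and>
      (\<forall>Q\<in>F. AE x in cube_measure d.
        cmod (g x) * indicator Q x \<le> \<epsilon> ^ (d - 1) * (1 / measure (cube_measure d) Q)) \<and>
      (\<forall>Q\<in>F. (LINT x:Q|cube_measure d. g x) = 0))"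

definition atom_functional ::
    "nat \<Rightarrow> ((nat \<Rightarrow> real) \<Rightarrow> complex) \<Rightarrow> ((nat \<Rightarrow> real) \<Rightarrow> complex) set \<Rightarrow> complex"
  where "atom_functional d g =
    (\<lambda>X\<in>carrier (bbm_space d). LINT x|cube_measure d. bbm_rep X x * g x)"

definition atomic_representation ::
    "nat \<Rightarrow> (((nat \<Rightarrow> real) \<Rightarrow> complex) set \<Rightarrow> complex) \<Rightarrow> (nat \<Rightarrow> complex) \<Rightarrow>
      (nat \<Rightarrow> (nat \<Rightarrow> real) \<Rightarrow> complex) \<Rightarrow> bool"
  where "atomic_representation d \<phi> c g \<longleftrightarrow>
    summable (\<lambda>n. cmod (c n)) \<and> (\<forall>n. bbm_atom d (g n)) \<and>
    nrm_sums (dual (bbm_space d))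
      (\<lambda>n. c n \<odot>\<^bsub>dual (bbm_space d)\<^esub> atom_functional d (g n)) \<phi>"

definition atomic_norm ::
    "nat \<Rightarrow> (((nat \<Rightarrow> real) \<Rightarrow> complex) set \<Rightarrow> complex) \<Rightarrow> real"
  where "atomic_norm d \<phi> =
    Inf {\<Sum>n. cmod (c n) | c. \<exists>g. atomic_representation d \<phi> c g}"

end

theory Submission
  imports Defs
begin

text \<open>
  Take \<open>P\<close> to be the closed span of the atoms in the dual of \<open>\<B>\<close>, and \<open>C = 1/2\<close>.

  Testing \<open>f\<close> on each cube against the conjugate sign of \<open>f - f\<^sub>Q\<close>, corrected to have mean zero and
  halved, gives atoms \<open>a\<close> with \<open>2 a\<close> in the unit ball of the dual and \<open>2 a f\<close> arbitrarily close to
  \<open>\<parallel>f\<parallel>\<close>. Hence \<open>\<B>\<close> embeds isometrically in the dual of \<open>P\<close>.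

  The embedding is onto because the unit ball of \<open>\<B>\<close>, normalised by mean zero, is uniformly
  integrable. In the Calderon--Zygmund decomposition of \<open>f\<close> at height \<open>2 ^ (d * s)\<close> only cubes of
  side \<open>2 ^ -j\<close> with \<open>j > s\<close> are stopped; those of one level split into admissible families, each of
  which contributes at most \<open>2 ^ -j\<close> to the \<open>L\<^sup>1\<close> norm of the bad part, which is therefore small. So a
  bounded functional \<open>L\<close> on \<open>P\<close> gives a functional \<open>g \<mapsto> L (g - mean g)\<close> on bounded functions that is
  controlled by \<open>C\<^sub>\<delta> \<parallel>g\<parallel>\<^sub>1 + \<delta> \<parallel>g\<parallel>\<^sub>\<infinity>\<close> for every \<open>\<delta>\<close>, and Radon--Nikodym represents it by some
  \<open>f \<in> L\<^sup>1\<close>; the norming atoms show that \<open>f \<in> \<B>\<close>.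

  A functional on \<open>P\<close> that is at most 1 on all atoms is therefore an \<open>f\<close> with \<open>\<parallel>f\<parallel> \<le> 2\<close>. By
  Hahn--Banach every \<open>\<phi> \<in> P\<close> is approximated by combinations of atoms of cost at most
  \<open>2 \<parallel>\<phi>\<parallel> + \<eta>\<close>, and iterating on the remainder gives an atomic series.
\<close>

section \<open>Hahn--Banach on complex modules\<close>

text \<open>The hard point is that a bounded functional on the predual is given by a function: on
  bounded functions it could a priori be merely finitely additive. Smallness on small sets has to
  come from the norm of the BBM space alone, and the cardinality restriction on families is just
  enough for it. Of the (2 p) ^ j cells of level j an admissible family holds only p ^ j; a stopped
  set of measure m therefore takes about 2 ^ j m + 1 families contributing 2 ^ -j each, that is m +
  2 ^ -j. The terms m add up to at most 2 ^ -s because stopping at a height of at least 2 ^ s is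
  rare, the terms 2 ^ -j because only levels above s occur. The constant 1/2 has a single origin:
  subtracting its mean can double a function of modulus at most 1. The isometry does not suffer from
  it, since the doubled test functional still has norm at most 1. Completeness of the BBM space is
  not shown by hand; it is pulled back from the dual of the predual once the embedding is known to
  be isometric and onto.\<close>

lemma complex_ring_simps [simp]:
  "carrier complex_ring = UNIV" "x \<otimes>\<^bsub>complex_ring\<^esub> y = x * y" "\<one>\<^bsub>complex_ring\<^esub> = 1"
  "\<zero>\<^bsub>complex_ring\<^esub> = 0" "x \<oplus>\<^bsub>complex_ring\<^esub> y = x + y"
  by (simp_all add: complex_ring_def)

lemma cring_complex_ring: "cring complex_ring"
proof (rule cringI)
  show "abelian_group complex_ring"
    by (rule abelian_groupI) (auto intro: exI[of _ "- _"] simp: eq_neg_iff_add_eq_0[symmetric])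
  show "comm_monoid complex_ring"
    by (rule comm_monoidI) auto
qed (auto simp: distrib_right)

lemma complex_ring_minus [simp]: "\<ominus>\<^bsub>complex_ring\<^esub> x = - x"
proof -
  interpret cring complex_ring by (rule cring_complex_ring)
  show ?thesis by (rule minus_equality) auto
qed

text \<open>No norm yet: Hahn--Banach is applied to a gauge other than the norm, on the carrier of a
  closed span, so it is developed for a bare module with an arbitrary record extension.\<close>

locale complex_module = module complex_ring V for V :: "(complex, 'v, 'm) module_scheme" (structure)
begin

lemma smult_minus_one: "x \<in> carrier V \<Longrightarrow> (-1) \<odot> x = \<ominus> x"
  using smult_l_minus[of 1 x] smult_one by simp

lemma smult_closed' [simp, intro]: "x \<in> carrier V \<Longrightarrow> c \<odot> x \<in> carrier V"
  by (rule smult_closed) auto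

lemma smult_add: "x \<in> carrier V \<Longrightarrow> (c + c') \<odot> x = c \<odot> x \<oplus> c' \<odot> x"
  using smult_l_distr[of c c' x] by simp

lemma smult_mult: "x \<in> carrier V \<Longrightarrow> (c * c') \<odot> x = c \<odot> (c' \<odot> x)"
  using smult_assoc1[of c c' x] by simp

lemma smult_1 [simp]: "x \<in> carrier V \<Longrightarrow> 1 \<odot> x = x"
  using smult_one[of x] by simp

lemma smult_0 [simp]: "x \<in> carrier V \<Longrightarrow> 0 \<odot> x = \<zero>"
  using smult_l_null[of x] by simp

lemma smult_right_distrib: "x \<in> carrier V \<Longrightarrow> y \<in> carrier V \<Longrightarrow> c \<odot> (x \<oplus> y) = c \<odot> x \<oplus> c \<odot> y"
  by (rule smult_r_distr) auto

section \<open>Sublinear functionals and linear functionals below them\<close>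

definition sublinear :: "('v \<Rightarrow> real) \<Rightarrow> bool" where
  "sublinear q \<longleftrightarrow> (\<forall>x\<in>carrier V. \<forall>y\<in>carrier V. q (x \<oplus> y) \<le> q x + q y) \<and>
    (\<forall>t>0. \<forall>x\<in>carrier V. q (complex_of_real t \<odot> x) \<le> t * q x)"

lemma sublinear_add: "sublinear q \<Longrightarrow> x \<in> carrier V \<Longrightarrow> y \<in> carrier V \<Longrightarrow> q (x \<oplus> y) \<le> q x + q y"
  by (auto simp: sublinear_def)

text \<open>Only one inequality is part of \<open>sublinear\<close>; the reverse one is the same
  inequality for the factor 1 / t, applied to t x.\<close>

lemma sublinear_scale:
  assumes "sublinear q" "x \<in> carrier V" "t > 0"
  shows "q (complex_of_real t \<odot> x) = t * q x"
proof (rule antisym)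
  have "q x = q (complex_of_real (1/t) \<odot> (complex_of_real t \<odot> x))"
    using assms smult_mult[of x "complex_of_real (1/t)" "complex_of_real t"] by simp
  also have "\<dots> \<le> (1/t) * q (complex_of_real t \<odot> x)"
    using assms by (intro sublinear_def[THEN iffD1, THEN conjunct2, rule_format]) auto
  finally show "t * q x \<le> q (complex_of_real t \<odot> x)"
    using assms by (simp add: field_simps)
qed (use assms in \<open>auto simp: sublinear_def\<close>)

lemma sublinear_zero: "sublinear q \<Longrightarrow> q \<zero> = 0"
  using sublinear_scale[of q \<zero> 2] smult_r_null[of 2] by simp

lemma sublinear_scale0:
  assumes "sublinear q" "x \<in> carrier V" "t \<ge> 0"
  shows "q (complex_of_real t \<odot> x) = t * q x"
  using assms sublinear_scale[of q x t] sublinear_zero[of q] by (cases "t = 0") auto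

lemma sublinear_neg: "sublinear q \<Longrightarrow> x \<in> carrier V \<Longrightarrow> - q (\<ominus> x) \<le> q x"
  using sublinear_add[of q x "\<ominus> x"] sublinear_zero[of q] by (simp add: r_neg)

text \<open>Lowers \<open>q\<close> along the ray through \<open>y\<close>: the value at \<ominus> y
  drops to at most - q y, so a linear functional below it is at least q y at \<open>y\<close>. Off
  the carrier it stays \<open>q\<close>, because the use of Zorn's lemma below compares whole
  functions.\<close>

definition sublinear_shift :: "('v \<Rightarrow> real) \<Rightarrow> 'v \<Rightarrow> 'v \<Rightarrow> real" where
  "sublinear_shift q y = (\<lambda>x. if x \<in> carrier V
     then INF t\<in>{0..}. q (x \<oplus> complex_of_real t \<odot> y) - t * q y else q x)"

text \<open>Subadditivity for t y = (x + t y) + (- x). The bound does not depend on t, so the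
  infimum in \<open>sublinear_shift\<close> runs over a set that is bounded below.\<close>

lemma sublinear_shift_bound:
  assumes "sublinear q" "x \<in> carrier V" "y \<in> carrier V" "t \<ge> 0"
  shows "- q (\<ominus> x) \<le> q (x \<oplus> complex_of_real t \<odot> y) - t * q y"
proof -
  have "complex_of_real t \<odot> y = (x \<oplus> complex_of_real t \<odot> y) \<oplus> \<ominus> x"
    using assms by (simp add: a_ac r_neg)
      (metis (no_types, lifting) M.a_closed a_assoc M.a_comm a_inv_closed r_neg2 smult_closed')
  hence "t * q y \<le> q (x \<oplus> complex_of_real t \<odot> y) + q (\<ominus> x)"
    using assms sublinear_add[of q "x \<oplus> complex_of_real t \<odot> y" "\<ominus> x"] sublinear_scale0[of q y t] by auto
  thus ?thesis by simp
qed

lemma sublinear_shift_le: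
  assumes "sublinear q" "x \<in> carrier V" "y \<in> carrier V" "t \<ge> 0"
  shows "sublinear_shift q y x \<le> q (x \<oplus> complex_of_real t \<odot> y) - t * q y"
  unfolding sublinear_shift_def using assms sublinear_shift_bound[OF assms(1-3)]
  by (auto intro!: cINF_lower bdd_belowI2)

lemma sublinear_shift_le_self:
  assumes "sublinear q" "y \<in> carrier V" shows "sublinear_shift q y x \<le> q x"
  using sublinear_shift_le[OF assms(1) _ assms(2), of x 0] assms
  by (cases "x \<in> carrier V") (auto simp: sublinear_shift_def)

lemma sublinear_shift_greatest:
  assumes "x \<in> carrier V" "\<And>t. t \<ge> 0 \<Longrightarrow> a \<le> q (x \<oplus> complex_of_real t \<odot> y) - t * q y"
  shows "a \<le> sublinear_shift q y x"
  unfolding sublinear_shift_def using assms by (auto intro!: cINF_greatest)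

lemma sublinear_shift_neg:
  assumes "sublinear q" "y \<in> carrier V" shows "sublinear_shift q y (\<ominus> y) \<le> - q y"
  using sublinear_shift_le[OF assms(1) _ assms(2), of "\<ominus> y" 1] assms sublinear_zero[of q]
  by (auto simp: l_neg)

text \<open>Shifts by t and t' combine into a shift by t + t', and the infimum is taken over one
  parameter at a time; scaling by t turns the parameter r into t * r.\<close>

lemma sublinear_shift_sublinear:
  assumes q: "sublinear q" and y: "y \<in> carrier V" shows "sublinear (sublinear_shift q y)"
  unfolding sublinear_def
proof (intro conjI ballI allI impI)
  fix x x' assume x: "x \<in> carrier V" "x' \<in> carrier V"
  let ?s = "sublinear_shift q y"
  have *: "?s (x \<oplus> x') \<le> (q (x \<oplus> complex_of_real t \<odot> y) - t * q y) + (q (x' \<oplus> complex_of_real t' \<odot> y) - t' * q y)"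
    if "t \<ge> 0" "t' \<ge> 0" for t t'
  proof -
    have "?s (x \<oplus> x') \<le> q ((x \<oplus> x') \<oplus> complex_of_real (t + t') \<odot> y) - (t + t') * q y"
      using sublinear_shift_le[OF q _ y, of "x \<oplus> x'" "t + t'"] that x by auto
    also have "(x \<oplus> x') \<oplus> complex_of_real (t + t') \<odot> y =
        (x \<oplus> complex_of_real t \<odot> y) \<oplus> (x' \<oplus> complex_of_real t' \<odot> y)"
      using x y by (simp add: smult_add a_ac)
    also have "q \<dots> \<le> q (x \<oplus> complex_of_real t \<odot> y) + q (x' \<oplus> complex_of_real t' \<odot> y)"
      using x y by (intro sublinear_add[OF q]) auto
    finally show ?thesis by (simp add: algebra_simps)
  qed
  have "?s (x \<oplus> x') - ?s x' \<le> ?s x"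
  proof (rule sublinear_shift_greatest[OF x(1)])
    fix t :: real assume t: "t \<ge> 0"
    have "?s (x \<oplus> x') - (q (x \<oplus> complex_of_real t \<odot> y) - t * q y) \<le> ?s x'"
      by (rule sublinear_shift_greatest[OF x(2)]) (use * t in fastforce)
    thus "?s (x \<oplus> x') - ?s x' \<le> q (x \<oplus> complex_of_real t \<odot> y) - t * q y" by simp
  qed
  thus "?s (x \<oplus> x') \<le> ?s x + ?s x'" by simp
next
  fix t :: real and x assume t: "0 < t" and x: "x \<in> carrier V"
  let ?s = "sublinear_shift q y"
  have "?s (complex_of_real t \<odot> x) / t \<le> ?s x"
  proof (rule sublinear_shift_greatest[OF x])
    fix r :: real assume r: "r \<ge> 0"
    have "?s (complex_of_real t \<odot> x) \<le> q (complex_of_real t \<odot> x \<oplus> complex_of_real (t * r) \<odot> y) - (t * r) * q y"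
      using sublinear_shift_le[OF q _ y, of "complex_of_real t \<odot> x" "t * r"] t r x by auto
    also have "complex_of_real t \<odot> x \<oplus> complex_of_real (t * r) \<odot> y = complex_of_real t \<odot> (x \<oplus> complex_of_real r \<odot> y)"
      using x y by (simp add: smult_mult smult_right_distrib)
    also have "q \<dots> = t * q (x \<oplus> complex_of_real r \<odot> y)"
      using x y t by (intro sublinear_scale[OF q]) auto
    finally show "?s (complex_of_real t \<odot> x) / t \<le> q (x \<oplus> complex_of_real r \<odot> y) - r * q y"
      using t by (simp add: field_simps)
  qed
  thus "?s (complex_of_real t \<odot> x) \<le> t * ?s x" using t by (simp add: field_simps)
qed

text \<open>A minimal sublinear functional m is linear: its shift along any y is sublinear and below
  m, hence equal to m, which forces m (- y) = - m y, and an odd sublinear functional is additive.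
  Minimality comes from Zorn's lemma with the pointwise order reversed.\<close>

lemma ex_linear_below:
  assumes p: "sublinear p"
  obtains m where "m \<le> p"
    "\<And>x x'. x \<in> carrier V \<Longrightarrow> x' \<in> carrier V \<Longrightarrow> m (x \<oplus> x') = m x + m x'"
    "\<And>t x. x \<in> carrier V \<Longrightarrow> m (complex_of_real t \<odot> x) = t * m x"
proof -
  \<comment> \<open>Fixing the values off the carrier gives every chain a lower bound there as well;
    on the carrier the bound is - p (\<ominus> x).\<close>
  define S where "S = {q. sublinear q \<and> q \<le> p \<and> (\<forall>x. x \<notin> carrier V \<longrightarrow> q x = p x)}"
  have "\<exists>m\<in>S. \<forall>a\<in>S. a \<le> m \<longrightarrow> a = m"
  proof (rule predicate_Zorn[where P = "\<lambda>a b. b \<le> a"])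
    show "partial_order_on S (relation_of (\<lambda>a b. b \<le> a) S)"
      by (rule partial_order_on_relation_ofI) auto
  next
    fix C assume C: "C \<in> Chains (relation_of (\<lambda>a b. b \<le> a) S)"
    show "\<exists>u\<in>S. \<forall>a\<in>C. u \<le> a"
    proof (cases "C = {}")
      case True
      thus ?thesis using p by (intro bexI[of _ p]) (auto simp: S_def)
    next
      case False
      have CS: "C \<subseteq> S" using Chains_relation_of[OF C] .
      have tot: "a \<le> b \<or> b \<le> a" if "a \<in> C" "b \<in> C" for a b
        using C that by (auto simp: Chains_def relation_of_def)
      define u where "u x = (INF q\<in>C. q x)" for x
      have bdd: "bdd_below ((\<lambda>q. q x) ` C)" for x
      proof (cases "x \<in> carrier V")
        case True
        have "- p (\<ominus> x) \<le> q x" if "q \<in> C" for q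
          using sublinear_neg[of q x] True that CS by (force simp: S_def le_fun_def intro: order_trans[of _ "- q (\<ominus> x)"])
        thus ?thesis by (intro bdd_belowI2)
      next
        case False
        thus ?thesis using CS by (intro bdd_belowI2[of _ "p x"]) (force simp: S_def)
      qed
      have low: "u x \<le> q x" if "q \<in> C" for q x
        unfolding u_def using bdd that by (rule cINF_lower)
      have gr: "a \<le> u x" if "\<And>q. q \<in> C \<Longrightarrow> a \<le> q x" for a x
        unfolding u_def using False that by (intro cINF_greatest) auto
      have "sublinear u" unfolding sublinear_def
      proof (intro conjI ballI allI impI)
        fix x y assume xy: "x \<in> carrier V" "y \<in> carrier V"
        \<comment> \<open>Two members of a chain are comparable, so the subadditivity of the smaller
          of q and r serves both arguments.\<close>
        have *: "u (x \<oplus> y) \<le> q x + r y" if "q \<in> C" "r \<in> C" for q r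
        proof (cases "q \<le> r")
          case True
          have "u (x \<oplus> y) \<le> q (x \<oplus> y)" using low that by auto
          also have "\<dots> \<le> q x + q y" using xy that CS by (auto simp: S_def sublinear_add)
          finally show ?thesis using True by (auto simp: le_fun_def intro: order_trans)
        next
          case False
          hence "r \<le> q" using tot that by auto
          have "u (x \<oplus> y) \<le> r (x \<oplus> y)" using low that by auto
          also have "\<dots> \<le> r x + r y" using xy that CS by (auto simp: S_def sublinear_add)
          finally show ?thesis using \<open>r \<le> q\<close> by (auto simp: le_fun_def intro: order_trans)
        qed
        have "u (x \<oplus> y) - u y \<le> u x"
        proof (rule gr)
          fix q assume q: "q \<in> C"
          have "u (x \<oplus> y) - q x \<le> u y" by (rule gr) (use * q in fastforce)
          thus "u (x \<oplus> y) - u y \<le> q x" by simp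
        qed
        thus "u (x \<oplus> y) \<le> u x + u y" by simp
      next
        fix t :: real and x assume t: "0 < t" "x \<in> carrier V"
        have "u (complex_of_real t \<odot> x) / t \<le> u x"
        proof (rule gr)
          fix q assume q: "q \<in> C"
          have "u (complex_of_real t \<odot> x) \<le> q (complex_of_real t \<odot> x)" using low q by auto
          also have "\<dots> = t * q x" using t q CS by (intro sublinear_scale) (auto simp: S_def)
          finally show "u (complex_of_real t \<odot> x) / t \<le> q x" using t by (simp add: field_simps)
        qed
        thus "u (complex_of_real t \<odot> x) \<le> t * u x" using t by (simp add: field_simps)
      qed
      moreover have "u \<le> p"
      proof (rule le_funI)
        fix x
        obtain q where q: "q \<in> C" using False by auto
        hence "q x \<le> p x" using CS by (auto simp: S_def le_fun_def)
        thus "u x \<le> p x" using low[OF q, of x] by simp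
      qed
      moreover have "u x = p x" if "x \<notin> carrier V" for x
      proof -
        have "\<And>q. q \<in> C \<Longrightarrow> q x = p x" using CS that by (auto simp: S_def)
        hence "(\<lambda>q. q x) ` C = {p x}" using False by auto
        thus ?thesis by (simp add: u_def)
      qed
      ultimately show ?thesis using low by (intro bexI[of _ u]) (auto simp: S_def le_fun_def)
    qed
  qed
  then obtain m where m: "m \<in> S" "\<And>a. a \<in> S \<Longrightarrow> a \<le> m \<Longrightarrow> a = m" by blast
  have mS: "sublinear m" "m \<le> p" using m by (auto simp: S_def)
  have odd: "m (\<ominus> y) = - m y" if y: "y \<in> carrier V" for y
  proof -
    have "sublinear_shift m y \<le> p"
      by (intro le_funI order_trans[OF sublinear_shift_le_self[OF mS(1) y] le_funD[OF mS(2)]])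
    hence "sublinear_shift m y \<in> S"
      using sublinear_shift_sublinear[OF mS(1) y] m(1)
      by (auto simp: S_def sublinear_shift_def)
    hence "sublinear_shift m y = m"
      using m(2) le_funI[of "sublinear_shift m y" m, OF sublinear_shift_le_self[OF mS(1) y]] by blast
    thus ?thesis using sublinear_shift_neg[OF mS(1) y] sublinear_neg[OF mS(1) y] by simp
  qed
  show ?thesis
  proof (rule that[of m])
    fix x y assume xy: "x \<in> carrier V" "y \<in> carrier V"
    have "m x = m ((x \<oplus> y) \<oplus> \<ominus> y)" using xy by (simp add: a_assoc r_neg)
    also have "\<dots> \<le> m (x \<oplus> y) + m (\<ominus> y)" using xy by (intro sublinear_add mS) auto
    finally show "m (x \<oplus> y) = m x + m y"
      using odd[OF xy(2)] sublinear_add[OF mS(1) xy] by simp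
  next
    fix t :: real and x assume x: "x \<in> carrier V"
    show "m (complex_of_real t \<odot> x) = t * m x"
    proof (cases "t \<ge> 0")
      case True thus ?thesis using sublinear_scale0 mS(1) x by blast
    next
      case False
      have "complex_of_real t \<odot> x = \<ominus> (complex_of_real (- t) \<odot> x)"
        using x smult_mult[of x "-1" "complex_of_real (-t)"] by (simp add: smult_minus_one[symmetric])
      thus ?thesis using odd[of "complex_of_real (- t) \<odot> x"] x False
        sublinear_scale0[OF mS(1) x, of "- t"] by simp
    qed
  qed (use mS in auto)
qed

text \<open>No functional is extended from a subspace: searching below
  \<open>sublinear_shift p y\<close> instead of p already forces u y \<ge> p y.\<close>

lemma Hahn_Banach_sublinear:
  assumes p: "sublinear p" and y: "y \<in> carrier V"
  obtains u where "\<And>x x'. x \<in> carrier V \<Longrightarrow> x' \<in> carrier V \<Longrightarrow> u (x \<oplus> x') = u x + u x'"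
    "\<And>t x. x \<in> carrier V \<Longrightarrow> u (complex_of_real t \<odot> x) = t * u x"
    "\<And>x. u x \<le> p x" "u y = p y"
proof -
  obtain u where u: "\<And>x x'. x \<in> carrier V \<Longrightarrow> x' \<in> carrier V \<Longrightarrow> u (x \<oplus> x') = u x + u x'"
    "\<And>t x. x \<in> carrier V \<Longrightarrow> u (complex_of_real t \<odot> x) = t * u x" and u0: "u \<le> sublinear_shift p y"
    by (rule ex_linear_below[OF sublinear_shift_sublinear[OF p y]]) blast
  note u = u le_funD[OF u0]
  have le: "u x \<le> p x" for x using u(3)[of x] sublinear_shift_le_self[OF p y, of x] by simp
  have "u (\<ominus> y) \<le> - p y" using u(3)[of "\<ominus> y"] sublinear_shift_neg[OF p y] by simp
  moreover have "u (\<ominus> y) = - u y" using u(2)[of y "-1"] y by (simp add: smult_minus_one)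
  ultimately have "u y = p y" using le[of y] by simp
  with u le show ?thesis by (intro that[of u]) auto
qed

text \<open>The complex functional is recovered from its real part \<open>u\<close> as \<open>u x - i u (i x)\<close>.\<close>

lemma Hahn_Banach_seminorm:
  assumes p: "\<And>x x'. x \<in> carrier V \<Longrightarrow> x' \<in> carrier V \<Longrightarrow> p (x \<oplus> x') \<le> p x + p x'"
    "\<And>c x. x \<in> carrier V \<Longrightarrow> p (c \<odot> x) = cmod c * p x" and y: "y \<in> carrier V"
  obtains L where "\<And>x x'. x \<in> carrier V \<Longrightarrow> x' \<in> carrier V \<Longrightarrow> L (x \<oplus> x') = L x + L x'"
    "\<And>c x. x \<in> carrier V \<Longrightarrow> L (c \<odot> x) = c * L x"
    "\<And>x. x \<in> carrier V \<Longrightarrow> cmod (L x) \<le> p x" "Re (L y) = p y"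
proof -
  have "sublinear p" unfolding sublinear_def using p by auto
  then obtain u where u: "\<And>x x'. x \<in> carrier V \<Longrightarrow> x' \<in> carrier V \<Longrightarrow> u (x \<oplus> x') = u x + u x'"
    "\<And>t x. x \<in> carrier V \<Longrightarrow> u (complex_of_real t \<odot> x) = t * u x"
    "\<And>x. u x \<le> p x" "u y = p y"
    using Hahn_Banach_sublinear[OF _ y] by metis
  define L where "L x = Complex (u x) (- u (\<i> \<odot> x))" for x
  have ui: "u (c \<odot> x) = Re c * u x + Im c * u (\<i> \<odot> x)" if x: "x \<in> carrier V" for c x
  proof -
    have "c \<odot> x = complex_of_real (Re c) \<odot> x \<oplus> complex_of_real (Im c) \<odot> (\<i> \<odot> x)"
      using x by (simp add: smult_mult[symmetric] smult_add[symmetric] complex_eq[symmetric] mult.commute)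
    thus ?thesis using x u(1,2) by simp
  qed
  have add: "L (x \<oplus> x') = L x + L x'" if "x \<in> carrier V" "x' \<in> carrier V" for x x'
    using that by (simp add: L_def u(1) smult_right_distrib complex_eq_iff)
  have smul: "L (c \<odot> x) = c * L x" if x: "x \<in> carrier V" for c x
    using x ui[OF x, of c] ui[OF x, of "\<i> * c"]
    by (simp add: L_def complex_eq_iff smult_mult[symmetric])
  have "cmod (L x) \<le> p x" if x: "x \<in> carrier V" for x
  proof (cases "L x = 0")
    case True
    have "p \<zero> = 0" using p(2)[of \<zero> 0] by simp
    moreover have "p \<zero> \<le> p x + p (\<ominus> x)" using p(1)[of x "\<ominus> x"] x by (simp add: r_neg)
    moreover have "p (\<ominus> x) = p x" using p(2)[of x "-1"] x by (simp add: smult_minus_one)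
    ultimately show ?thesis using True by simp
  next
    case False
    \<comment> \<open>A factor of modulus 1 that rotates L x to its modulus; there L coincides with
      its real part u, which is bounded by p.\<close>
    define c where "c = cnj (L x) / complex_of_real (cmod (L x))"
    have "L (c \<odot> x) = complex_of_real (cmod (L x))"
      using False complex_norm_square[of "L x"] by (simp add: smul[OF x] c_def field_simps power2_eq_square)
    hence "cmod (L x) = u (c \<odot> x)" by (simp add: L_def complex_eq_iff)
    also have "\<dots> \<le> p (c \<odot> x)" by (rule u(3))
    also have "\<dots> = p x" using False by (simp add: p(2)[OF x] c_def norm_divide)
    finally show ?thesis .
  qed
  moreover have "Re (L y) = p y" using u(4) by (simp add: L_def)
  ultimately show ?thesis using add smul by (intro that[of L]) auto
qed

end

section \<open>Normed spaces and their duals\<close>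

sublocale complex_normed_space \<subseteq> complex_module V
  by unfold_locales

context complex_normed_space
begin

lemma nrm_zero [simp]: "nrm V \<zero> = 0"
  using nrm_eq_0[of \<zero>] by simp

lemma nrm_uminus [simp]: "x \<in> carrier V \<Longrightarrow> nrm V (\<ominus> x) = nrm V x"
  using nrm_smult[of x "-1"] by (simp add: smult_minus_one)

lemma nrm_minus_commute: "x \<in> carrier V \<Longrightarrow> y \<in> carrier V \<Longrightarrow> nrm V (x \<ominus> y) = nrm V (y \<ominus> x)"
  using nrm_uminus[of "x \<ominus> y"] by (simp add: minus_eq minus_add M.a_comm)

lemma nrm_minus_triangle:
  assumes "x \<in> carrier V" "y \<in> carrier V" "z \<in> carrier V"
  shows "nrm V (x \<ominus> z) \<le> nrm V (x \<ominus> y) + nrm V (y \<ominus> z)"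
proof -
  have "x \<ominus> z = (x \<ominus> y) \<oplus> (y \<ominus> z)"
    using assms by (simp add: minus_eq a_assoc) (metis M.a_inv_closed M.add.inv_solve_left M.a_closed)
  thus ?thesis using assms nrm_triangle[of "x \<ominus> y" "y \<ominus> z"] by simp
qed

lemma Metric_space_nrm_dist: "Metric_space (carrier V) (nrm_dist V)"
proof
  show "nrm_dist V x y = nrm_dist V y x" for x y
    by (auto simp: nrm_dist_def nrm_minus_commute)
  show "x \<in> carrier V \<Longrightarrow> y \<in> carrier V \<Longrightarrow> (nrm_dist V x y = 0) = (x = y)" for x y
    using nrm_eq_0[of "x \<ominus> y"] M.minus_equality[of x "\<ominus> y"]
    by (auto simp: nrm_dist_def minus_eq r_neg)
qed (auto simp: nrm_dist_def nrm_nonneg nrm_minus_triangle)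

lemma complex_banach_iff:
  "complex_banach V \<longleftrightarrow> (\<forall>\<sigma>::nat \<Rightarrow> _. range \<sigma> \<subseteq> carrier V \<longrightarrow>
     (\<forall>e>0. \<exists>N. \<forall>m\<ge>N. \<forall>n\<ge>N. nrm V (\<sigma> m \<ominus> \<sigma> n) < e) \<longrightarrow>
     (\<exists>x\<in>carrier V. \<forall>e>0. \<exists>N. \<forall>n\<ge>N. nrm V (\<sigma> n \<ominus> x) < e))"
proof -
  interpret Metric_space "carrier V" "nrm_dist V" by (rule Metric_space_nrm_dist)
  have 1: "MCauchy \<sigma> \<longleftrightarrow> range \<sigma> \<subseteq> carrier V \<and>
     (\<forall>e>0. \<exists>N. \<forall>m\<ge>N. \<forall>n\<ge>N. nrm V (\<sigma> m \<ominus> \<sigma> n) < e)" for \<sigma>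
    by (auto simp: MCauchy_def nrm_dist_def image_subset_iff; meson)
  have 2: "limitin mtopology \<sigma> x sequentially \<longleftrightarrow>
      x \<in> carrier V \<and> (\<forall>e>0. \<exists>N. \<forall>n\<ge>N. nrm V (\<sigma> n \<ominus> x) < e)" if "range \<sigma> \<subseteq> carrier V" for \<sigma> :: "nat \<Rightarrow> _" and x
    using that by (auto simp: limit_metric_sequentially nrm_dist_def image_subset_iff)
  have "complex_banach V \<longleftrightarrow> (\<forall>\<sigma>. MCauchy \<sigma> \<longrightarrow> (\<exists>x. limitin mtopology \<sigma> x sequentially))"
    unfolding complex_banach_def mcomplete_def using complex_normed_space_axioms by simp
  also have "\<dots> \<longleftrightarrow> (\<forall>\<sigma>::nat \<Rightarrow> _. range \<sigma> \<subseteq> carrier V \<longrightarrow> MCauchy \<sigma> \<longrightarrow> (\<exists>x. limitin mtopology \<sigma> x sequentially))"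
    unfolding MCauchy_def by blast
  also have "\<dots> \<longleftrightarrow> (\<forall>\<sigma>::nat \<Rightarrow> _. range \<sigma> \<subseteq> carrier V \<longrightarrow>
     (\<forall>e>0. \<exists>N. \<forall>m\<ge>N. \<forall>n\<ge>N. nrm V (\<sigma> m \<ominus> \<sigma> n) < e) \<longrightarrow>
     (\<exists>x\<in>carrier V. \<forall>e>0. \<exists>N. \<forall>n\<ge>N. nrm V (\<sigma> n \<ominus> x) < e))"
    by (simp only: 1 2 cong: imp_cong) (simp add: Bex_def)
  finally show ?thesis .
qed

lemma closedin_nrm_dist:
  assumes "P \<subseteq> carrier V"
    "\<And>x. x \<in> carrier V \<Longrightarrow> (\<And>e. e > 0 \<Longrightarrow> \<exists>y\<in>P. nrm V (x \<ominus> y) < e) \<Longrightarrow> x \<in> P"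
  shows "closedin (Metric_space.mtopology (carrier V) (nrm_dist V)) P"
proof -
  interpret Metric_space "carrier V" "nrm_dist V" by (rule Metric_space_nrm_dist)
  have "\<exists>r>0. disjnt P (mball x r)" if "x \<in> carrier V - P" for x
  proof -
    have "\<not> (\<forall>e>0. \<exists>y\<in>P. nrm V (x \<ominus> y) < e)"
      using assms(2)[of x] that by (metis DiffD1 DiffD2)
    then obtain e where e: "e > 0" "\<And>y. y \<in> P \<Longrightarrow> \<not> nrm V (x \<ominus> y) < e"
      by auto
    hence "disjnt P (mball x e)" using assms(1) by (fastforce simp: disjnt_def nrm_dist_def)
    thus ?thesis using e by blast
  qed
  thus ?thesis unfolding closedin_metric using assms(1) by blast
qed

lemma submodule_simps:
  assumes "submodule P complex_ring V"
  shows "P \<subseteq> carrier V" "\<zero> \<in> P" "x \<in> P \<Longrightarrow> y \<in> P \<Longrightarrow> x \<oplus> y \<in> P" "x \<in> P \<Longrightarrow> c \<odot> x \<in> P"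
    "x \<in> P \<Longrightarrow> y \<in> P \<Longrightarrow> x \<ominus> y \<in> P"
proof -
  show 1: "P \<subseteq> carrier V" and 2: "\<zero> \<in> P" and 3: "\<And>x y. x \<in> P \<Longrightarrow> y \<in> P \<Longrightarrow> x \<oplus> y \<in> P"
    and 4: "\<And>x c. x \<in> P \<Longrightarrow> c \<odot> x \<in> P"
    using submoduleE[OF assms] submoduleE(4)[OF assms, of 0] by (auto simp: subset_iff)
  show "x \<in> P \<Longrightarrow> y \<in> P \<Longrightarrow> x \<ominus> y \<in> P"
    using 1 3 4[of y "-1"] by (auto simp: smult_minus_one minus_eq)
qed

text \<open>Subtraction refers to an inverse chosen within the carrier, so its agreement with that
  of V is not definitional; in both modules it is addition of (-1) times the vector.\<close>

lemma complex_normed_space_submodule: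
  assumes P: "submodule P complex_ring V"
  shows "complex_normed_space (V\<lparr>carrier := P\<rparr>)"
    "x \<in> P \<Longrightarrow> y \<in> P \<Longrightarrow> x \<ominus>\<^bsub>V\<lparr>carrier := P\<rparr>\<^esub> y = x \<ominus> y"
proof -
  note S = submodule_simps[OF P]
  interpret P: module complex_ring "V\<lparr>carrier := P\<rparr>"
    by (rule submodule.submodule_is_module[OF P]) unfold_locales
  show "complex_normed_space (V\<lparr>carrier := P\<rparr>)"
    using S(1) by unfold_locales (auto simp: nrm_nonneg nrm_eq_0 nrm_triangle nrm_smult subset_iff)
  interpret PN: complex_module "V\<lparr>carrier := P\<rparr>" by unfold_locales
  show "x \<in> P \<Longrightarrow> y \<in> P \<Longrightarrow> x \<ominus>\<^bsub>V\<lparr>carrier := P\<rparr>\<^esub> y = x \<ominus> y"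
    using S(1) PN.smult_minus_one[of y] by (auto simp: a_minus_def smult_minus_one)
qed

lemma complex_banach_closed_submodule:
  assumes "complex_banach V" and P: "submodule P complex_ring V"
    and cl: "\<And>x. x \<in> carrier V \<Longrightarrow> (\<And>e. e > 0 \<Longrightarrow> \<exists>y\<in>P. nrm V (x \<ominus> y) < e) \<Longrightarrow> x \<in> P"
  shows "complex_banach (V\<lparr>carrier := P\<rparr>)"
proof -
  note S = submodule_simps[OF P]
  interpret P: complex_normed_space "V\<lparr>carrier := P\<rparr>"
    by (rule complex_normed_space_submodule[OF P])
  show ?thesis
  proof (rule P.complex_banach_iff[THEN iffD2], intro allI impI, simp)
    fix \<sigma> :: "nat \<Rightarrow> _"
    assume r: "range \<sigma> \<subseteq> P" and c: "\<forall>e>0. \<exists>N. \<forall>m\<ge>N. \<forall>n\<ge>N. nrm V (\<sigma> m \<ominus>\<^bsub>V\<lparr>carrier := P\<rparr>\<^esub> \<sigma> n) < e"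
    have \<sigma>: "\<sigma> n \<in> P" for n using r by auto
    have eq: "x \<ominus>\<^bsub>V\<lparr>carrier := P\<rparr>\<^esub> y = x \<ominus> y" if "x \<in> P" "y \<in> P" for x y
      using complex_normed_space_submodule(2)[OF P] that by auto
    obtain x where x: "x \<in> carrier V" "\<forall>e>0. \<exists>N. \<forall>n\<ge>N. nrm V (\<sigma> n \<ominus> x) < e"
      using complex_banach_iff[THEN iffD1, OF assms(1), rule_format, of \<sigma>] c order_trans[OF r S(1)]
      unfolding eq[OF \<sigma> \<sigma>] by blast
    have "x \<in> P"
    proof (rule cl[OF x(1)])
      fix e :: real assume "e > 0"
      then obtain N where "nrm V (\<sigma> N \<ominus> x) < e" using x(2) by blast
      thus "\<exists>y\<in>P. nrm V (x \<ominus> y) < e" using \<sigma>[of N] nrm_minus_commute[OF x(1), of "\<sigma> N"] subsetD[OF S(1) \<sigma>[of N]]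
        by (intro bexI[of _ "\<sigma> N"]) auto
    qed
    thus "\<exists>x\<in>P. \<forall>e>0. \<exists>N. \<forall>n\<ge>N. nrm V (\<sigma> n \<ominus>\<^bsub>V\<lparr>carrier := P\<rparr>\<^esub> x) < e"
      using x by (auto simp: eq[OF \<sigma>])
  qed
qed

end

lemma dual_simps [simp]:
  "carrier (dual V) = dual_carrier V" "\<zero>\<^bsub>dual V\<^esub> = (\<lambda>x\<in>carrier V. 0)"
  "\<phi> \<oplus>\<^bsub>dual V\<^esub> \<psi> = (\<lambda>x\<in>carrier V. \<phi> x + \<psi> x)" "c \<odot>\<^bsub>dual V\<^esub> \<phi> = (\<lambda>x\<in>carrier V. c * \<phi> x)"
  by (simp_all add: dual_def)

lemma dual_carrierI:
  assumes "\<phi> \<in> extensional (carrier V)"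
    "\<And>x y. x \<in> carrier V \<Longrightarrow> y \<in> carrier V \<Longrightarrow> \<phi> (x \<oplus>\<^bsub>V\<^esub> y) = \<phi> x + \<phi> y"
    "\<And>c x. x \<in> carrier V \<Longrightarrow> \<phi> (c \<odot>\<^bsub>V\<^esub> x) = c * \<phi> x"
    "\<And>x. x \<in> carrier V \<Longrightarrow> cmod (\<phi> x) \<le> K * nrm V x"
  shows "\<phi> \<in> dual_carrier V"
  using assms unfolding dual_carrier_def by blast

context complex_normed_space
begin

lemma dual_nrm_bdd:
  assumes "\<phi> \<in> dual_carrier V"
  shows "bdd_above ((\<lambda>x. cmod (\<phi> x)) ` {x \<in> carrier V. nrm V x \<le> 1})"
proof -
  obtain K where K: "\<And>x. x \<in> carrier V \<Longrightarrow> cmod (\<phi> x) \<le> K * nrm V x"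
    using assms unfolding dual_carrier_def by blast
  \<comment> \<open>The constant in \<open>dual_carrier\<close> may be negative, hence the absolute
    value.\<close>
  have "cmod (\<phi> x) \<le> \<bar>K\<bar>" if "x \<in> carrier V" "nrm V x \<le> 1" for x
  proof -
    have "K * nrm V x \<le> \<bar>K\<bar> * 1"
      using that nrm_nonneg[of x] by (intro mult_mono) auto
    thus ?thesis using K[of x] that by simp
  qed
  thus ?thesis by (intro bdd_aboveI2) auto
qed

lemma dual_apply:
  assumes "\<phi> \<in> dual_carrier V"
  shows dual_add: "x \<in> carrier V \<Longrightarrow> y \<in> carrier V \<Longrightarrow> \<phi> (x \<oplus> y) = \<phi> x + \<phi> y"
    and dual_smult: "x \<in> carrier V \<Longrightarrow> \<phi> (c \<odot> x) = c * \<phi> x"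
    and dual_ext: "\<phi> \<in> extensional (carrier V)"
  using assms by (auto simp: dual_carrier_def)

lemma dual_apply_zero: "\<phi> \<in> dual_carrier V \<Longrightarrow> \<phi> \<zero> = 0"
  using dual_smult[of \<phi> \<zero> 0] by simp

lemma dual_apply_le:
  assumes "\<phi> \<in> dual_carrier V" "x \<in> carrier V"
  shows "cmod (\<phi> x) \<le> nrm (dual V) \<phi> * nrm V x"
proof (cases "nrm V x = 0")
  case True
  thus ?thesis using assms nrm_eq_0[of x] dual_apply_zero[of \<phi>] by simp
next
  case False
  hence pos: "nrm V x > 0" using nrm_nonneg[of x] assms by simp
  let ?c = "complex_of_real (1 / nrm V x)"
  have "cmod (\<phi> (?c \<odot> x)) \<le> nrm (dual V) \<phi>"
    unfolding dual_def using dual_nrm_bdd[OF assms(1)] assms pos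
    by (auto intro!: cSUP_upper simp: nrm_smult norm_divide)
  moreover have "cmod (\<phi> (?c \<odot> x)) = cmod (\<phi> x) / nrm V x"
    using assms pos dual_smult[OF assms, of ?c] by (simp add: norm_mult norm_divide)
  ultimately show ?thesis using pos by (simp add: field_simps del: of_real_divide)
qed

lemma dual_nrm_le:
  assumes "K \<ge> 0" "\<And>x. x \<in> carrier V \<Longrightarrow> cmod (\<phi> x) \<le> K * nrm V x"
  shows "nrm (dual V) \<phi> \<le> K"
proof -
  have "\<zero> \<in> {x \<in> carrier V. nrm V x \<le> 1}" by simp
  moreover have "cmod (\<phi> x) \<le> K" if "x \<in> {x \<in> carrier V. nrm V x \<le> 1}" for x
  proof -
    have "K * nrm V x \<le> K * 1" using that assms(1) by (intro mult_left_mono) auto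
    thus ?thesis using assms(2)[of x] that by simp
  qed
  ultimately show ?thesis unfolding dual_def by (auto intro!: cSUP_least)
qed

lemma dual_nrm_nonneg: "\<phi> \<in> dual_carrier V \<Longrightarrow> 0 \<le> nrm (dual V) \<phi>"
  unfolding dual_def using dual_nrm_bdd[of \<phi>]
  by (auto intro!: cSUP_upper2[where x = \<zero>])

lemma dual_add_closed:
  assumes "\<phi> \<in> dual_carrier V" "\<psi> \<in> dual_carrier V"
  shows "(\<lambda>x\<in>carrier V. \<phi> x + \<psi> x) \<in> dual_carrier V"
proof (rule dual_carrierI)
  fix x assume x: "x \<in> carrier V"
  have "cmod (\<phi> x + \<psi> x) \<le> cmod (\<phi> x) + cmod (\<psi> x)" by (rule norm_triangle_ineq)
  also have "\<dots> \<le> (nrm (dual V) \<phi> + nrm (dual V) \<psi>) * nrm V x"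
    using dual_apply_le[OF assms(1) x] dual_apply_le[OF assms(2) x] by (simp add: distrib_right)
  finally show "cmod ((\<lambda>x\<in>carrier V. \<phi> x + \<psi> x) x) \<le> (nrm (dual V) \<phi> + nrm (dual V) \<psi>) * nrm V x"
    using x by simp
qed (use assms in \<open>auto simp: dual_add dual_smult distrib_left\<close>)

lemma dual_smult_closed:
  assumes "\<phi> \<in> dual_carrier V" shows "(\<lambda>x\<in>carrier V. c * \<phi> x) \<in> dual_carrier V"
proof (rule dual_carrierI)
  fix x assume x: "x \<in> carrier V"
  show "cmod ((\<lambda>x\<in>carrier V. c * \<phi> x) x) \<le> (cmod c * nrm (dual V) \<phi>) * nrm V x"
    using x dual_apply_le[OF assms x] by (simp add: norm_mult mult.assoc mult_left_mono)
qed (use assms in \<open>auto simp: dual_add dual_smult distrib_left\<close>)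

lemma module_dual: "module complex_ring (dual V)"
proof (rule moduleI)
  show "abelian_group (dual V)"
  proof (rule abelian_groupI)
    fix \<phi> assume \<phi>: "\<phi> \<in> carrier (dual V)"
    show "\<exists>y\<in>carrier (dual V). y \<oplus>\<^bsub>dual V\<^esub> \<phi> = \<zero>\<^bsub>dual V\<^esub>"
      using \<phi> dual_smult_closed[of \<phi> "-1"] by (intro bexI[of _ "\<lambda>x\<in>carrier V. - \<phi> x"])
        (auto intro!: restrict_ext dual_smult_closed)
  next
    show "\<zero>\<^bsub>dual V\<^esub> \<in> carrier (dual V)" by (auto intro!: dual_carrierI[where K=0])
  qed (auto simp: dual_add_closed dual_ext intro!: restrict_ext extensionalityI[of _ "carrier V"])
qed (auto simp: cring_complex_ring dual_smult_closed dual_ext algebra_simps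
      intro!: restrict_ext extensionalityI[of _ "carrier V"])

lemma complex_normed_space_dual: "complex_normed_space (dual V)"
proof -
  interpret D: module complex_ring "dual V" by (rule module_dual)
  interpret D: complex_module "dual V" by unfold_locales
  show ?thesis
  proof
    fix \<phi> assume \<phi>: "\<phi> \<in> carrier (dual V)"
    show "0 \<le> nrm (dual V) \<phi>" using \<phi> dual_nrm_nonneg by simp
    show "(nrm (dual V) \<phi> = 0) = (\<phi> = \<zero>\<^bsub>dual V\<^esub>)"
    proof
      assume "nrm (dual V) \<phi> = 0"
      thus "\<phi> = \<zero>\<^bsub>dual V\<^esub>" using \<phi> dual_apply_le[of \<phi>]
        by (intro extensionalityI[of _ "carrier V"]) (auto simp: dual_ext)
    next
      assume "\<phi> = \<zero>\<^bsub>dual V\<^esub>"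
      hence "nrm (dual V) \<phi> \<le> 0" by (intro dual_nrm_le) auto
      thus "nrm (dual V) \<phi> = 0" using \<phi> dual_nrm_nonneg[of \<phi>] by simp
    qed
    fix c
    \<comment> \<open>One inequality is enough; applied to 1 / c it gives the other.\<close>
    have le: "nrm (dual V) (c \<odot>\<^bsub>dual V\<^esub> \<phi>) \<le> cmod c * nrm (dual V) \<phi>"
      if \<phi>: "\<phi> \<in> carrier (dual V)" for c \<phi>
      using dual_apply_le[of \<phi>] \<phi> dual_nrm_nonneg[of \<phi>]
      by (intro dual_nrm_le) (auto simp: norm_mult mult.assoc mult_left_mono)
    show "nrm (dual V) (c \<odot>\<^bsub>dual V\<^esub> \<phi>) = cmod c * nrm (dual V) \<phi>"
    proof (cases "c = 0")
      case True
      thus ?thesis using le[OF \<phi>, of c] dual_nrm_nonneg[OF dual_smult_closed[of \<phi> c]] \<phi> by simp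
    next
      case False
      have "\<phi> = (1/c) \<odot>\<^bsub>dual V\<^esub> (c \<odot>\<^bsub>dual V\<^esub> \<phi>)"
        using \<phi> False D.smult_mult[of \<phi> "1/c" c] by (simp del: dual_simps)
      hence "nrm (dual V) \<phi> \<le> cmod (1/c) * nrm (dual V) (c \<odot>\<^bsub>dual V\<^esub> \<phi>)"
        using le[of "c \<odot>\<^bsub>dual V\<^esub> \<phi>" "1/c"] \<phi> D.smult_closed'[of \<phi> c] by metis
      thus ?thesis using le[OF \<phi>, of c] False by (simp add: norm_divide field_simps)
    qed
  next
    fix \<phi> \<psi> assume a: "\<phi> \<in> carrier (dual V)" "\<psi> \<in> carrier (dual V)"
    show "nrm (dual V) (\<phi> \<oplus>\<^bsub>dual V\<^esub> \<psi>) \<le> nrm (dual V) \<phi> + nrm (dual V) \<psi>"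
    proof (rule dual_nrm_le)
      fix x assume x: "x \<in> carrier V"
      have "cmod (\<phi> x + \<psi> x) \<le> cmod (\<phi> x) + cmod (\<psi> x)" by (rule norm_triangle_ineq)
      also have "\<dots> \<le> (nrm (dual V) \<phi> + nrm (dual V) \<psi>) * nrm V x"
        using dual_apply_le[OF _ x, of \<phi>] dual_apply_le[OF _ x, of \<psi>] a by (simp add: distrib_right)
      finally show "cmod ((\<phi> \<oplus>\<^bsub>dual V\<^esub> \<psi>) x) \<le> (nrm (dual V) \<phi> + nrm (dual V) \<psi>) * nrm V x"
        using x by simp
    qed (use a dual_nrm_nonneg in auto)
  qed
qed

lemma dual_minus_apply:
  assumes "\<phi> \<in> dual_carrier V" "\<psi> \<in> dual_carrier V" "x \<in> carrier V"
  shows "(\<phi> \<ominus>\<^bsub>dual V\<^esub> \<psi>) x = \<phi> x - \<psi> x"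
proof -
  interpret D: complex_normed_space "dual V" by (rule complex_normed_space_dual)
  show ?thesis using D.smult_minus_one[of \<psi>, symmetric] assms by (simp add: a_minus_def)
qed

lemma dual_finsum_apply:
  assumes "finite I" "\<And>i. i \<in> I \<Longrightarrow> u i \<in> dual_carrier V" "x \<in> carrier V"
  shows "finsum (dual V) u I x = (\<Sum>i\<in>I. u i x)"
proof -
  interpret D: complex_normed_space "dual V" by (rule complex_normed_space_dual)
  show ?thesis using assms
    by (induction I rule: finite_induct) (auto simp: D.finsum_insert Pi_def)
qed

text \<open>The limit is taken pointwise. Letting one index tend to infinity in the Cauchy condition
  makes the convergence uniform relative to \<open>nrm V x\<close>, which gives both the boundedness
  of the limit and convergence in norm.\<close>

lemma complex_banach_dual: "complex_banach (dual V)"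
proof -
  interpret D: complex_normed_space "dual V" by (rule complex_normed_space_dual)
  show ?thesis
  proof (rule D.complex_banach_iff[THEN iffD2], intro allI impI)
    fix \<sigma> :: "nat \<Rightarrow> _"
    assume "range \<sigma> \<subseteq> carrier (dual V)"
    hence \<sigma>: "\<sigma> n \<in> dual_carrier V" for n by auto
    assume C: "\<forall>e>0. \<exists>N. \<forall>m\<ge>N. \<forall>n\<ge>N. nrm (dual V) (\<sigma> m \<ominus>\<^bsub>dual V\<^esub> \<sigma> n) < e"
    have le: "cmod (\<sigma> m x - \<sigma> n x) \<le> nrm (dual V) (\<sigma> m \<ominus>\<^bsub>dual V\<^esub> \<sigma> n) * nrm V x"
      if "x \<in> carrier V" for m n x
      using dual_apply_le[of "\<sigma> m \<ominus>\<^bsub>dual V\<^esub> \<sigma> n" x] D.minus_closed[of "\<sigma> m" "\<sigma> n"] \<sigma> that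
      by (simp add: dual_minus_apply)
    have "Cauchy (\<lambda>n. \<sigma> n x)" if x: "x \<in> carrier V" for x
    proof (rule CauchyI)
      fix e :: real assume e: "e > 0"
      have pos: "nrm V x + 1 > 0" using nrm_nonneg[OF x] by simp
      then obtain N where N: "\<forall>m\<ge>N. \<forall>n\<ge>N. nrm (dual V) (\<sigma> m \<ominus>\<^bsub>dual V\<^esub> \<sigma> n) < e / (nrm V x + 1)"
        using C e by (meson divide_pos_pos)
      have "cmod (\<sigma> m x - \<sigma> n x) < e" if "m \<ge> N" "n \<ge> N" for m n
      proof -
        have "cmod (\<sigma> m x - \<sigma> n x) \<le> e / (nrm V x + 1) * nrm V x"
          using le[OF x, of m n] N that nrm_nonneg[OF x]
          by (meson less_imp_le mult_right_mono order_trans)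
        also have "\<dots> < e" using pos e by (simp add: field_simps)
        finally show ?thesis .
      qed
      thus "\<exists>M. \<forall>m\<ge>M. \<forall>n\<ge>M. cmod (\<sigma> m x - \<sigma> n x) < e" by blast
    qed
    hence lim: "(\<lambda>n. \<sigma> n x) \<longlonglongrightarrow> lim (\<lambda>n. \<sigma> n x)" if "x \<in> carrier V" for x
      using that Cauchy_convergent convergent_LIMSEQ_iff by blast
    define \<phi> where "\<phi> = (\<lambda>x\<in>carrier V. lim (\<lambda>n. \<sigma> n x))"
    have lim': "(\<lambda>n. \<sigma> n x) \<longlonglongrightarrow> \<phi> x" if "x \<in> carrier V" for x
      using lim[OF that] that by (simp add: \<phi>_def)
    have tail: "\<exists>N. \<forall>n\<ge>N. \<forall>x\<in>carrier V. cmod (\<sigma> n x - \<phi> x) \<le> e * nrm V x" if e: "e > 0" for e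
    proof -
      obtain N where N: "\<forall>m\<ge>N. \<forall>n\<ge>N. nrm (dual V) (\<sigma> m \<ominus>\<^bsub>dual V\<^esub> \<sigma> n) < e" using C e by blast
      have "cmod (\<sigma> n x - \<phi> x) \<le> e * nrm V x" if n: "n \<ge> N" and x: "x \<in> carrier V" for n x
      proof (rule LIMSEQ_le_const2)
        show "(\<lambda>m. cmod (\<sigma> n x - \<sigma> m x)) \<longlonglongrightarrow> cmod (\<sigma> n x - \<phi> x)"
          by (intro tendsto_intros lim' x)
        show "\<exists>M. \<forall>m\<ge>M. cmod (\<sigma> n x - \<sigma> m x) \<le> e * nrm V x"
          using le[OF x] N n nrm_nonneg[OF x]
          by (intro exI[of _ N]) (meson less_imp_le mult_right_mono order_trans)
      qed
      thus ?thesis by blast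
    qed
    have \<phi>: "\<phi> \<in> dual_carrier V"
    proof -
      obtain N where N: "\<And>x. x \<in> carrier V \<Longrightarrow> cmod (\<sigma> N x - \<phi> x) \<le> 1 * nrm V x"
        using tail[of 1] by auto
      show ?thesis
      proof (rule dual_carrierI)
        show "\<phi> \<in> extensional (carrier V)" by (simp add: \<phi>_def)
      next
        fix x y assume xy: "x \<in> carrier V" "y \<in> carrier V"
        have "(\<lambda>n. \<sigma> n (x \<oplus> y)) \<longlonglongrightarrow> \<phi> x + \<phi> y"
          unfolding dual_add[OF \<sigma> xy] by (intro tendsto_intros lim' xy)
        thus "\<phi> (x \<oplus> y) = \<phi> x + \<phi> y" using lim'[of "x \<oplus> y"] xy LIMSEQ_unique by blast
      next
        fix c x assume x: "x \<in> carrier V"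
        have "(\<lambda>n. \<sigma> n (c \<odot> x)) \<longlonglongrightarrow> c * \<phi> x"
          unfolding dual_smult[OF \<sigma> x] by (intro tendsto_intros lim' x)
        thus "\<phi> (c \<odot> x) = c * \<phi> x" using lim'[of "c \<odot> x"] x LIMSEQ_unique by blast
      next
        fix x assume x: "x \<in> carrier V"
        have "cmod (\<phi> x) \<le> cmod (\<sigma> N x) + cmod (\<sigma> N x - \<phi> x)"
          by (metis norm_minus_commute norm_triangle_sub add.commute)
        also have "\<dots> \<le> (nrm (dual V) (\<sigma> N) + 1) * nrm V x"
          using N[OF x] dual_apply_le[OF \<sigma> x, of N] by (simp add: distrib_right)
        finally show "cmod (\<phi> x) \<le> (nrm (dual V) (\<sigma> N) + 1) * nrm V x" .
      qed
    qed
    show "\<exists>x\<in>carrier (dual V). \<forall>e>0. \<exists>N. \<forall>n\<ge>N. nrm (dual V) (\<sigma> n \<ominus>\<^bsub>dual V\<^esub> x) < e"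
    proof (rule bexI[of _ \<phi>], intro allI impI)
      fix e :: real assume e: "e > 0"
      obtain N where N: "\<And>n x. n \<ge> N \<Longrightarrow> x \<in> carrier V \<Longrightarrow> cmod (\<sigma> n x - \<phi> x) \<le> e / 2 * nrm V x"
        using tail[of "e/2"] e by auto
      have "nrm (dual V) (\<sigma> n \<ominus>\<^bsub>dual V\<^esub> \<phi>) \<le> e / 2" if "n \<ge> N" for n
        using N[OF that] e by (intro dual_nrm_le) (auto simp: dual_minus_apply[OF \<sigma> \<phi>])
      thus "\<exists>N. \<forall>n\<ge>N. nrm (dual V) (\<sigma> n \<ominus>\<^bsub>dual V\<^esub> \<phi>) < e"
        using e by (intro exI[of _ N]) force
    qed (use \<phi> in simp)
  qed
qed

end

section \<open>Atomic decompositions and preduals\<close>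

context complex_normed_space
begin

text \<open>Combinations are lists of pairs, with repetitions allowed: addition is concatenation,
  the cost is exactly additive, and a series can be read off from lists that extend each
  other.\<close>

definition lin_comb :: "(complex \<times> 'v) list \<Rightarrow> 'v" where
  "lin_comb xs = foldr (\<lambda>(c, a) y. c \<odot> a \<oplus> y) xs \<zero>"

definition lin_cost :: "(complex \<times> 'v) list \<Rightarrow> real" where
  "lin_cost xs = (\<Sum>(c, a)\<leftarrow>xs. cmod c)"

lemma lin_comb_simps [simp]:
  "lin_comb [] = \<zero>" "lin_comb ((c, a) # xs) = c \<odot> a \<oplus> lin_comb xs"
  by (simp_all add: lin_comb_def)

lemma lin_cost_simps [simp]:
  "lin_cost [] = 0" "lin_cost ((c, a) # xs) = cmod c + lin_cost xs"
  "lin_cost (xs @ ys) = lin_cost xs + lin_cost ys"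
  by (simp_all add: lin_cost_def)

lemma lin_cost_nonneg: "0 \<le> lin_cost xs"
  by (induction xs) auto

lemma lin_cost_map: "lin_cost (map (\<lambda>(b, a). (c * b, a)) xs) = cmod c * lin_cost xs"
  by (induction xs) (auto simp: norm_mult distrib_left)

lemma lin_comb_closed:
  assumes "submodule P complex_ring V" "A \<subseteq> P" "snd ` set xs \<subseteq> A" shows "lin_comb xs \<in> P"
  using assms(3) by (induction xs) (use assms(2) submodule_simps[OF assms(1)] in auto)

lemma lin_comb_carrier:
  assumes "A \<subseteq> carrier V" "snd ` set xs \<subseteq> A" shows "lin_comb xs \<in> carrier V"
  using lin_comb_closed[OF carrier_is_submodule assms] .

lemma lin_comb_append:
  assumes A: "A \<subseteq> carrier V" "snd ` set xs \<subseteq> A" "snd ` set ys \<subseteq> A"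
  shows "lin_comb (xs @ ys) = lin_comb xs \<oplus> lin_comb ys"
  using A(2)
proof (induction xs)
  case (Cons x xs)
  thus ?case using A lin_comb_carrier[OF A(1), of xs] lin_comb_carrier[OF A(1), of ys]
    by (cases x) (auto simp: a_assoc)
qed (use lin_comb_carrier[OF A(1,3)] in auto)

lemma lin_comb_map:
  assumes A: "A \<subseteq> carrier V" "snd ` set xs \<subseteq> A"
  shows "lin_comb (map (\<lambda>(b, a). (c * b, a)) xs) = c \<odot> lin_comb xs"
  using A(2)
proof (induction xs)
  case (Cons x xs)
  thus ?case using A lin_comb_carrier[OF A(1), of xs]
    by (cases x) (auto simp: smult_mult smult_right_distrib)
qed auto

definition closed_span :: "'v set \<Rightarrow> 'v set" where
  "closed_span A = {x \<in> carrier V. \<forall>e>0. \<exists>xs. snd ` set xs \<subseteq> A \<and> nrm V (x \<ominus> lin_comb xs) < e}"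

lemma submodule_closed_span:
  assumes A: "A \<subseteq> carrier V" shows "submodule (closed_span A) complex_ring V"
proof -
  note cc = lin_comb_carrier[OF A]
  have add: "x \<oplus> y \<in> closed_span A" if x: "x \<in> closed_span A" and y: "y \<in> closed_span A" for x y
    unfolding closed_span_def
  proof (intro CollectI conjI allI impI)
    show "x \<oplus> y \<in> carrier V" using x y by (auto simp: closed_span_def)
    fix e :: real assume "e > 0"
    hence "e / 2 > 0" by simp
    obtain xs ys where xs: "snd ` set xs \<subseteq> A" "nrm V (x \<ominus> lin_comb xs) < e / 2"
      and ys: "snd ` set ys \<subseteq> A" "nrm V (y \<ominus> lin_comb ys) < e / 2"
      using x y \<open>e / 2 > 0\<close> unfolding closed_span_def by blast
    have xy: "x \<in> carrier V" "y \<in> carrier V" using x y by (auto simp: closed_span_def)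
    have "x \<oplus> y \<ominus> lin_comb (xs @ ys) = (x \<ominus> lin_comb xs) \<oplus> (y \<ominus> lin_comb ys)"
      using xy cc[OF xs(1)] cc[OF ys(1)] lin_comb_append[OF A xs(1) ys(1)]
      by (simp add: minus_eq minus_add a_ac)
    hence "nrm V (x \<oplus> y \<ominus> lin_comb (xs @ ys)) < e"
      using nrm_triangle[of "x \<ominus> lin_comb xs" "y \<ominus> lin_comb ys"] xy xs ys cc[OF xs(1)] cc[OF ys(1)] by simp
    thus "\<exists>xs. snd ` set xs \<subseteq> A \<and> nrm V (x \<oplus> y \<ominus> lin_comb xs) < e"
      using xs ys by (intro exI[of _ "xs @ ys"]) auto
  qed
  have smul: "c \<odot> x \<in> closed_span A" if x: "x \<in> closed_span A" for c x
    unfolding closed_span_def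
  proof (intro CollectI conjI allI impI)
    show "c \<odot> x \<in> carrier V" using x by (auto simp: closed_span_def)
    fix e :: real assume "e > 0"
    hence "e / (cmod c + 1) > 0" by (simp add: add_nonneg_pos)
    then obtain xs where xs: "snd ` set xs \<subseteq> A" "nrm V (x \<ominus> lin_comb xs) < e / (cmod c + 1)"
      using x unfolding closed_span_def by blast
    have xc: "x \<in> carrier V" using x by (auto simp: closed_span_def)
    let ?ys = "map (\<lambda>(b, a). (c * b, a)) xs"
    have "c \<odot> x \<ominus> lin_comb ?ys = c \<odot> (x \<ominus> lin_comb xs)"
      using xc cc[OF xs(1)] lin_comb_map[OF A xs(1)] smult_r_minus[of c "lin_comb xs"]
      by (simp add: minus_eq smult_right_distrib)
    hence "nrm V (c \<odot> x \<ominus> lin_comb ?ys) = cmod c * nrm V (x \<ominus> lin_comb xs)"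
      using xc cc[OF xs(1)] by (simp add: nrm_smult)
    also have "\<dots> \<le> cmod c * (e / (cmod c + 1))" using xs by (intro mult_left_mono) auto
    also have "\<dots> < e" using \<open>e > 0\<close> add_nonneg_pos[OF norm_ge_zero[of c] zero_less_one] by (simp add: field_simps)
    finally show "\<exists>xs. snd ` set xs \<subseteq> A \<and> nrm V (c \<odot> x \<ominus> lin_comb xs) < e"
      using xs by (intro exI[of _ ?ys]) auto
  qed
  have zero: "\<zero> \<in> closed_span A"
    by (auto simp: closed_span_def minus_eq intro!: exI[of _ "[]"])
  show ?thesis
    using add smul zero smul[of _ "-1"] smult_minus_one
    by (intro submoduleI) (auto simp: closed_span_def)
qed

lemma closed_span_superset:
  assumes "A \<subseteq> carrier V" shows "A \<subseteq> closed_span A"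
proof
  fix a assume a: "a \<in> A"
  hence "nrm V (a \<ominus> lin_comb [(1, a)]) = 0" using assms by (auto simp: minus_eq r_neg)
  thus "a \<in> closed_span A" using a assms unfolding closed_span_def
    by (auto intro!: exI[of _ "[(1, a)]"])
qed

lemma closed_span_closed:
  assumes A: "A \<subseteq> carrier V" and x: "x \<in> carrier V"
    and ap: "\<And>e. e > 0 \<Longrightarrow> \<exists>y\<in>closed_span A. nrm V (x \<ominus> y) < e"
  shows "x \<in> closed_span A"
  unfolding closed_span_def
proof (intro CollectI conjI allI impI x)
  fix e :: real assume e: "e > 0"
  then obtain y where y: "y \<in> closed_span A" "nrm V (x \<ominus> y) < e / 2" using ap[of "e / 2"] by auto
  moreover have "e / 2 > 0" using e by simp
  ultimately obtain xs where xs: "snd ` set xs \<subseteq> A" "nrm V (y \<ominus> lin_comb xs) < e / 2"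
    unfolding closed_span_def by blast
  have "y \<in> carrier V" using y by (simp add: closed_span_def)
  hence "nrm V (x \<ominus> lin_comb xs) < e"
    using nrm_minus_triangle[OF x, of y "lin_comb xs"] lin_comb_carrier[OF A xs(1)] xs y by simp
  thus "\<exists>xs. snd ` set xs \<subseteq> A \<and> nrm V (x \<ominus> lin_comb xs) < e" using xs by blast
qed

text \<open>Meant for the difference of two bounded functionals that agree on A: it vanishes on
  combinations by linearity and on their limits by the bound.\<close>

lemma closed_span_functional_eq_0:
  assumes A: "A \<subseteq> carrier V" and x: "x \<in> closed_span A"
    and L: "\<And>x y. x \<in> closed_span A \<Longrightarrow> y \<in> closed_span A \<Longrightarrow> L (x \<oplus> y) = L x + L y"
      "\<And>c x. x \<in> closed_span A \<Longrightarrow> L (c \<odot> x) = c * L x"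
      "\<And>x. x \<in> closed_span A \<Longrightarrow> cmod (L x) \<le> K * nrm V x"
    and 0: "\<And>a. a \<in> A \<Longrightarrow> L a = 0"
  shows "L x = 0"
proof -
  let ?P = "closed_span A"
  note S = submodule_simps[OF submodule_closed_span[OF A]] and sup = closed_span_superset[OF A]
  have L0: "L \<zero> = 0" using L(2)[of \<zero> 0] S(2) by simp
  have Lc: "L (lin_comb xs) = 0" if "snd ` set xs \<subseteq> A" for xs
    using that
  proof (induction xs)
    case (Cons p xs)
    obtain c a where p: "p = (c, a)" by force
    have "lin_comb xs \<in> ?P" "a \<in> ?P"
      using Cons.prems sup lin_comb_closed[OF submodule_closed_span[OF A] sup, of xs] p by auto
    thus ?case using Cons 0[of a] S(4)[of a c] by (simp add: p L)
  qed (use L0 in simp)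
  have "cmod (L x) \<le> 0 + e" if e: "e > 0" for e
  proof -
    have pos: "e / (\<bar>K\<bar> + 1) > 0" using e by simp
    then obtain xs where xs: "snd ` set xs \<subseteq> A" "nrm V (x \<ominus> lin_comb xs) < e / (\<bar>K\<bar> + 1)"
      using x unfolding closed_span_def by blast
    have c: "lin_comb xs \<in> ?P" using lin_comb_closed[OF submodule_closed_span[OF A] sup xs(1)] .
    have xc: "x \<in> carrier V" "lin_comb xs \<in> carrier V" using S(1) x c by auto
    have "x = (x \<ominus> lin_comb xs) \<oplus> lin_comb xs" using xc by (simp add: minus_eq a_assoc l_neg)
    hence "L x = L (x \<ominus> lin_comb xs)" using L(1)[OF S(5)[OF x c] c] Lc[OF xs(1)] by simp
    hence "cmod (L x) \<le> K * nrm V (x \<ominus> lin_comb xs)" using L(3)[OF S(5)[OF x c]] by simp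
    also have "\<dots> \<le> (\<bar>K\<bar> + 1) * (e / (\<bar>K\<bar> + 1))"
      using xs(2) nrm_nonneg[of "x \<ominus> lin_comb xs"] xc by (intro mult_mono) auto
    finally show ?thesis by simp
  qed
  hence "cmod (L x) \<le> 0" by (rule field_le_epsilon)
  thus ?thesis by simp
qed

text \<open>The dual form of the statement that the unit ball of the closed span lies in the closure
  of B times the absolutely convex hull of A. The constant K only expresses that L is bounded; B
  must serve all L at once.\<close>

definition norms_functionals :: "'v set \<Rightarrow> real \<Rightarrow> bool" where
  "norms_functionals A B \<longleftrightarrow> (\<forall>L K.
      (\<forall>x\<in>closed_span A. \<forall>y\<in>closed_span A. L (x \<oplus> y) = L x + L y) \<and>
      (\<forall>c. \<forall>x\<in>closed_span A. L (c \<odot> x) = c * L x) \<and>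
      (\<forall>x\<in>closed_span A. cmod (L x) \<le> K * nrm V x) \<and> (\<forall>a\<in>A. cmod (L a) \<le> 1) \<longrightarrow>
      (\<forall>x\<in>closed_span A. cmod (L x) \<le> B * nrm V x))"

text \<open>By Hahn-Banach for the gauge \<open>p\<close> below: a functional dominated by \<open>p\<close> is at most 1 on \<open>A\<close>.\<close>

lemma lin_comb_approximation:
  assumes A: "A \<subseteq> carrier V" and B: "B \<ge> 0"
    and L: "norms_functionals A B"
    and x: "x \<in> closed_span A" and eta: "\<eta> > 0" and del: "\<delta> > 0"
  obtains xs where "snd ` set xs \<subseteq> A" "lin_cost xs \<le> B * nrm V x + \<eta>" "nrm V (x \<ominus> lin_comb xs) \<le> \<delta>"
proof -
  let ?P = "closed_span A"
  note S = submodule_simps[OF submodule_closed_span[OF A]] and sup = closed_span_superset[OF A]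
  note cc = lin_comb_carrier[OF A]
  have xc: "x \<in> carrier V" using S(1) x by auto
  define K where "K = (B * nrm V x + \<eta>) / \<delta>"
  have K: "K > 0" using eta del B nrm_nonneg[OF xc] by (simp add: K_def add_nonneg_pos)
  \<comment> \<open>Cost of a combination plus a penalty for the error it leaves. Its infimum p is
    the largest seminorm that is at most 1 on A and at most K times the norm.\<close>
  define g where "g y xs = lin_cost xs + K * nrm V (y \<ominus> lin_comb xs)" for y xs
  define X where "X = {xs :: (complex \<times> 'v) list. snd ` set xs \<subseteq> A}"
  have XI: "[] \<in> X" by (simp add: X_def)
  define p where "p y = (INF xs\<in>X. g y xs)" for y
  have g0: "0 \<le> g y xs" if "y \<in> carrier V" "xs \<in> X" for y xs
    using that K cc[of xs] by (auto simp: g_def X_def lin_cost_nonneg nrm_nonneg)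
  have bdd: "bdd_below (g y ` X)" if "y \<in> carrier V" for y
    using g0[OF that] by (intro bdd_belowI2[of _ 0])
  have ple: "p y \<le> g y xs" if "y \<in> carrier V" "xs \<in> X" for y xs
    unfolding p_def using bdd that by (intro cINF_lower) auto
  have pge: "a \<le> p y" if "\<And>xs. xs \<in> X \<Longrightarrow> a \<le> g y xs" for a y
    unfolding p_def using XI that by (intro cINF_greatest) auto
  have padd: "p (y \<oplus> z) \<le> p y + p z" if yz: "y \<in> carrier V" "z \<in> carrier V" for y z
  proof -
    have *: "p (y \<oplus> z) \<le> g y xs + g z ys" if "xs \<in> X" "ys \<in> X" for xs ys
    proof -
      have xs: "snd ` set xs \<subseteq> A" and ys: "snd ` set ys \<subseteq> A" using that by (auto simp: X_def)
      have "y \<oplus> z \<ominus> lin_comb (xs @ ys) = (y \<ominus> lin_comb xs) \<oplus> (z \<ominus> lin_comb ys)"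
        using yz cc[OF xs] cc[OF ys] lin_comb_append[OF A xs ys]
        by (simp add: minus_eq minus_add a_ac)
      hence "nrm V (y \<oplus> z \<ominus> lin_comb (xs @ ys)) \<le> nrm V (y \<ominus> lin_comb xs) + nrm V (z \<ominus> lin_comb ys)"
        using nrm_triangle[of "y \<ominus> lin_comb xs" "z \<ominus> lin_comb ys"] yz cc[OF xs] cc[OF ys] by simp
      hence "g (y \<oplus> z) (xs @ ys) \<le> g y xs + g z ys"
        using K by (simp add: g_def distrib_left[symmetric])
      moreover have "xs @ ys \<in> X" using xs ys by (auto simp: X_def)
      ultimately show ?thesis using ple[of "y \<oplus> z" "xs @ ys"] yz by simp
    qed
    have "p (y \<oplus> z) - p z \<le> p y"
    proof (rule pge)
      fix xs assume xs: "xs \<in> X"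
      have "p (y \<oplus> z) - g y xs \<le> p z" by (rule pge) (use *[OF xs] in force)
      thus "p (y \<oplus> z) - p z \<le> g y xs" by simp
    qed
    thus ?thesis by simp
  qed
  have psm1: "p (c \<odot> y) \<le> cmod c * p y" if y: "y \<in> carrier V" and c: "c \<noteq> 0" for c y
  proof -
    have "p (c \<odot> y) / cmod c \<le> p y"
    proof (rule pge)
      fix xs assume "xs \<in> X"
      hence xs: "snd ` set xs \<subseteq> A" by (simp add: X_def)
      let ?ys = "map (\<lambda>(b, a). (c * b, a)) xs"
      have "c \<odot> y \<ominus> lin_comb ?ys = c \<odot> (y \<ominus> lin_comb xs)"
        using y cc[OF xs] lin_comb_map[OF A xs] smult_r_minus[of c "lin_comb xs"]
        by (simp add: minus_eq smult_right_distrib)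
      hence "g (c \<odot> y) ?ys = cmod c * g y xs"
        using y cc[OF xs] by (simp add: g_def nrm_smult lin_cost_map distrib_left mult.left_commute)
      moreover have "?ys \<in> X" using xs by (auto simp: X_def)
      ultimately show "p (c \<odot> y) / cmod c \<le> g y xs"
        using ple[of "c \<odot> y" ?ys] y c by (simp add: field_simps)
    qed
    thus ?thesis using c by (simp add: field_simps)
  qed
  have psm: "p (c \<odot> y) = cmod c * p y" if y: "y \<in> carrier V" for c y
  proof (cases "c = 0")
    case True
    have "p \<zero> \<le> g \<zero> []" using ple[of \<zero> "[]"] XI by simp
    moreover have "0 \<le> p \<zero>" by (rule pge) (auto simp: g0)
    ultimately show ?thesis using True y by (simp add: g_def minus_eq)
  next
    case False
    have "p ((1/c) \<odot> (c \<odot> y)) \<le> cmod (1/c) * p (c \<odot> y)" using psm1[of "c \<odot> y" "1/c"] y False by simp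
    hence "cmod c * p y \<le> p (c \<odot> y)"
      using False y by (simp add: smult_mult[symmetric] norm_divide field_simps)
    thus ?thesis using psm1[OF y False] by simp
  qed
  \<comment> \<open>\<open>norms_functionals\<close> speaks of functionals on the closed span, so
    Hahn--Banach is applied to that module.\<close>
  interpret P: complex_normed_space "V\<lparr>carrier := ?P\<rparr>"
    by (rule complex_normed_space_submodule[OF submodule_closed_span[OF A]])
  have PC: "y \<in> carrier V" if "y \<in> ?P" for y using S(1) that by auto
  obtain L where L': "\<And>y y'. y \<in> ?P \<Longrightarrow> y' \<in> ?P \<Longrightarrow> L (y \<oplus> y') = L y + L y'"
    "\<And>c y. y \<in> ?P \<Longrightarrow> L (c \<odot> y) = c * L y"
    "\<And>y. y \<in> ?P \<Longrightarrow> cmod (L y) \<le> p y" "Re (L x) = p x"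
    by (rule P.Hahn_Banach_seminorm[of p x]) (use padd psm PC x in auto)
  \<comment> \<open>The empty combination bounds L by K times the norm; the singleton combination
    below, of cost 1 and without error, bounds L by 1 on A.\<close>
  have L1: "cmod (L y) \<le> K * nrm V y" if y: "y \<in> ?P" for y
  proof -
    have "cmod (L y) \<le> g y []" using L'(3)[OF y] ple[of y "[]"] XI PC[OF y] by simp
    thus ?thesis using PC[OF y] M.minus_equality[of \<zero> \<zero>] by (simp add: g_def minus_eq)
  qed
  have L2: "cmod (L a) \<le> 1" if a: "a \<in> A" for a
  proof -
    have "a \<in> ?P" using a sup by auto
    have "cmod (L a) \<le> g a [(1, a)]"
      using L'(3)[of a] ple[of a "[(1, a)]"] a A \<open>a \<in> ?P\<close> by (auto simp: X_def)
    also have "\<dots> = 1" using a A by (auto simp: g_def minus_eq r_neg)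
    finally show ?thesis .
  qed
  have "cmod (L x) \<le> B * nrm V x"
    using L L'(1,2) L1 L2 x unfolding norms_functionals_def by blast
  \<comment> \<open>The infimum need not be attained; the strict inequality provides a
    combination.\<close>
  hence "p x < B * nrm V x + \<eta>" using L'(4) complex_Re_le_cmod[of "L x"] eta by simp
  then obtain xs where xs: "xs \<in> X" "g x xs < B * nrm V x + \<eta>"
    unfolding p_def using bdd[OF xc] XI by (subst (asm) cINF_less_iff) auto
  show ?thesis
  proof (rule that)
    show sx: "snd ` set xs \<subseteq> A" using xs by (simp add: X_def)
    have n: "0 \<le> nrm V (x \<ominus> lin_comb xs)" using xc cc[OF sx] by (simp add: nrm_nonneg)
    hence "0 \<le> K * nrm V (x \<ominus> lin_comb xs)" using K by simp
    thus "lin_cost xs \<le> B * nrm V x + \<eta>" using xs(2) by (simp add: g_def)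
    have "K * nrm V (x \<ominus> lin_comb xs) \<le> B * nrm V x + \<eta>" using xs(2) lin_cost_nonneg[of xs] by (simp add: g_def)
    also have "\<dots> = K * \<delta>" using del by (simp add: K_def)
    finally show "nrm V (x \<ominus> lin_comb xs) \<le> \<delta>" using K by simp
  qed
qed

lemma lin_comb_conv_finsum:
  assumes "A \<subseteq> carrier V" "snd ` set xs \<subseteq> A"
  shows "lin_comb xs = finsum V (\<lambda>n. fst (xs ! n) \<odot> snd (xs ! n)) {..<length xs}"
  using assms(2)
proof (induction xs rule: rev_induct)
  case (snoc p xs)
  have A: "snd ` set xs \<subseteq> A" "snd p \<in> carrier V" using snoc.prems assms(1) by auto
  have xs: "snd (xs ! n) \<in> carrier V" if "n < length xs" for n
    using A(1) assms(1) that nth_mem[OF that] by blast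
  have "finsum V (\<lambda>n. fst ((xs @ [p]) ! n) \<odot> snd ((xs @ [p]) ! n)) {..<length (xs @ [p])} =
      finsum V (\<lambda>n. fst ((xs @ [p]) ! n) \<odot> snd ((xs @ [p]) ! n)) (insert (length xs) {..<length xs})"
    by (simp add: lessThan_Suc)
  also have "\<dots> = fst p \<odot> snd p \<oplus> finsum V (\<lambda>n. fst ((xs @ [p]) ! n) \<odot> snd ((xs @ [p]) ! n)) {..<length xs}"
    using A xs by (subst finsum_insert) (auto simp: nth_append)
  also have "finsum V (\<lambda>n. fst ((xs @ [p]) ! n) \<odot> snd ((xs @ [p]) ! n)) {..<length xs} = lin_comb xs"
    unfolding snoc.IH[OF A(1)] using xs by (intro finsum_cong') (auto simp: nth_append)
  also have "fst p \<odot> snd p \<oplus> lin_comb xs = lin_comb (xs @ [p])"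
    using snoc.prems A lin_comb_carrier[OF assms(1) A(1)]
    by (cases p, subst lin_comb_append[OF assms(1)]) (auto simp: M.a_comm)
  finally show ?case ..
qed simp

lemma lin_cost_conv_sum: "lin_cost xs = (\<Sum>n<length xs. cmod (fst (xs ! n)))"
  by (induction xs rule: rev_induct) (auto simp: lin_cost_def nth_append case_prod_beta)

text \<open>The remainder is approximated again and again, each time to within a tolerance so small
  that all further steps together cost at most \<eta>. The approximating lists extend each other, so
  together they define one sequence of coefficients and elements of A.\<close>

theorem atomic_decomposition:
  assumes A: "A \<subseteq> carrier V" "A \<noteq> {}" "\<And>a. a \<in> A \<Longrightarrow> nrm V a \<le> 1" and B: "B \<ge> 0"
    and L: "norms_functionals A B"
    and x: "x \<in> closed_span A" and eta: "\<eta> > 0"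
  obtains c a where "range a \<subseteq> A" "summable (\<lambda>n. cmod (c n))" "(\<Sum>n. cmod (c n)) \<le> B * nrm V x + \<eta>"
    "nrm_sums V (\<lambda>n. c n \<odot> a n) x"
proof -
  note S = submodule_simps[OF submodule_closed_span[OF A(1)]] and sup = closed_span_superset[OF A(1)]
  note cc = lin_comb_carrier[OF A(1)]
  have xc: "x \<in> carrier V" using S(1) x by auto
  \<comment> \<open>With this tolerance the remainder after step k costs at most B * d k + \<eta> /
    2 ^ (k + 3), which is at most \<eta> / 2 ^ (k + 2); this is exactly the growth of the budget
    \<eta> * (1 - 1 / 2 ^ (k + 1)) from k to k + 1.\<close>
  define d where "d k = \<eta> / 2 ^ (k + 3) / (B + 1)" for k :: nat
  have d: "d k > 0" for k using eta B by (simp add: d_def)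
  define Q where "Q k xs \<longleftrightarrow> snd ` set xs \<subseteq> A \<and> length xs \<ge> k \<and>
    lin_cost xs \<le> B * nrm V x + \<eta> * (1 - 1 / 2 ^ (k + 1)) \<and> nrm V (x \<ominus> lin_comb xs) \<le> d k" for k xs
  have "\<exists>f. \<forall>n. Q n (f n) \<and> (\<exists>zs. f (Suc n) = f n @ zs)"
  proof (rule dependent_nat_choice)
    obtain xs where "snd ` set xs \<subseteq> A" "lin_cost xs \<le> B * nrm V x + \<eta> / 2" "nrm V (x \<ominus> lin_comb xs) \<le> d 0"
      by (rule lin_comb_approximation[OF A(1) B L x, of "\<eta> / 2" "d 0"]) (use eta d in auto)
    thus "\<exists>xs. Q 0 xs" by (intro exI[of _ xs]) (auto simp: Q_def)
  next
    fix xs k assume Q: "Q k xs"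
    hence xs: "snd ` set xs \<subseteq> A" by (simp add: Q_def)
    obtain a where a: "a \<in> A" using A(2) by auto
    have xsP: "lin_comb xs \<in> closed_span A" using lin_comb_closed[OF submodule_closed_span[OF A(1)] sup xs] .
    obtain ys where ys: "snd ` set ys \<subseteq> A" "lin_cost ys \<le> B * nrm V (x \<ominus> lin_comb xs) + \<eta> / 2 ^ (k + 3)"
       "nrm V ((x \<ominus> lin_comb xs) \<ominus> lin_comb ys) \<le> d (Suc k)"
      by (rule lin_comb_approximation[OF A(1) B L S(5)[OF x xsP], of "\<eta> / 2 ^ (k + 3)" "d (Suc k)"])
        (use eta d in auto)
    \<comment> \<open>The entry with coefficient 0 is padding: it lengthens the list even when
      \<open>ys\<close> is empty, so that the lists fill every position in the end.\<close>
    let ?zs = "xs @ (ys @ [(0, a)])"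
    have yc: "lin_comb ys \<in> carrier V" "lin_comb xs \<in> carrier V" using cc xs ys by auto
    have ac: "a \<in> carrier V" using a A(1) by auto
    have ya: "snd ` set (ys @ [(0, a)]) \<subseteq> A" "snd ` set [(0::complex, a)] \<subseteq> A" using ys a by auto
    have "lin_comb ?zs = lin_comb xs \<oplus> lin_comb ys"
      using ac yc unfolding lin_comb_append[OF A(1) xs ya(1)] lin_comb_append[OF A(1) ys(1) ya(2)] by simp
    hence "x \<ominus> lin_comb ?zs = (x \<ominus> lin_comb xs) \<ominus> lin_comb ys"
      using xc yc by (simp add: minus_eq minus_add a_ac)
    moreover have "B * nrm V (x \<ominus> lin_comb xs) \<le> \<eta> / 2 ^ (k + 3)"
    proof -
      have "B * nrm V (x \<ominus> lin_comb xs) \<le> (B + 1) * d k"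
        using Q B xc yc by (intro mult_mono) (auto simp: Q_def nrm_nonneg)
      also have "\<dots> = \<eta> / 2 ^ (k + 3)" using B by (simp add: d_def)
      finally show ?thesis .
    qed
    hence "lin_cost ?zs \<le> B * nrm V x + \<eta> * (1 - 1 / 2 ^ (k + 1)) + 2 * (\<eta> / 2 ^ (k + 3))"
      using ys(2) Q by (simp add: Q_def)
    moreover have "\<eta> * (1 - 1 / 2 ^ (k + 1)) + 2 * (\<eta> / 2 ^ (k + 3)) = \<eta> * (1 - 1 / 2 ^ (Suc k + 1))"
      by (simp add: field_simps power_add)
    ultimately have "Q (Suc k) ?zs" using Q ys ya xs a by (auto simp: Q_def)
    thus "\<exists>zs. Q (Suc k) zs \<and> (\<exists>us. zs = xs @ us)" by blast
  qed
  then obtain f where f: "\<And>n. Q n (f n)" "\<And>n. \<exists>zs. f (Suc n) = f n @ zs" by blast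
  have ext: "\<exists>zs. f n = f m @ zs" if "m \<le> n" for m n
    using that
  proof (induction n rule: dec_induct)
    case (step n)
    thus ?case using f(2)[of n] by auto
  qed auto
  have len: "length (f n) \<ge> n" for n using f(1) by (simp add: Q_def)
  \<comment> \<open>The list of index n + 1 has length at least n + 1, and later lists only append,
    so position n is settled from there on.\<close>
  define h where "h n = f (Suc n) ! n" for n
  have h: "f k ! n = h n" if "n < length (f k)" for n k
  proof (cases "k \<le> Suc n")
    case True
    thus ?thesis using ext[OF True] that by (auto simp: h_def nth_append)
  next
    case False
    hence "Suc n \<le> k" by simp
    thus ?thesis using ext[of "Suc n" k] len[of "Suc n"] by (auto simp: h_def nth_append)
  qed
  define c where "c n = fst (h n)" for n
  define a where "a n = snd (h n)" for n
  have aA: "a n \<in> A" for n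
  proof -
    have "h n \<in> set (f (Suc n))" unfolding h_def using len[of "Suc n"] by (intro nth_mem) simp
    thus ?thesis using f(1)[of "Suc n"] by (auto simp: Q_def a_def)
  qed
  have ac: "a n \<in> carrier V" for n using aA A(1) by auto
  have cost: "(\<Sum>n<length (f k). cmod (c n)) = lin_cost (f k)" for k
    unfolding lin_cost_conv_sum by (intro sum.cong) (auto simp: c_def h)
  have cbound: "(\<Sum>n<N. cmod (c n)) \<le> B * nrm V x + \<eta>" for N
  proof -
    have "(\<Sum>n<N. cmod (c n)) \<le> (\<Sum>n<length (f N). cmod (c n))"
      using len[of N] by (intro sum_mono2) auto
    also have "\<dots> \<le> B * nrm V x + \<eta> * (1 - 1 / 2 ^ (N + 1))"
      unfolding cost using f(1)[of N] by (simp add: Q_def)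
    also have "\<dots> \<le> B * nrm V x + \<eta> * 1"
      using eta by (intro add_left_mono mult_left_mono) auto
    finally show ?thesis by simp
  qed
  have sm: "summable (\<lambda>n. cmod (c n))"
    by (rule summableI_nonneg_bounded[OF _ cbound]) auto
  have le: "(\<Sum>n. cmod (c n)) \<le> B * nrm V x + \<eta>"
    by (rule suminf_le_const[OF sm cbound])
  define s where "s N = finsum V (\<lambda>n. c n \<odot> a n) {..<N}" for N
  have sc: "s N \<in> carrier V" for N unfolding s_def using ac by auto
  have s_Suc: "s (Suc N) = c N \<odot> a N \<oplus> s N" for N
    unfolding s_def lessThan_Suc using ac by (subst finsum_insert) auto
  define r where "r N = nrm V (x \<ominus> s N)" for N
  \<comment> \<open>The error is controlled so far only at the lengths of the lists. Consecutive
    errors differ by at most |c N|, which is summable, so the whole sequence of errors converges,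
    and its limit must be the limit 0 along the lengths.\<close>
  have rdiff: "\<bar>r (Suc N) - r N\<bar> \<le> cmod (c N)" for N
  proof -
    let ?t = "c N \<odot> a N"
    have t: "nrm V ?t \<le> cmod (c N)"
      using ac A(3)[OF aA, of N] by (simp add: nrm_smult mult_left_le)
    have "x \<ominus> s (Suc N) = (x \<ominus> s N) \<oplus> \<ominus> ?t"
      using xc sc ac by (simp add: s_Suc minus_eq minus_add a_ac)
    hence 1: "r (Suc N) \<le> r N + cmod (c N)"
      using nrm_triangle[of "x \<ominus> s N" "\<ominus> ?t"] t xc sc ac by (simp add: r_def)
    have "x \<ominus> s N = (x \<ominus> s (Suc N)) \<oplus> ?t"
      using xc sc ac by (simp add: s_Suc minus_eq minus_add a_ac r_neg)
    hence "r N \<le> r (Suc N) + cmod (c N)"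
      using nrm_triangle[of "x \<ominus> s (Suc N)" ?t] t xc sc ac by (simp add: r_def)
    with 1 show ?thesis by simp
  qed
  have "summable (\<lambda>N. r (Suc N) - r N)"
    by (rule summable_comparison_test'[OF sm]) (use rdiff in auto)
  hence "convergent (\<lambda>N. \<Sum>n<N. r (Suc n) - r n)" by (simp add: summable_iff_convergent)
  hence "convergent (\<lambda>N. (r N - r 0) + r 0)"
    unfolding sum_lessThan_telescope by (intro convergent_add convergent_const)
  then obtain l where l: "r \<longlonglongrightarrow> l" by (auto simp: convergent_def)
  have sf: "s (length (f k)) = lin_comb (f k)" for k
    unfolding s_def
    by (subst lin_comb_conv_finsum[OF A(1)]) (use f(1)[of k] ac h in \<open>auto simp: Q_def c_def a_def intro!: finsum_cong'\<close>)
  have sub: "(\<lambda>k. r (length (f k))) \<longlonglongrightarrow> l"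
    by (rule filterlim_compose[OF l]) (rule filterlim_at_top_mono[OF filterlim_ident], use len in auto)
  have lim0: "(\<lambda>k. \<eta> * (1 / 2) ^ k) \<longlonglongrightarrow> \<eta> * 0" by (intro tendsto_intros LIMSEQ_realpow_zero) auto
  have r1: "r (length (f k)) \<le> \<eta> * (1 / 2) ^ k" for k
  proof -
    have "r (length (f k)) \<le> d k" using f(1)[of k] by (simp add: r_def sf Q_def)
    also have "\<dots> \<le> \<eta> / 2 ^ (k + 3) / 1" unfolding d_def using B eta by (intro divide_left_mono) auto
    also have "\<dots> \<le> \<eta> * (1 / 2) ^ k" using eta by (simp add: field_simps power_add)
    finally show ?thesis .
  qed
  have r0: "0 \<le> r N" for N unfolding r_def using xc sc by (simp add: nrm_nonneg)
  have "(\<lambda>k. r (length (f k))) \<longlonglongrightarrow> 0"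
    by (rule tendsto_sandwich[OF _ _ tendsto_const lim0[simplified]])
      (simp_all add: r0 r1 always_eventually)
  with sub have "l = 0" by (metis LIMSEQ_unique)
  hence "nrm_sums V (\<lambda>n. c n \<odot> a n) x"
    using l ac xc unfolding nrm_sums_def r_def s_def by auto
  thus ?thesis using that[of a c] aA sm le by auto
qed

end

text \<open>The argument in abstract form: \<open>norming\<close> makes evaluation isometric,
  \<open>repr\<close> makes it onto, and both together give \<open>norms_functionals\<close> with B
  = 2. Agreement in \<open>repr\<close> is asked for on A; it extends to the closed span because L
  and evaluation at x are both bounded.\<close>

theorem isometric_predual_closed_span:
  fixes V :: "'v normed_module"
  assumes V: "complex_normed_space V" and A: "A \<subseteq> dual_carrier V"
    and norming: "\<And>x r. x \<in> carrier V \<Longrightarrow> r < nrm V x \<Longrightarrow>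
      \<exists>a\<in>A. (\<forall>y\<in>carrier V. 2 * cmod (a y) \<le> nrm V y) \<and> r < 2 * cmod (a x)"
    and repr: "\<And>L K. (\<And>\<phi> \<psi>. \<phi> \<in> complex_normed_space.closed_span (dual V) A \<Longrightarrow>
        \<psi> \<in> complex_normed_space.closed_span (dual V) A \<Longrightarrow> L (\<phi> \<oplus>\<^bsub>dual V\<^esub> \<psi>) = L \<phi> + L \<psi>) \<Longrightarrow>
      (\<And>c \<phi>. \<phi> \<in> complex_normed_space.closed_span (dual V) A \<Longrightarrow> L (c \<odot>\<^bsub>dual V\<^esub> \<phi>) = c * L \<phi>) \<Longrightarrow>
      (\<And>\<phi>. \<phi> \<in> complex_normed_space.closed_span (dual V) A \<Longrightarrow> cmod (L \<phi>) \<le> K * nrm (dual V) \<phi>) \<Longrightarrow>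
      \<exists>x\<in>carrier V. \<forall>a\<in>A. L a = a x"
  shows "isometric_predual V (complex_normed_space.closed_span (dual V) A)"
    and "A \<noteq> {} \<Longrightarrow> (\<And>a. a \<in> A \<Longrightarrow> nrm (dual V) a \<le> 1) \<Longrightarrow>
      \<phi> \<in> complex_normed_space.closed_span (dual V) A \<Longrightarrow> \<eta> > 0 \<Longrightarrow>
      \<exists>c a. range a \<subseteq> A \<and> summable (\<lambda>n. cmod (c n)) \<and> (\<Sum>n. cmod (c n)) \<le> 2 * nrm (dual V) \<phi> + \<eta> \<and>
        nrm_sums (dual V) (\<lambda>n. c n \<odot>\<^bsub>dual V\<^esub> a n) \<phi>"
proof -
  interpret V: complex_normed_space V by (rule V)
  interpret D: complex_normed_space "dual V" by (rule V.complex_normed_space_dual)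
  let ?P = "D.closed_span A"
  have A': "A \<subseteq> carrier (dual V)" using A by simp
  note sub = D.submodule_closed_span[OF A'] and sup = D.closed_span_superset[OF A']
  note S = D.submodule_simps[OF sub]
  have Pd: "\<phi> \<in> dual_carrier V" if "\<phi> \<in> ?P" for \<phi> using S(1) that by auto
  interpret P: complex_normed_space "(dual V)\<lparr>carrier := ?P\<rparr>"
    by (rule D.complex_normed_space_submodule[OF sub])
  let ?W = "(dual V)\<lparr>carrier := ?P\<rparr>"
  have W: "carrier ?W = ?P" "nrm ?W = nrm (dual V)" by simp_all
  have repr': "\<exists>x\<in>carrier V. \<forall>\<phi>\<in>?P. L \<phi> = \<phi> x"
    if L: "\<And>\<phi> \<psi>. \<phi> \<in> ?P \<Longrightarrow> \<psi> \<in> ?P \<Longrightarrow> L (\<phi> \<oplus>\<^bsub>dual V\<^esub> \<psi>) = L \<phi> + L \<psi>"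
      "\<And>c \<phi>. \<phi> \<in> ?P \<Longrightarrow> L (c \<odot>\<^bsub>dual V\<^esub> \<phi>) = c * L \<phi>"
      "\<And>\<phi>. \<phi> \<in> ?P \<Longrightarrow> cmod (L \<phi>) \<le> K * nrm (dual V) \<phi>" for L K
  proof -
    obtain x where x: "x \<in> carrier V" "\<And>a. a \<in> A \<Longrightarrow> L a = a x" using repr[OF L] by blast
    have "L \<phi> - \<phi> x = 0" if \<phi>: "\<phi> \<in> ?P" for \<phi>
    proof (rule D.closed_span_functional_eq_0[OF A' \<phi>, where K = "K + nrm V x"])
      fix \<psi> assume \<psi>: "\<psi> \<in> ?P"
      have "cmod (L \<psi> - \<psi> x) \<le> cmod (L \<psi>) + cmod (\<psi> x)" by (rule norm_triangle_ineq4)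
      also have "\<dots> \<le> (K + nrm V x) * nrm (dual V) \<psi>"
        using L(3)[OF \<psi>] V.dual_apply_le[OF Pd[OF \<psi>] x(1)] by (simp add: algebra_simps)
      finally show "cmod (L \<psi> - \<psi> x) \<le> (K + nrm V x) * nrm (dual V) \<psi>" .
    next
      fix \<psi> \<psi>' assume \<psi>: "\<psi> \<in> ?P" "\<psi>' \<in> ?P"
      show "L (\<psi> \<oplus>\<^bsub>dual V\<^esub> \<psi>') - (\<psi> \<oplus>\<^bsub>dual V\<^esub> \<psi>') x = L \<psi> - \<psi> x + (L \<psi>' - \<psi>' x)"
        unfolding L(1)[OF \<psi>] using x(1) by simp
    next
      fix c \<psi> assume \<psi>: "\<psi> \<in> ?P"
      show "L (c \<odot>\<^bsub>dual V\<^esub> \<psi>) - (c \<odot>\<^bsub>dual V\<^esub> \<psi>) x = c * (L \<psi> - \<psi> x)"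
        unfolding L(2)[OF \<psi>] using x(1) by (simp add: algebra_simps)
    qed (use x in simp)
    thus ?thesis using x(1) by auto
  qed
  \<comment> \<open>The source of the constant 2: it is twice an element of A that comes close to
    the norm of x.\<close>
  have norm_le: "nrm V x \<le> 2 * M" if x: "x \<in> carrier V" and M: "\<And>a. a \<in> A \<Longrightarrow> cmod (a x) \<le> M" for x M
  proof (rule ccontr)
    assume "\<not> nrm V x \<le> 2 * M"
    then obtain a where "a \<in> A" "2 * M < 2 * cmod (a x)" using norming[OF x, of "2 * M"] by auto
    thus False using M[of a] by simp
  qed

  define T where "T = (\<lambda>x. \<lambda>\<phi>\<in>?P. \<phi> x)"
  have T: "T x \<in> dual_carrier ?W" if x: "x \<in> carrier V" for x
    by (rule dual_carrierI[where K = "nrm V x"])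
      (use x S V.dual_apply_le[OF Pd x] in \<open>auto simp: T_def mult.commute simp del: dual_simps(1)\<close>)
  have Tn: "nrm (dual ?W) (T x) = nrm V x" if x: "x \<in> carrier V" for x
  proof (rule antisym)
    show "nrm (dual ?W) (T x) \<le> nrm V x"
      by (rule P.dual_nrm_le) (use x V.dual_apply_le[OF Pd x] V.nrm_nonneg[OF x] in \<open>auto simp: T_def mult.commute\<close>)
    show "nrm V x \<le> nrm (dual ?W) (T x)"
    proof (rule dense_le)
      fix r assume "r < nrm V x"
      then obtain a where a: "a \<in> A" "\<And>y. y \<in> carrier V \<Longrightarrow> 2 * cmod (a y) \<le> nrm V y" "r < 2 * cmod (a x)"
        using norming[OF x] by blast
      have aP: "a \<in> ?P" using a sup by auto
      \<comment> \<open>Twice this particular a still lies in the unit ball, which cancels the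
        factor 2; a norming element with no more than norm 1 would lose it.\<close>
      have an: "nrm (dual V) a \<le> 1 / 2" using a(2) by (intro V.dual_nrm_le) (auto simp: mult.commute)
      have "cmod (a x) = cmod (T x a)" using aP by (simp add: T_def)
      also have "\<dots> \<le> nrm (dual ?W) (T x) * nrm (dual V) a"
        using P.dual_apply_le[OF T[OF x], of a] aP by simp
      also have "\<dots> \<le> nrm (dual ?W) (T x) * (1 / 2)"
        using an P.dual_nrm_nonneg[OF T[OF x]] by (intro mult_left_mono)
      finally show "r \<le> nrm (dual ?W) (T x)" using a(3) by simp
    qed
  qed
  have Tadd: "T (x \<oplus>\<^bsub>V\<^esub> y) = T x \<oplus>\<^bsub>dual ?W\<^esub> T y" if "x \<in> carrier V" "y \<in> carrier V" for x y
    using that by (auto simp: T_def V.dual_add[OF Pd] intro!: restrict_ext)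
  have Tsm: "T (c \<odot>\<^bsub>V\<^esub> x) = c \<odot>\<^bsub>dual ?W\<^esub> T x" if "x \<in> carrier V" for c x
    using that by (auto simp: T_def V.dual_smult[OF Pd] intro!: restrict_ext)
  interpret DW: complex_normed_space "dual ?W" by (rule P.complex_normed_space_dual)
  have Tminus: "T (x \<ominus>\<^bsub>V\<^esub> y) = T x \<ominus>\<^bsub>dual ?W\<^esub> T y" if "x \<in> carrier V" "y \<in> carrier V" for x y
    using that T[of y] Tadd[of x "(-1) \<odot>\<^bsub>V\<^esub> y"] Tsm[of y "-1"]
    by (simp add: a_minus_def V.smult_minus_one DW.smult_minus_one[symmetric] del: dual_simps(2-))
  have inj: "inj_on T (carrier V)"
  proof (rule inj_onI)
    fix x y assume xy: "x \<in> carrier V" "y \<in> carrier V" "T x = T y"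
    have "nrm V (x \<ominus>\<^bsub>V\<^esub> y) = nrm (dual ?W) (T x \<ominus>\<^bsub>dual ?W\<^esub> T y)"
      using Tn[of "x \<ominus>\<^bsub>V\<^esub> y"] xy Tminus[of x y] by simp
    also have "\<dots> = 0" using xy T[of y] DW.r_neg[of "T y"] DW.nrm_zero by (simp add: a_minus_def del: dual_simps(2-))
    finally have "x \<ominus>\<^bsub>V\<^esub> y = \<zero>\<^bsub>V\<^esub>" using V.nrm_eq_0[of "x \<ominus>\<^bsub>V\<^esub> y"] xy by simp
    thus "x = y" using xy V.minus_equality[of x "\<ominus>\<^bsub>V\<^esub> y"] by (simp add: V.minus_eq)
  qed
  have surj: "\<exists>x\<in>carrier V. T x = \<xi>" if xi: "\<xi> \<in> dual_carrier ?W" for \<xi>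
  proof -
    have "\<exists>x\<in>carrier V. \<forall>\<phi>\<in>?P. \<xi> \<phi> = \<phi> x"
      by (rule repr'[where K = "nrm (dual ?W) \<xi>"])
        (use P.dual_add[OF xi] P.dual_smult[OF xi] P.dual_apply_le[OF xi] in \<open>simp_all del: dual_simps\<close>)
    then obtain x where x: "x \<in> carrier V" "\<And>\<phi>. \<phi> \<in> ?P \<Longrightarrow> \<xi> \<phi> = \<phi> x" by blast
    have "T x = \<xi>"
      by (rule extensionalityI[of _ ?P]) (use x P.dual_ext[OF xi] in \<open>auto simp: T_def\<close>)
    thus ?thesis using x by blast
  qed
  have iso: "isometric_isomorphism V (dual ?W) T"
    unfolding isometric_isomorphism_def bij_betw_def
    using inj T surj Tadd Tsm Tn by (auto simp del: dual_simps(2-))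
  have cpl: "complex_banach V"
  proof (rule V.complex_banach_iff[THEN iffD2], intro allI impI)
    fix \<sigma> :: "nat \<Rightarrow> 'v"
    assume "range \<sigma> \<subseteq> carrier V"
    hence \<sigma>: "\<sigma> n \<in> carrier V" for n by auto
    assume C: "\<forall>e>0. \<exists>N. \<forall>m\<ge>N. \<forall>n\<ge>N. nrm V (\<sigma> m \<ominus>\<^bsub>V\<^esub> \<sigma> n) < e"
    have eq: "nrm (dual ?W) (T x \<ominus>\<^bsub>dual ?W\<^esub> T y) = nrm V (x \<ominus>\<^bsub>V\<^esub> y)"
      if "x \<in> carrier V" "y \<in> carrier V" for x y
      using Tn[of "x \<ominus>\<^bsub>V\<^esub> y"] that by (simp add: Tminus)
    have "\<exists>\<xi>\<in>carrier (dual ?W). \<forall>e>0. \<exists>N. \<forall>n\<ge>N. nrm (dual ?W) (T (\<sigma> n) \<ominus>\<^bsub>dual ?W\<^esub> \<xi>) < e"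
      using DW.complex_banach_iff[THEN iffD1, OF P.complex_banach_dual, rule_format, of "\<lambda>n. T (\<sigma> n)"] C T[OF \<sigma>]
      by (auto simp: eq[OF \<sigma> \<sigma>] image_subset_iff)
    then obtain \<xi> where \<xi>: "\<xi> \<in> dual_carrier ?W" "\<forall>e>0. \<exists>N. \<forall>n\<ge>N. nrm (dual ?W) (T (\<sigma> n) \<ominus>\<^bsub>dual ?W\<^esub> \<xi>) < e"
      by auto
    obtain x where x: "x \<in> carrier V" "T x = \<xi>" using surj[OF \<xi>(1)] by blast
    show "\<exists>x\<in>carrier V. \<forall>e>0. \<exists>N. \<forall>n\<ge>N. nrm V (\<sigma> n \<ominus>\<^bsub>V\<^esub> x) < e"
      using \<xi>(2) x(1) unfolding x(2)[symmetric] eq[OF \<sigma> x(1)] by blast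
  qed
  show "isometric_predual V ?P"
    unfolding isometric_predual_def
    using cpl sub iso D.closedin_nrm_dist[OF S(1) D.closed_span_closed[OF A']]
      D.complex_banach_closed_submodule[OF V.complex_banach_dual sub D.closed_span_closed[OF A']]
    unfolding T_def by blast
  show "\<exists>c a. range a \<subseteq> A \<and> summable (\<lambda>n. cmod (c n)) \<and> (\<Sum>n. cmod (c n)) \<le> 2 * nrm (dual V) \<phi> + \<eta> \<and>
        nrm_sums (dual V) (\<lambda>n. c n \<odot>\<^bsub>dual V\<^esub> a n) \<phi>"
    if A1: "A \<noteq> {}" "\<And>a. a \<in> A \<Longrightarrow> nrm (dual V) a \<le> 1" and \<phi>: "\<phi> \<in> ?P" and \<eta>: "\<eta> > 0"
  proof -
    \<comment> \<open>L is evaluation at some x, and being at most 1 on A bounds the norm of x by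
      2.\<close>
    have "cmod (L \<psi>) \<le> 2 * nrm (dual V) \<psi>"
      if L: "\<And>\<phi> \<psi>. \<phi> \<in> ?P \<Longrightarrow> \<psi> \<in> ?P \<Longrightarrow> L (\<phi> \<oplus>\<^bsub>dual V\<^esub> \<psi>) = L \<phi> + L \<psi>"
      "\<And>c \<phi>. \<phi> \<in> ?P \<Longrightarrow> L (c \<odot>\<^bsub>dual V\<^esub> \<phi>) = c * L \<phi>"
      "\<And>\<phi>. \<phi> \<in> ?P \<Longrightarrow> cmod (L \<phi>) \<le> K * nrm (dual V) \<phi>" and 1: "\<And>a. a \<in> A \<Longrightarrow> cmod (L a) \<le> 1"
      and \<psi>: "\<psi> \<in> ?P" for L K \<psi>
    proof -
      obtain x where x: "x \<in> carrier V" "\<And>\<phi>. \<phi> \<in> ?P \<Longrightarrow> L \<phi> = \<phi> x" using repr'[OF L] by blast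
      have "nrm V x \<le> 2 * 1" using 1 x sup by (intro norm_le) force+
      hence "nrm (dual V) \<psi> * nrm V x \<le> nrm (dual V) \<psi> * 2"
        using V.dual_nrm_nonneg[OF Pd[OF \<psi>]] by (intro mult_left_mono) auto
      thus ?thesis using V.dual_apply_le[OF Pd[OF \<psi>] x(1)] x(2)[OF \<psi>] by simp
    qed
    hence "D.norms_functionals A 2" unfolding D.norms_functionals_def by blast
    show ?thesis
      by (rule D.atomic_decomposition[OF A' A1 _ \<open>D.norms_functionals A 2\<close> \<phi> \<eta>]) (assumption, simp, blast)
  qed
qed

section \<open>Representation of functionals on bounded measurable functions\<close>

text \<open>The hypothesis \<open>cont\<close> acts twice: along sets that decrease to the empty set
  it makes \<nu> tend to 0, hence \<nu> is countably additive, and on null sets it makes \<nu>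
  vanish. As C depends on \<delta>, the density is integrable but may be unbounded.\<close>

lemma (in finite_measure) Radon_Nikodym_nonneg_additive:
  fixes \<nu> :: "'a set \<Rightarrow> real"
  assumes add: "\<And>A B. A \<in> sets M \<Longrightarrow> B \<in> sets M \<Longrightarrow> A \<inter> B = {} \<Longrightarrow> \<nu> (A \<union> B) = \<nu> A + \<nu> B"
    and nonneg: "\<And>A. A \<in> sets M \<Longrightarrow> 0 \<le> \<nu> A"
    and cont: "\<And>\<delta>. \<delta> > 0 \<Longrightarrow> \<exists>C. \<forall>A\<in>sets M. \<nu> A \<le> C * measure M A + \<delta>"
  obtains f where "integrable M f" "\<And>A. A \<in> sets M \<Longrightarrow> \<nu> A = (LINT x|M. f x * indicator A x)"
proof -
  define N where "N = measure_of (space M) (sets M) (\<lambda>A. ennreal (\<nu> A))"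
  have empty: "\<nu> {} = 0" using add[of "{}" "{}"] by simp
  have pos: "positive (sets M) (\<lambda>A. ennreal (\<nu> A))" by (simp add: positive_def empty)
  have ca: "countably_additive (sets M) (\<lambda>A. ennreal (\<nu> A))"
  proof (rule sets.empty_continuous_imp_countably_additive[OF pos])
    show "additive (sets M) (\<lambda>A. ennreal (\<nu> A))"
      by (auto simp: additive_def add nonneg)
    fix A :: "nat \<Rightarrow> 'a set" assume A: "range A \<subseteq> sets M" "decseq A" "(\<Inter>i. A i) = {}"
    have lim: "(\<lambda>i. measure M (A i)) \<longlonglongrightarrow> 0" using finite_Lim_measure_decseq[OF A(1,2)] A(3) by simp
    have "(\<lambda>i. \<nu> (A i)) \<longlonglongrightarrow> 0"
    proof (rule tendstoI)
      fix e :: real assume e: "e > 0"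
      then obtain C where C: "\<And>B. B \<in> sets M \<Longrightarrow> \<nu> B \<le> C * measure M B + e / 2"
        using cont[of "e / 2"] by auto
      have lim': "(\<lambda>i. C * measure M (A i) + e / 2) \<longlonglongrightarrow> C * 0 + e / 2" by (intro tendsto_intros lim)
      have "\<forall>\<^sub>F i in sequentially. C * measure M (A i) + e / 2 < e"
        by (rule order_tendstoD(2)[OF lim']) (use e in simp)
      thus "\<forall>\<^sub>F i in sequentially. dist (\<nu> (A i)) 0 < e"
      proof eventually_elim
        case (elim i)
        have "A i \<in> sets M" using A(1) by auto
        thus ?case using C[of "A i"] nonneg[of "A i"] elim by simp
      qed
    qed
    thus "(\<lambda>i. ennreal (\<nu> (A i))) \<longlonglongrightarrow> 0" using tendsto_ennrealI by fastforce
  qed auto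
  have sN: "sets N = sets M" "space N = space M" by (simp_all add: N_def)
  have eN: "emeasure N A = ennreal (\<nu> A)" if "A \<in> sets M" for A
    unfolding N_def using sets.space_closed pos ca that by (intro emeasure_measure_of_sigma sets.sigma_algebra_axioms) auto
  interpret N: finite_measure N by (rule finite_measureI) (simp add: sN eN)
  have ac: "absolutely_continuous M N"
    unfolding absolutely_continuous_def
  proof
    fix A assume A: "A \<in> null_sets M"
    have "\<nu> A \<le> 0 + \<delta>" if "\<delta> > 0" for \<delta>
      using cont[OF that] A by (auto simp: null_sets_def measure_def)
    hence "\<nu> A \<le> 0" by (rule field_le_epsilon)
    thus "A \<in> null_sets N" using A eN[of A] by (auto simp: null_sets_def sN ennreal_eq_0_iff)
  qed
  obtain f where f: "f \<in> borel_measurable M" "AE x in M. RN_deriv M N x = ennreal (f x)" "\<And>x. 0 \<le> f x"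
    using real_RN_deriv[OF N.finite_measure_axioms ac sN(1)] by metis
  have "density M (\<lambda>x. ennreal (f x)) = density M (RN_deriv M N)"
    using f by (intro density_cong) auto
  hence dN: "N = density M (\<lambda>x. ennreal (f x))" using density_RN_deriv[OF ac sN(1)] by simp
  have "integrable N (\<lambda>x. 1::real)" by simp
  hence fi: "integrable M f" unfolding dN using f by (subst (asm) integrable_density) auto
  have "\<nu> A = (LINT x|M. f x * indicator A x)" if A: "A \<in> sets M" for A
  proof -
    have "\<nu> A = measure N A" using eN[OF A] nonneg[OF A] by (simp add: measure_def)
    also have "\<dots> = (LINT x|N. indicator A x)" using A sN by simp
    also have "\<dots> = (LINT x|M. f x * indicator A x)"
      unfolding dN using f A by (subst integral_density) auto
    finally show ?thesis .
  qed
  with fi show ?thesis by (rule that)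
qed

text \<open>A Jordan decomposition: p is the positive variation of \<nu>, and both p and p - \<nu>
  are nonnegative, additive and inherit the smallness condition, so that each has a density.\<close>

lemma (in finite_measure) Radon_Nikodym_additive:
  fixes \<nu> :: "'a set \<Rightarrow> real"
  assumes add: "\<And>A B. A \<in> sets M \<Longrightarrow> B \<in> sets M \<Longrightarrow> A \<inter> B = {} \<Longrightarrow> \<nu> (A \<union> B) = \<nu> A + \<nu> B"
    and cont: "\<And>\<delta>. \<delta> > 0 \<Longrightarrow> \<exists>C. \<forall>A\<in>sets M. \<bar>\<nu> A\<bar> \<le> C * measure M A + \<delta>"
  obtains f where "integrable M f" "\<And>A. A \<in> sets M \<Longrightarrow> \<nu> A = (LINT x|M. f x * indicator A x)"
proof -
  \<comment> \<open>A nonnegative constant makes the bound monotone in the set, which the supremum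
    over subsets in p requires.\<close>
  have cont': "\<exists>C\<ge>0. \<forall>A\<in>sets M. \<bar>\<nu> A\<bar> \<le> C * measure M A + \<delta>" if \<delta>: "\<delta> > 0" for \<delta>
  proof -
    obtain C where C: "\<And>A. A \<in> sets M \<Longrightarrow> \<bar>\<nu> A\<bar> \<le> C * measure M A + \<delta>" using cont[OF \<delta>] by blast
    have "C * measure M A \<le> max C 0 * measure M A" for A by (intro mult_right_mono) auto
    hence "\<bar>\<nu> A\<bar> \<le> max C 0 * measure M A + \<delta>" if "A \<in> sets M" for A
      using C[OF that] by (meson add_right_mono order_trans)
    thus ?thesis by (intro exI[of _ "max C 0"]) auto
  qed
  have empty: "\<nu> {} = 0" using add[of "{}" "{}"] by simp
  define p where "p A = (SUP B\<in>{B \<in> sets M. B \<subseteq> A}. \<nu> B)" for A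
  have le: "\<nu> B \<le> C * measure M A + \<delta>"
    if "C \<ge> 0" "\<forall>A\<in>sets M. \<bar>\<nu> A\<bar> \<le> C * measure M A + \<delta>" "A \<in> sets M" "B \<in> sets M" "B \<subseteq> A" for A B C \<delta>
  proof -
    have "measure M B \<le> measure M A" using that by (intro finite_measure_mono)
    hence "C * measure M B \<le> C * measure M A" using that by (intro mult_left_mono)
    thus ?thesis using that(2)[rule_format, OF that(4)] by linarith
  qed
  have bdd: "bdd_above (\<nu> ` {B \<in> sets M. B \<subseteq> A})" if "A \<in> sets M" for A
  proof -
    obtain C where "C \<ge> 0" "\<forall>A\<in>sets M. \<bar>\<nu> A\<bar> \<le> C * measure M A + 1" using cont'[of 1] by auto
    thus ?thesis using le that by (intro bdd_aboveI2[of _ _ "C * measure M A + 1"]) blast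
  qed
  have up: "\<nu> B \<le> p A" if "A \<in> sets M" "B \<in> sets M" "B \<subseteq> A" for A B
    unfolding p_def using bdd that by (intro cSUP_upper) auto
  have least: "p A \<le> a" if "\<And>B. B \<in> sets M \<Longrightarrow> B \<subseteq> A \<Longrightarrow> \<nu> B \<le> a" for A a
    unfolding p_def using that by (intro cSUP_least) (auto intro: exI[of _ "{}"])
  have p0: "0 \<le> p A" if "A \<in> sets M" for A using up[OF that, of "{}"] empty by simp
  have padd: "p (A \<union> B) = p A + p B" if AB: "A \<in> sets M" "B \<in> sets M" "A \<inter> B = {}" for A B
  proof (rule antisym)
    show "p (A \<union> B) \<le> p A + p B"
    proof (rule least)
      fix E assume E: "E \<in> sets M" "E \<subseteq> A \<union> B"
      have "E = (E \<inter> A) \<union> (E \<inter> B)" using E by auto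
      hence "\<nu> E = \<nu> (E \<inter> A) + \<nu> (E \<inter> B)" using add[of "E \<inter> A" "E \<inter> B"] E AB by auto
      thus "\<nu> E \<le> p A + p B" using up[of A "E \<inter> A"] up[of B "E \<inter> B"] E AB by auto
    qed
    have *: "\<nu> E + \<nu> F \<le> p (A \<union> B)" if "E \<in> sets M" "E \<subseteq> A" "F \<in> sets M" "F \<subseteq> B" for E F
    proof -
      have "E \<inter> F = {}" "E \<union> F \<subseteq> A \<union> B" using that AB by blast+
      thus ?thesis using add[of E F] that AB up[of "A \<union> B" "E \<union> F"] by auto
    qed
    have "p A \<le> p (A \<union> B) - p B"
    proof (rule least)
      fix E assume E: "E \<in> sets M" "E \<subseteq> A"
      have "p B \<le> p (A \<union> B) - \<nu> E" by (rule least) (use *[OF E] in force)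
      thus "\<nu> E \<le> p (A \<union> B) - p B" by simp
    qed
    thus "p A + p B \<le> p (A \<union> B)" by simp
  qed
  have pc: "\<exists>C. \<forall>A\<in>sets M. p A \<le> C * measure M A + \<delta>" if \<delta>: "\<delta> > 0" for \<delta>
  proof -
    obtain C where C: "C \<ge> 0" "\<forall>A\<in>sets M. \<bar>\<nu> A\<bar> \<le> C * measure M A + \<delta>" using cont'[OF \<delta>] by auto
    show ?thesis using le[OF C] by (intro exI[of _ C] ballI least)
  qed
  have pm: "\<exists>C. \<forall>A\<in>sets M. p A - \<nu> A \<le> C * measure M A + \<delta>" if "\<delta> > 0" for \<delta>
  proof -
    have "\<delta> / 2 > 0" using that by simp
    obtain C where C: "\<forall>A\<in>sets M. \<bar>\<nu> A\<bar> \<le> C * measure M A + \<delta> / 2" using cont[OF \<open>\<delta> / 2 > 0\<close>] by auto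
    obtain C' where C': "\<forall>A\<in>sets M. p A \<le> C' * measure M A + \<delta> / 2" using pc[OF \<open>\<delta> / 2 > 0\<close>] by auto
    have "p A - \<nu> A \<le> (C + C') * measure M A + \<delta>" if "A \<in> sets M" for A
      using C[rule_format, OF that] C'[rule_format, OF that] by (simp add: distrib_right)
    thus ?thesis by blast
  qed
  obtain f where f: "integrable M f" "\<And>A. A \<in> sets M \<Longrightarrow> p A = (LINT x|M. f x * indicator A x)"
    by (rule Radon_Nikodym_nonneg_additive[of p]) (use padd p0 pc in auto)
  obtain g where g: "integrable M g" "\<And>A. A \<in> sets M \<Longrightarrow> p A - \<nu> A = (LINT x|M. g x * indicator A x)"
    by (rule Radon_Nikodym_nonneg_additive[of "\<lambda>A. p A - \<nu> A"]) (use padd add up pm in auto)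
  show ?thesis
  proof (rule that[of "\<lambda>x. f x - g x"])
    show "integrable M (\<lambda>x. f x - g x)" using f g by simp
    fix A assume A: "A \<in> sets M"
    have "integrable M (\<lambda>x. f x * indicator A x)" "integrable M (\<lambda>x. g x * indicator A x)"
      using f(1) g(1) A by (auto intro: integrable_real_mult_indicator)
    thus "\<nu> A = (LINT x|M. (f x - g x) * indicator A x)"
      using f(2)[OF A] g(2)[OF A] by (simp add: left_diff_distrib)
  qed
qed

section \<open>Bounded measurable functions and the functionals on them\<close>

definition bounded_measurable :: "'a measure \<Rightarrow> ('a \<Rightarrow> complex) set" where
  "bounded_measurable M = {g \<in> borel_measurable M. \<exists>b. \<forall>x\<in>space M. cmod (g x) \<le> b}"

lemma bounded_measurableI:
  "g \<in> borel_measurable M \<Longrightarrow> (\<And>x. x \<in> space M \<Longrightarrow> cmod (g x) \<le> b) \<Longrightarrow> g \<in> bounded_measurable M"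
  by (auto simp: bounded_measurable_def)

lemma bounded_measurableD:
  "g \<in> bounded_measurable M \<Longrightarrow> g \<in> borel_measurable M"
  by (simp add: bounded_measurable_def)

lemma bounded_measurable_add:
  assumes "g \<in> bounded_measurable M" "h \<in> bounded_measurable M"
  shows "(\<lambda>x. g x + h x) \<in> bounded_measurable M"
proof -
  obtain b c where "\<And>x. x \<in> space M \<Longrightarrow> cmod (g x) \<le> b" "\<And>x. x \<in> space M \<Longrightarrow> cmod (h x) \<le> c"
    using assms by (auto simp: bounded_measurable_def)
  thus ?thesis using assms[THEN bounded_measurableD]
    by (intro bounded_measurableI[where b = "b + c"]) (auto intro: norm_triangle_le add_mono)
qed

lemma bounded_measurable_mult:
  assumes "g \<in> bounded_measurable M" "h \<in> bounded_measurable M"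
  shows "(\<lambda>x. g x * h x) \<in> bounded_measurable M"
proof -
  obtain b c where bc: "\<And>x. x \<in> space M \<Longrightarrow> cmod (g x) \<le> b" "\<And>x. x \<in> space M \<Longrightarrow> cmod (h x) \<le> c"
    using assms by (auto simp: bounded_measurable_def)
  have "cmod (g x) * cmod (h x) \<le> \<bar>b\<bar> * \<bar>c\<bar>" if "x \<in> space M" for x
    using bc[OF that] by (intro mult_mono) auto
  thus ?thesis using assms[THEN bounded_measurableD]
    by (intro bounded_measurableI[where b = "\<bar>b\<bar> * \<bar>c\<bar>"]) (auto simp: norm_mult)
qed

lemma bounded_measurable_const [simp]: "(\<lambda>x. c) \<in> bounded_measurable M"
  by (rule bounded_measurableI[where b = "cmod c"]) auto

lemma bounded_measurable_diff:
  "g \<in> bounded_measurable M \<Longrightarrow> h \<in> bounded_measurable M \<Longrightarrow> (\<lambda>x. g x - h x) \<in> bounded_measurable M"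
  using bounded_measurable_add[of g M "\<lambda>x. (-1) * h x"] bounded_measurable_mult[of "\<lambda>_. -1" M h]
  by (simp del: mult_minus_left add: mult_minus1)

lemma bounded_measurable_sum:
  "finite I \<Longrightarrow> (\<And>i. i \<in> I \<Longrightarrow> g i \<in> bounded_measurable M) \<Longrightarrow> (\<lambda>x. \<Sum>i\<in>I. g i x) \<in> bounded_measurable M"
  by (induction I rule: finite_induct) (auto intro: bounded_measurable_add)

lemma bounded_measurable_indicator: "A \<in> sets M \<Longrightarrow> indicator A \<in> bounded_measurable M"
  by (rule bounded_measurableI[where b = 1]) (auto simp: indicator_def)

lemma bounded_measurable_mult_indicator:
  "A \<in> sets M \<Longrightarrow> (\<lambda>x. c * indicator A x) \<in> bounded_measurable M"
  by (rule bounded_measurable_mult[OF bounded_measurable_const bounded_measurable_indicator])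

lemma integrable_bounded_measurable:
  assumes "integrable M f" "g \<in> bounded_measurable M"
  shows "integrable M (\<lambda>x. f x * g x)"
proof -
  obtain b where "\<And>x. x \<in> space M \<Longrightarrow> cmod (g x) \<le> b" using assms by (auto simp: bounded_measurable_def)
  hence le: "norm (f x * g x) \<le> norm (b * cmod (f x))" if "x \<in> space M" for x
    using that mult_left_mono[of "cmod (g x)" b "cmod (f x)"] abs_ge_self[of "b * cmod (f x)"]
    by (simp add: norm_mult mult.commute)
  show ?thesis
  proof (rule Bochner_Integration.integrable_bound)
    show "integrable M (\<lambda>x. b * cmod (f x))" using assms(1) by (intro integrable_mult_right integrable_norm)
    show "(\<lambda>x. f x * g x) \<in> borel_measurable M"
      using bounded_measurableD[OF assms(2)] borel_measurable_integrable[OF assms(1)] by (rule borel_measurable_times[rotated])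
    show "AE x in M. norm (f x * g x) \<le> norm (b * cmod (f x))" by (rule AE_I2) (rule le)
  qed
qed

text \<open>The values on indicators determine f. The difference of \<Lambda> and integration
  against f vanishes on step functions and is bounded for the sup norm, and step functions are
  uniformly dense in the bounded measurable functions.\<close>

theorem (in finite_measure) bounded_measurable_functional_representation:
  fixes \<Lambda> :: "('a \<Rightarrow> complex) \<Rightarrow> complex"
  assumes add: "\<And>g h. g \<in> bounded_measurable M \<Longrightarrow> h \<in> bounded_measurable M \<Longrightarrow> \<Lambda> (\<lambda>x. g x + h x) = \<Lambda> g + \<Lambda> h"
    and smult: "\<And>c g. g \<in> bounded_measurable M \<Longrightarrow> \<Lambda> (\<lambda>x. c * g x) = c * \<Lambda> g"
    and cont: "\<And>\<delta>. \<delta> > 0 \<Longrightarrow> \<exists>C. \<forall>g b. g \<in> borel_measurable M \<longrightarrow> (\<forall>x\<in>space M. cmod (g x) \<le> b) \<longrightarrow>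
      cmod (\<Lambda> g) \<le> C * (LINT x|M. cmod (g x)) + \<delta> * b"
  obtains f where "integrable M f" "\<And>g. g \<in> bounded_measurable M \<Longrightarrow> \<Lambda> g = (LINT x|M. f x * g x)"
proof -
  have \<nu>: "\<Lambda> (indicator (A \<union> B)) = \<Lambda> (indicator A) + \<Lambda> (indicator B)"
    if "A \<in> sets M" "B \<in> sets M" "A \<inter> B = {}" for A B
  proof -
    have "indicator (A \<union> B) = (\<lambda>x. indicator A x + indicator B x :: complex)"
      using that by (auto simp: indicator_def fun_eq_iff)
    thus ?thesis using add[of "indicator A" "indicator B"] that by (simp add: bounded_measurable_indicator)
  qed
  have c\<nu>: "\<exists>C. \<forall>A\<in>sets M. cmod (\<Lambda> (indicator A)) \<le> C * measure M A + \<delta>" if \<delta>: "\<delta> > 0" for \<delta>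
  proof -
    obtain C where C: "\<And>g b. g \<in> borel_measurable M \<Longrightarrow> (\<And>x. x\<in>space M \<Longrightarrow> cmod (g x) \<le> b) \<Longrightarrow>
      cmod (\<Lambda> g) \<le> C * (LINT x|M. cmod (g x)) + \<delta> * b" using cont[OF \<delta>] by blast
    have "cmod (\<Lambda> (indicator A)) \<le> C * measure M A + \<delta>" if A: "A \<in> sets M" for A
    proof -
      have "(LINT x|M. cmod (indicator A x)) = (LINT x|M. indicator A x)"
        by (intro Bochner_Integration.integral_cong) (auto simp: indicator_def)
      thus ?thesis using C[of "indicator A" 1] A by (auto split: split_indicator_asm split_indicator)
    qed
    thus ?thesis by blast
  qed
  obtain u where u: "integrable M u" "\<And>A. A \<in> sets M \<Longrightarrow> Re (\<Lambda> (indicator A)) = (LINT x|M. u x * indicator A x)"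
    by (rule Radon_Nikodym_additive[of "\<lambda>A. Re (\<Lambda> (indicator A))"])
      (auto simp: \<nu> dest!: c\<nu> intro: order_trans[OF abs_Re_le_cmod])
  obtain v where v: "integrable M v" "\<And>A. A \<in> sets M \<Longrightarrow> Im (\<Lambda> (indicator A)) = (LINT x|M. v x * indicator A x)"
    by (rule Radon_Nikodym_additive[of "\<lambda>A. Im (\<Lambda> (indicator A))"])
      (auto simp: \<nu> dest!: c\<nu> intro: order_trans[OF abs_Im_le_cmod])
  define f where "f x = complex_of_real (u x) + \<i> * complex_of_real (v x)" for x
  have f: "integrable M f" unfolding f_def using u v by auto
  define L where "L g = \<Lambda> g - (LINT x|M. f x * g x)" for g
  have Ladd: "L (\<lambda>x. g x + h x) = L g + L h" if "g \<in> bounded_measurable M" "h \<in> bounded_measurable M" for g h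
    using integrable_bounded_measurable[OF f that(1)] integrable_bounded_measurable[OF f that(2)]
    by (simp add: L_def add[OF that] distrib_left)
  have Lsm: "L (\<lambda>x. c * g x) = c * L g" if "g \<in> bounded_measurable M" for c g
    by (simp add: L_def smult[OF that] right_diff_distrib mult.left_commute[of _ c])
  have Lind: "L (indicator A) = 0" if A: "A \<in> sets M" for A
  proof -
    have i: "integrable M (\<lambda>x. complex_of_real (u x * indicator A x))" "integrable M (\<lambda>x. complex_of_real (v x * indicator A x))"
      using u(1) v(1) A by (auto intro!: integrable_of_real integrable_real_mult_indicator simp del: of_real_mult)
    have "(LINT x|M. f x * indicator A x) = (LINT x|M. complex_of_real (u x * indicator A x) + \<i> * complex_of_real (v x * indicator A x))"
      by (intro Bochner_Integration.integral_cong) (auto simp: f_def indicator_def)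
    also have "\<dots> = complex_of_real (LINT x|M. u x * indicator A x) + \<i> * complex_of_real (LINT x|M. v x * indicator A x)"
      using i by (subst Bochner_Integration.integral_add) (simp_all del: of_real_mult)
    also have "\<dots> = \<Lambda> (indicator A)" unfolding u(2)[OF A, symmetric] v(2)[OF A, symmetric]
      by (simp add: complex_eq_iff)
    finally show ?thesis by (simp add: L_def)
  qed
  \<comment> \<open>Integer indices, because the step functions used below are indexed by the values
    of a floor.\<close>
  have Lsum: "L (\<lambda>x. \<Sum>i\<in>I. c i * indicator (A i) x) = 0"
    if "finite I" "\<And>i. i \<in> I \<Longrightarrow> A i \<in> sets M" for I :: "int set" and c A
    using that
  proof (induction I rule: finite_induct)
    case empty
    show ?case using Lsm[of "\<lambda>_. 0" 0] by simp
  next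
    case (insert i I)
    have 1: "(\<lambda>x. c i * indicator (A i) x) \<in> bounded_measurable M"
      using insert.prems by (intro bounded_measurable_mult_indicator) auto
    have 2: "(\<lambda>x. \<Sum>i\<in>I. c i * indicator (A i) x) \<in> bounded_measurable M"
      using insert.prems insert.hyps by (intro bounded_measurable_sum bounded_measurable_mult_indicator) auto
    have "L (indicator (A i)) = 0" "L (\<lambda>x. c i * indicator (A i) x) = c i * L (indicator (A i))"
      using insert.prems by (auto intro!: Lind Lsm bounded_measurable_indicator)
    moreover have "L (\<lambda>x. \<Sum>i\<in>I. c i * indicator (A i) x) = 0" using insert by blast
    ultimately show ?case unfolding sum.insert[OF insert.hyps] Ladd[OF 1 2] by simp
  qed
  \<comment> \<open>The case \<delta> = 1 of \<open>cont\<close> suffices, since the L1 norm is at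
    most the sup norm times the total mass.\<close>
  obtain K where K: "K \<ge> 0" "\<And>g b. g \<in> borel_measurable M \<Longrightarrow> (\<And>x. x \<in> space M \<Longrightarrow> cmod (g x) \<le> b) \<Longrightarrow> b \<ge> 0 \<Longrightarrow> cmod (L g) \<le> K * b"
  proof -
    obtain C where C: "\<And>g b. g \<in> borel_measurable M \<Longrightarrow> (\<And>x. x\<in>space M \<Longrightarrow> cmod (g x) \<le> b) \<Longrightarrow>
      cmod (\<Lambda> g) \<le> C * (LINT x|M. cmod (g x)) + 1 * b" using cont[OF zero_less_one] by blast
    define K where "K = \<bar>C\<bar> * measure M (space M) + 1 + (LINT x|M. cmod (f x))"
    have "cmod (L g) \<le> K * b" if g: "g \<in> borel_measurable M" "\<And>x. x \<in> space M \<Longrightarrow> cmod (g x) \<le> b" "b \<ge> 0" for g b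
    proof -
      have gi: "integrable M g" using g by (intro integrable_const_bound[of _ b]) auto
      have fg: "integrable M (\<lambda>x. f x * g x)" using f g by (intro integrable_bounded_measurable bounded_measurableI)
      have 1: "(LINT x|M. cmod (g x)) \<le> (LINT x|M. b)" using g gi by (intro integral_mono) auto
      have "C * (LINT x|M. cmod (g x)) \<le> \<bar>C\<bar> * (measure M (space M) * b)"
        using 1 by (intro mult_mono) auto
      moreover have "cmod (LINT x|M. f x * g x) \<le> (LINT x|M. cmod (f x) * b)"
        by (rule order_trans[OF integral_norm_bound])
          (use f g in \<open>intro integral_mono integrable_norm[OF fg], auto simp: norm_mult mult_left_mono\<close>)
      moreover have "cmod (L g) \<le> cmod (\<Lambda> g) + cmod (LINT x|M. f x * g x)" unfolding L_def by (rule norm_triangle_ineq4)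
      ultimately show ?thesis using C[OF g(1,2)] by (simp add: K_def algebra_simps)
    qed
    moreover have "K \<ge> 0" by (simp add: K_def)
    ultimately show ?thesis using that by blast
  qed
  have Lreal: "L (\<lambda>x. complex_of_real (g x)) = 0"
    if g: "g \<in> borel_measurable M" "\<And>x. x \<in> space M \<Longrightarrow> \<bar>g x\<bar> \<le> b" for g b
  proof -
    have "cmod (L (\<lambda>x. complex_of_real (g x))) \<le> K / real (Suc n)" for n
    proof -
      let ?n = "real (Suc n)"
      \<comment> \<open>Rounding g down to multiples of 1 / n gives a step function s within 1 / n
        of g; the summand 1 in m leaves room for the floor.\<close>
      define m where "m = \<lceil>?n * \<bar>b\<bar>\<rceil> + 1"
      define A where "A k = {x \<in> space M. \<lfloor>?n * g x\<rfloor> = k}" for k :: int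
      have A: "A k \<in> sets M" for k unfolding A_def using g(1) by measurable
      define s where "s x = (\<Sum>k\<in>{-m..m}. complex_of_real (of_int k / ?n) * indicator (A k) x)" for x
      have sx: "s x = complex_of_real (of_int \<lfloor>?n * g x\<rfloor> / ?n)" if x: "x \<in> space M" for x
      proof -
        have "\<bar>?n * g x\<bar> \<le> ?n * \<bar>b\<bar>" using g(2)[OF x] by (auto simp: abs_mult intro!: mult_left_mono)
        hence "\<lfloor>?n * g x\<rfloor> \<in> {-m..m}" unfolding m_def atLeastAtMost_iff by linarith
        moreover have "s x = (\<Sum>k\<in>{-m..m}. if k = \<lfloor>?n * g x\<rfloor> then complex_of_real (of_int k / ?n) else 0)"
          unfolding s_def using x by (intro sum.cong) (auto simp: A_def indicator_def)
        ultimately show ?thesis by simp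
      qed
      have sb: "s \<in> bounded_measurable M" unfolding s_def using A
        by (intro bounded_measurable_sum bounded_measurable_mult_indicator) auto
      have gb: "(\<lambda>x. complex_of_real (g x)) \<in> bounded_measurable M"
        using g by (intro bounded_measurableI[where b = b]) auto
      have "L (\<lambda>x. complex_of_real (g x)) = L (\<lambda>x. complex_of_real (g x) - s x) + L s"
        using Ladd[OF bounded_measurable_diff[OF gb sb] sb] by simp
      moreover have "L s = 0" unfolding s_def using A by (intro Lsum) auto
      moreover have "cmod (L (\<lambda>x. complex_of_real (g x) - s x)) \<le> K * (1 / ?n)"
      proof (rule K(2))
        show "(\<lambda>x. complex_of_real (g x) - s x) \<in> borel_measurable M"
          using bounded_measurable_diff[OF gb sb] by (rule bounded_measurableD)
        fix x assume x: "x \<in> space M"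
        have "cmod (complex_of_real (g x) - s x) = \<bar>g x - of_int \<lfloor>?n * g x\<rfloor> / ?n\<bar>"
          unfolding sx[OF x] of_real_diff[symmetric] norm_of_real ..
        also have "g x - of_int \<lfloor>?n * g x\<rfloor> / ?n = (?n * g x - of_int \<lfloor>?n * g x\<rfloor>) / ?n"
          by (simp add: diff_divide_distrib del: of_nat_Suc)
        also have "\<bar>\<dots>\<bar> = \<bar>?n * g x - of_int \<lfloor>?n * g x\<rfloor>\<bar> / ?n"
          by (simp add: abs_divide del: of_nat_Suc)
        also have "\<dots> \<le> 1 / ?n" by (intro divide_right_mono) linarith+
        finally show "cmod (complex_of_real (g x) - s x) \<le> 1 / ?n" .
      qed auto
      ultimately show ?thesis by simp
    qed
    moreover have "(\<lambda>n. K / real (Suc n)) \<longlonglongrightarrow> 0"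
      using tendsto_mult_right_zero[OF LIMSEQ_inverse_real_of_nat, of K] by (simp add: divide_inverse)
    ultimately have "cmod (L (\<lambda>x. complex_of_real (g x))) \<le> 0"
      by (intro LIMSEQ_le_const) auto
    thus ?thesis by simp
  qed
  have "L g = 0" if g: "g \<in> bounded_measurable M" for g
  proof -
    obtain b where b: "\<And>x. x \<in> space M \<Longrightarrow> cmod (g x) \<le> b" using g by (auto simp: bounded_measurable_def)
    note gm = bounded_measurableD[OF g]
    have br: "\<bar>Re (g x)\<bar> \<le> b" "\<bar>Im (g x)\<bar> \<le> b" if "x \<in> space M" for x
      using b[OF that] abs_Re_le_cmod[of "g x"] abs_Im_le_cmod[of "g x"] by auto
    have bm: "(\<lambda>x. complex_of_real (Re (g x))) \<in> bounded_measurable M" "(\<lambda>x. complex_of_real (Im (g x))) \<in> bounded_measurable M"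
      using gm br by (auto intro!: bounded_measurableI[where b = b])
    have "L g = L (\<lambda>x. complex_of_real (Re (g x)) + \<i> * complex_of_real (Im (g x)))" by (simp add: complex_eq[symmetric])
    also have "\<dots> = L (\<lambda>x. complex_of_real (Re (g x))) + \<i> * L (\<lambda>x. complex_of_real (Im (g x)))"
      using bm bounded_measurable_mult[of "\<lambda>_. \<i>" M] by (subst Ladd) (auto simp: Lsm)
    also have "\<dots> = 0" using Lreal[of "\<lambda>x. Re (g x)" b] Lreal[of "\<lambda>x. Im (g x)" b] gm br by auto
    finally show ?thesis .
  qed
  thus ?thesis using f by (intro that[of f]) (auto simp: L_def)
qed

section \<open>Uniform integrability from dyadic oscillations\<close>

text \<open>Subsets of size m are split off one by one: each costs at most B and lowers card C / m
  by 1, and the last, possibly smaller one accounts for the + 1.\<close>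

lemma sum_le_of_small_subset_sums:
  fixes w :: "'c \<Rightarrow> real"
  assumes "finite C" "m > 0" and small: "\<And>D. D \<subseteq> C \<Longrightarrow> card D \<le> m \<Longrightarrow> sum w D \<le> B"
  shows "sum w C \<le> B * (real (card C) / real m + 1)"
  using assms(1) small
proof (induction "card C" arbitrary: C rule: less_induct)
  case less
  have B: "B \<ge> 0" using less.prems(2)[of "{}"] by simp
  show ?case
  proof (cases "card C \<le> m")
    case True
    have "B * 1 \<le> B * (real (card C) / real m + 1)" using B by (intro mult_left_mono) auto
    thus ?thesis using less.prems(2)[of C] True by simp
  next
    case False
    then obtain T where T: "T \<subseteq> C" "card T = m" "finite T"
      using obtain_subset_with_card_n[of m C] by auto
    have c: "card (C - T) = card C - m" using T less.prems(1) by (simp add: card_Diff_subset)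
    have "sum w (C - T) \<le> B * (real (card (C - T)) / real m + 1)"
      using less.prems False assms(2) c by (intro less.hyps) auto
    moreover have "sum w T \<le> B" using less.prems(2)[OF T(1)] T by simp
    moreover have "sum w C = sum w (C - T) + sum w T"
      using less.prems(1) T by (simp add: sum.subset_diff)
    moreover have "real (card (C - T)) / real m = real (card C) / real m - 1"
      using False assms(2) c by (simp add: of_nat_diff diff_divide_distrib)
    ultimately show ?thesis by (simp add: algebra_simps)
  qed
qed

text \<open>
  The model is the unit cube with its dyadic cells of side \<open>2 ^ -k\<close>, where \<open>p = 2 ^ (d - 1)\<close>; then
  \<open>p ^ k\<close> is the largest number of cells of level \<open>k\<close> in an admissible family.
\<close>

locale dyadic_cells = finite_measure M for M :: "'a measure" +
  fixes cells :: "nat \<Rightarrow> 'a set set" and p :: nat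
  assumes p_pos: "p > 0"
    and finite_cells [simp]: "finite (cells k)"
    and cells_disjoint: "c \<in> cells k \<Longrightarrow> c' \<in> cells k \<Longrightarrow> c \<inter> c' \<noteq> {} \<Longrightarrow> c = c'"
    and cells_cover: "\<Union>(cells k) = space M"
    and sets_cells: "c \<in> cells k \<Longrightarrow> c \<in> sets M"
    and measure_cells: "c \<in> cells k \<Longrightarrow> measure M c = 1 / (2 * real p) ^ k"
    and cells_Suc: "c \<in> cells (Suc k) \<Longrightarrow> \<exists>c'\<in>cells k. c \<subseteq> c'"
    and sets_eq_sigma_cells: "sets M = sigma_sets (space M) (\<Union>k. cells k)"
begin

section \<open>Cell means and averages\<close>

definition mean :: "('a \<Rightarrow> 'b::{banach, second_countable_topology}) \<Rightarrow> 'a set \<Rightarrow> 'b" where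
  "mean f c = (LINT x:c|M. f x) /\<^sub>R measure M c"

text \<open>Not divided by the measure of the cell: at \<epsilon> = 2 ^ -j an admissible sum of mean
  oscillations with its weight \<epsilon> ^ (d - 1) is 2 ^ j times the sum of these integrals, so
  norm at most 1 turns into the bound 2 ^ -j.\<close>

definition osc :: "('a \<Rightarrow> complex) \<Rightarrow> 'a set \<Rightarrow> real" where
  "osc f c = (LINT x:c|M. cmod (f x - mean f c))"

text \<open>The conditional expectation given the cells of level k. The codomain is left general
  because f and its modulus are both averaged.\<close>

definition avg :: "nat \<Rightarrow> ('a \<Rightarrow> 'b::{banach, second_countable_topology}) \<Rightarrow> 'a \<Rightarrow> 'b" where
  "avg k f x = (\<Sum>c\<in>cells k. indicator c x *\<^sub>R mean f c)"

lemma q_pos: "0 < (2 * real p) ^ k"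
  using p_pos by auto

lemma cells_refine:
  assumes "c \<in> cells j" "i \<le> j" obtains c' where "c' \<in> cells i" "c \<subseteq> c'"
proof -
  have "\<exists>c'\<in>cells i. c \<subseteq> c'"
    using assms(2,1)
  proof (induction j arbitrary: c rule: dec_induct)
    case (step j)
    obtain b where b: "b \<in> cells j" "c \<subseteq> b" using cells_Suc[OF step.prems] by auto
    obtain c' where "c' \<in> cells i" "b \<subseteq> c'" using step.IH[OF b(1)] by auto
    thus ?case using b(2) by auto
  qed auto
  thus ?thesis using that by blast
qed

lemma cells_ex: "x \<in> space M \<Longrightarrow> \<exists>c\<in>cells k. x \<in> c"
  unfolding cells_cover[of k, symmetric] by blast

lemma cells_space: "c \<in> cells k \<Longrightarrow> c \<subseteq> space M"
  unfolding cells_cover[of k, symmetric] by blast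

lemma set_integrable_cells:
  fixes f :: "'a \<Rightarrow> 'b::{banach, second_countable_topology}"
  shows "integrable M f \<Longrightarrow> c \<in> cells k \<Longrightarrow> set_integrable M c f"
  unfolding set_integrable_def by (rule integrable_mult_indicator[OF sets_cells])

lemma set_integral_const_cell:
  fixes v :: "'b::{banach, second_countable_topology}"
  shows "c \<in> cells k \<Longrightarrow> (LINT x:c|M. v) = measure M c *\<^sub>R v"
  unfolding set_lebesgue_integral_def
  by (rule has_bochner_integral_integral_eq[OF has_bochner_integral_indicator[OF sets_cells]])
    (simp_all add: emeasure_eq_measure)

lemma avg_eq:
  assumes "c \<in> cells k" "x \<in> c" shows "avg k f x = mean f c"
proof -
  have "avg k f x = (\<Sum>c'\<in>cells k. if c' = c then mean f c else 0)"
    unfolding avg_def using assms cells_disjoint[of c k] by (intro sum.cong) (auto simp: indicator_def)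
  thus ?thesis using assms by simp
qed

text \<open>Each cell of level j lies in a single cell of level i. Consequently a stopping rule that
  looks at averages up to level j treats all points of a cell of level j alike.\<close>

lemma avg_const:
  assumes "c \<in> cells j" "x \<in> c" "y \<in> c" "i \<le> j" shows "avg i f x = avg i f y"
proof -
  obtain c' where c': "c' \<in> cells i" "c \<subseteq> c'" using cells_refine assms(1,4) by blast
  hence "x \<in> c'" "y \<in> c'" using assms by auto
  thus ?thesis by (simp add: avg_eq[OF c'(1)])
qed

lemma measurable_avg [measurable]:
  fixes f :: "'a \<Rightarrow> 'b::{banach, second_countable_topology}"
  shows "avg k f \<in> borel_measurable M"
  unfolding avg_def[abs_def] by (intro borel_measurable_sum borel_measurable_scaleR borel_measurable_indicator borel_measurable_const sets_cells)

lemma integrable_avg: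
  fixes f :: "'a \<Rightarrow> 'b::{banach, second_countable_topology}"
  shows "integrable M (avg k f)"
  unfolding avg_def[abs_def]
  by (intro Bochner_Integration.integrable_sum integrable_scaleR_left integrable_real_indicator sets_cells)
    (auto simp: emeasure_eq_measure)

lemma indicator_Union_cells:
  assumes "D \<subseteq> cells k" shows "(\<Sum>c\<in>D. indicator c x) = (indicator (\<Union>D) x :: real)"
proof -
  have dj: "c \<inter> c' = {}" if "c \<in> D" "c' \<in> D" "c \<noteq> c'" for c c'
    using cells_disjoint[of c k c'] assms that by blast
  have "indicator (\<Union>((\<lambda>c. c) ` D)) x = (\<Sum>c\<in>D. indicator c x :: real)"
    using dj finite_subset[OF assms]
    by (intro indicator_UN_disjoint) (simp_all add: disjoint_family_on_def)
  thus ?thesis by simp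
qed

lemma integral_Union_cells:
  fixes h :: "'a \<Rightarrow> 'b::{banach, second_countable_topology}"
  assumes "D \<subseteq> cells k" "integrable M h"
  shows "(LINT x:\<Union>D|M. h x) = (\<Sum>c\<in>D. LINT x:c|M. h x)"
proof -
  have "(\<Sum>c\<in>D. LINT x:c|M. h x) = (LINT x|M. (\<Sum>c\<in>D. indicator c x *\<^sub>R h x))"
    unfolding set_lebesgue_integral_def using assms set_integrable_cells[OF assms(2)]
    by (intro Bochner_Integration.integral_sum[symmetric]) (auto simp: set_integrable_def)
  also have "(\<lambda>x. \<Sum>c\<in>D. indicator c x *\<^sub>R h x) = (\<lambda>x. indicator (\<Union>D) x *\<^sub>R h x)"
    by (simp add: scaleR_left.sum[symmetric] indicator_Union_cells[OF assms(1)])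
  finally show ?thesis by (simp add: set_lebesgue_integral_def)
qed

lemma integral_avg_cell:
  fixes f :: "'a \<Rightarrow> 'b::{banach, second_countable_topology}"
  assumes c: "c \<in> cells k" shows "(LINT x:c|M. avg k f x) = (LINT x:c|M. f x)"
proof -
  have "(LINT x:c|M. avg k f x) = (LINT x:c|M. mean f c)"
    unfolding set_lebesgue_integral_def using avg_eq[OF c]
    by (intro Bochner_Integration.integral_cong) (auto simp: indicator_def)
  also have "\<dots> = measure M c *\<^sub>R mean f c"
    by (rule set_integral_const_cell[OF c])
  also have "\<dots> = (LINT x:c|M. f x)" using p_pos by (simp add: mean_def measure_cells[OF c])
  finally show ?thesis .
qed

lemma integral_avg_Union:
  fixes f :: "'a \<Rightarrow> 'b::{banach, second_countable_topology}"
  assumes "D \<subseteq> cells k" "integrable M f"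
  shows "(LINT x:\<Union>D|M. avg k f x) = (LINT x:\<Union>D|M. f x)"
  unfolding integral_Union_cells[OF assms] integral_Union_cells[OF assms(1) integrable_avg]
  using assms(1) by (intro sum.cong) (auto simp: integral_avg_cell)

lemma integral_avg:
  fixes f :: "'a \<Rightarrow> 'b::{banach, second_countable_topology}"
  assumes "integrable M f" shows "(LINT x|M. avg k f x) = (LINT x|M. f x)"
  using integral_avg_Union[OF order_refl assms, of k]
  by (simp add: cells_cover set_integral_space[OF assms] set_integral_space[OF integrable_avg])

lemma norm_mean_le:
  fixes f :: "'a \<Rightarrow> 'b::{banach, second_countable_topology}"
  shows "norm (mean f c) \<le> mean (\<lambda>x. norm (f x)) c"
proof -
  have "norm (LINT x:c|M. f x) \<le> (LINT x|M. norm (indicator c x *\<^sub>R f x))"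
    unfolding set_lebesgue_integral_def by (rule integral_norm_bound)
  thus ?thesis unfolding mean_def norm_scaleR
    by (auto intro!: mult_left_mono simp: set_lebesgue_integral_def abs_mult)
qed

lemma norm_avg_le:
  fixes f :: "'a \<Rightarrow> 'b::{banach, second_countable_topology}"
  assumes "x \<in> space M" shows "norm (avg k f x) \<le> avg k (\<lambda>x. norm (f x)) x"
proof -
  obtain c where c: "c \<in> cells k" "x \<in> c" using cells_ex assms by blast
  show ?thesis unfolding avg_eq[OF c] by (rule norm_mean_le)
qed

lemma avg_diff:
  fixes f :: "'a \<Rightarrow> 'b::{banach, second_countable_topology}"
  assumes "integrable M f" "integrable M g" "x \<in> space M"
  shows "avg k (\<lambda>x. f x - g x) x = avg k f x - avg k g x"
proof -
  obtain c where c: "c \<in> cells k" "x \<in> c" using cells_ex assms by blast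
  show ?thesis unfolding avg_eq[OF c] mean_def
    using set_integral_diff(2)[OF set_integrable_cells[OF assms(1) c(1)] set_integrable_cells[OF assms(2) c(1)]]
    by (simp add: scaleR_right_diff_distrib)
qed

text \<open>The modulus of a mean is at most the mean of the modulus, and averaging preserves
  integrals.\<close>

lemma avg_contraction:
  fixes f :: "'a \<Rightarrow> 'b::{banach, second_countable_topology}"
  assumes "integrable M f" shows "(LINT x|M. norm (avg k f x)) \<le> (LINT x|M. norm (f x))"
proof -
  have "(LINT x|M. norm (avg k f x)) \<le> (LINT x|M. avg k (\<lambda>x. norm (f x)) x)"
    using norm_avg_le by (intro integral_mono integrable_norm integrable_avg) auto
  also have "\<dots> = (LINT x|M. norm (f x))" using assms by (intro integral_avg integrable_norm)
  finally show ?thesis .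
qed

lemma integrable_complex_indicator: "A \<in> sets M \<Longrightarrow> integrable M (indicator A :: 'a \<Rightarrow> complex)"
  by (intro integrable_const_bound[where B = 1]) (auto simp: indicator_def)

section \<open>Convergence of the averages in L1\<close>

definition avg_converges :: "('a \<Rightarrow> complex) \<Rightarrow> bool" where
  "avg_converges f \<longleftrightarrow> integrable M f \<and> (\<lambda>k. LINT x|M. cmod (f x - avg k f x)) \<longlonglongrightarrow> 0"

text \<open>Averaging is linear and contracts the L1 norm, so the error for f exceeds that for g by
  at most twice the L1 distance of f and g.\<close>

lemma avg_converges_closed:
  assumes f: "integrable M f" and ap: "\<And>e. e > 0 \<Longrightarrow> \<exists>g. avg_converges g \<and> (LINT x|M. cmod (f x - g x)) < e"
  shows "avg_converges f"
proof -
  have "\<exists>N. \<forall>n\<ge>N. norm ((LINT x|M. cmod (f x - avg n f x)) - 0) < e" if e: "e > 0" for e :: real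
  proof -
    obtain g where g: "avg_converges g" "(LINT x|M. cmod (f x - g x)) < e / 3" using ap[of "e / 3"] e by auto
    have gi: "integrable M g" using g by (simp add: avg_converges_def)
    have "\<forall>\<^sub>F n in sequentially. (LINT x|M. cmod (g x - avg n g x)) < e / 3"
      using g(1) e unfolding avg_converges_def by (intro order_tendstoD) auto
    then obtain N where N: "\<And>n. n \<ge> N \<Longrightarrow> (LINT x|M. cmod (g x - avg n g x)) < e / 3"
      by (auto simp: eventually_sequentially)
    have "norm ((LINT x|M. cmod (f x - avg n f x)) - 0) < e" if n: "n \<ge> N" for n
    proof -
      have "(LINT x|M. cmod (f x - avg n f x)) \<le>
          (LINT x|M. cmod (f x - g x) + cmod (g x - avg n g x) + cmod (avg n (\<lambda>x. f x - g x) x))"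
      proof (intro integral_mono integrable_norm Bochner_Integration.integrable_add
          Bochner_Integration.integrable_diff f gi integrable_avg)
        fix x assume x: "x \<in> space M"
        have "f x - avg n f x = (f x - g x) + (g x - avg n g x) - avg n (\<lambda>x. f x - g x) x"
          by (simp add: avg_diff[OF f gi x])
        thus "cmod (f x - avg n f x) \<le> cmod (f x - g x) + cmod (g x - avg n g x) + cmod (avg n (\<lambda>x. f x - g x) x)"
          by (metis norm_triangle_ineq4 norm_triangle_ineq add_right_mono order_trans)
      qed
      also have "\<dots> = (LINT x|M. cmod (f x - g x)) + (LINT x|M. cmod (g x - avg n g x)) + (LINT x|M. cmod (avg n (\<lambda>x. f x - g x) x))"
        using f gi integrable_avg by (simp add: integrable_avg)
      also have "\<dots> \<le> (LINT x|M. cmod (f x - g x)) + (LINT x|M. cmod (g x - avg n g x)) + (LINT x|M. cmod (f x - g x))"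
        using f gi by (intro add_left_mono avg_contraction) auto
      also have "\<dots> < e" using g(2) N[OF n] by simp
      finally show ?thesis by simp
    qed
    thus ?thesis by blast
  qed
  thus ?thesis using f unfolding avg_converges_def by (auto intro: LIMSEQ_I)
qed

lemma avg_add:
  fixes f :: "'a \<Rightarrow> 'b::{banach, second_countable_topology}"
  assumes "integrable M f" "integrable M g" "x \<in> space M"
  shows "avg k (\<lambda>x. f x + g x) x = avg k f x + avg k g x"
proof -
  obtain c where c: "c \<in> cells k" "x \<in> c" using cells_ex assms by blast
  show ?thesis unfolding avg_eq[OF c] mean_def
    using set_integral_add(2)[OF set_integrable_cells[OF assms(1) c(1)] set_integrable_cells[OF assms(2) c(1)]]
    by (simp add: scaleR_right_distrib)
qed

lemma avg_cmult: "avg k (\<lambda>x. a * f x) x = a * avg k f x" for a :: complex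
  unfolding avg_def mean_def set_lebesgue_integral_def
  by (simp only: mult_scaleR_right[symmetric] integral_mult_right_zero sum_distrib_left)

lemma avg_converges_add:
  assumes "avg_converges f" "avg_converges g" shows "avg_converges (\<lambda>x. f x + g x)"
proof -
  have fg: "integrable M f" "integrable M g" using assms by (auto simp: avg_converges_def)
  have "(\<lambda>k. LINT x|M. cmod ((f x + g x) - avg k (\<lambda>x. f x + g x) x)) \<longlonglongrightarrow> 0"
  proof (rule tendsto_sandwich[OF _ _ tendsto_const])
    show "(\<lambda>k. (LINT x|M. cmod (f x - avg k f x)) + (LINT x|M. cmod (g x - avg k g x))) \<longlonglongrightarrow> 0"
      using assms unfolding avg_converges_def by (auto intro: tendsto_add_zero)
    have "(LINT x|M. cmod ((f x + g x) - avg k (\<lambda>x. f x + g x) x)) \<le>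
       (LINT x|M. cmod (f x - avg k f x) + cmod (g x - avg k g x))" for k
    proof (intro integral_mono integrable_norm Bochner_Integration.integrable_add
          Bochner_Integration.integrable_diff fg integrable_avg)
      fix x assume x: "x \<in> space M"
      show "cmod ((f x + g x) - avg k (\<lambda>x. f x + g x) x) \<le> cmod (f x - avg k f x) + cmod (g x - avg k g x)"
        unfolding avg_add[OF fg x] by (rule order_trans[OF eq_refl norm_triangle_ineq]) (simp add: algebra_simps)
    qed
    thus "\<forall>\<^sub>F k in sequentially. (LINT x|M. cmod ((f x + g x) - avg k (\<lambda>x. f x + g x) x)) \<le>
       (LINT x|M. cmod (f x - avg k f x)) + (LINT x|M. cmod (g x - avg k g x))"
      using fg by (simp add: integrable_avg)
  qed auto
  thus ?thesis using fg by (simp add: avg_converges_def)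
qed

lemma avg_converges_cmult:
  assumes "avg_converges f" shows "avg_converges (\<lambda>x. a * f x)"
proof -
  have "cmod (a * f x - a * avg k f x) = cmod a * cmod (f x - avg k f x)" for x k
    by (simp add: right_diff_distrib[symmetric] norm_mult)
  thus ?thesis using assms unfolding avg_converges_def by (auto intro: tendsto_mult_right_zero simp: avg_cmult)
qed

text \<open>From level j on every cell is contained in c or disjoint from it, so averaging
  reproduces the indicator exactly.\<close>

lemma avg_converges_cell:
  assumes c: "c \<in> cells j" shows "avg_converges (indicator c)"
proof -
  have "avg k (indicator c) x = (indicator c x :: complex)" if k: "k \<ge> j" and x: "x \<in> space M" for k x
  proof -
    obtain b where b: "b \<in> cells k" "x \<in> b" using cells_ex x by blast
    obtain c' where c': "c' \<in> cells j" "b \<subseteq> c'" using cells_refine b(1) k by blast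
    have "(LINT y:b|M. indicator c y :: complex) = (LINT y:b|M. indicator c x)"
    proof (unfold set_lebesgue_integral_def, intro Bochner_Integration.integral_cong refl)
      fix y
      have "y \<in> c \<longleftrightarrow> x \<in> c" if "y \<in> b" using b c' that cells_disjoint[OF c c'(1)] by blast
      thus "indicator b y *\<^sub>R (indicator c y :: complex) = indicator b y *\<^sub>R indicator c x" by (auto simp: indicator_def)
    qed
    also have "\<dots> = measure M b *\<^sub>R indicator c x"
      by (rule set_integral_const_cell[OF b(1)])
    finally show ?thesis using measure_cells[OF b(1)] q_pos[of k] p_pos by (simp add: avg_eq[OF b] mean_def)
  qed
  hence "(LINT x|M. cmod (indicator c x - avg k (indicator c) x)) = (LINT x|M. 0)" if "k \<ge> j" for k
    using that by (intro Bochner_Integration.integral_cong) auto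
  hence "(\<lambda>k. LINT x|M. cmod (indicator c x - avg k (indicator c) x)) \<longlonglongrightarrow> 0"
    by (intro tendsto_eventually) (auto simp: eventually_sequentially)
  thus ?thesis using integrable_complex_indicator[OF sets_cells[OF c]] by (simp add: avg_converges_def)
qed

text \<open>The cells are, up to the empty set, an intersection-stable generator, so the claim
  spreads through complements and disjoint unions; a countable union is approximated in measure by
  finite ones.\<close>

lemma avg_converges_indicator:
  assumes A: "A \<in> sets M" shows "avg_converges (indicator A)"
proof -
  let ?G = "insert {} (\<Union>k. cells k)"
  \<comment> \<open>Cells of any two levels are nested or disjoint; the empty set is added to the
    generator for the latter case.\<close>
  have st: "Int_stable ?G"
  proof (rule Int_stableI)
    fix a b assume ab: "a \<in> ?G" "b \<in> ?G"
    show "a \<inter> b \<in> ?G"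
    proof (cases "a \<inter> b = {}")
      case False
      then obtain i j where ij: "a \<in> cells i" "b \<in> cells j" using ab by auto
      have *: "a \<inter> b = a" if h: "a \<in> cells i" "b \<in> cells j" "j \<le> i" "a \<inter> b \<noteq> {}" for a b i j
      proof -
        obtain c where "c \<in> cells j" "a \<subseteq> c" using cells_refine[OF h(1,3)] by blast
        moreover have "c \<inter> b \<noteq> {}" using calculation h(4) by auto
        ultimately show ?thesis using cells_disjoint[of c j b] h(2) by auto
      qed
      show ?thesis
      proof (cases "j \<le> i")
        case True thus ?thesis using *[OF ij True False] ab by simp
      next
        case 2: False
        hence "b \<inter> a = b" using *[OF ij(2,1)] False by (auto simp: Int_commute)
        thus ?thesis using ab by (simp add: Int_commute)
      qed
    qed auto
  qed
  have gen: "sets M = sigma_sets (space M) ?G"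
    unfolding sets_eq_sigma_cells
  proof (intro equalityI sigma_sets_mono)
    show "(\<Union>k. cells k) \<subseteq> sigma_sets (space M) ?G" by auto
    show "?G \<subseteq> sigma_sets (space M) (\<Union>k. cells k)" by (auto intro: sigma_sets.intros)
  qed
  have GP: "?G \<subseteq> Pow (space M)" using cells_space by auto
  have "A \<in> sigma_sets (space M) ?G" using A gen by simp
  with st GP show ?thesis
  proof (induction rule: sigma_sets_induct_disjoint)
    case (basic a)
    show ?case
    proof (cases "a = {}")
      case True
      have "indicator {} = (\<lambda>x. 0 :: complex)" by auto
      thus ?thesis using True by (simp add: avg_converges_def avg_def mean_def set_lebesgue_integral_def)
    next
      case False thus ?thesis using basic avg_converges_cell by auto
    qed
  next
    case empty
    have "indicator {} = (\<lambda>x. 0 :: complex)" by auto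
    thus ?case by (simp add: avg_converges_def avg_def mean_def set_lebesgue_integral_def)
  next
    case (compl a)
    have a: "a \<in> sets M" using compl gen by simp
    have sp: "avg_converges (indicator (space M))"
    proof -
      have "(\<lambda>k. LINT x|M. cmod (indicator (space M) x - avg k (indicator (space M)) x)) = (\<lambda>k. 0)"
      proof
        fix k
        have "cmod (indicator (space M) x - avg k (indicator (space M)) x) = 0" if x: "x \<in> space M" for x
        proof -
          obtain b where b: "b \<in> cells k" "x \<in> b" using cells_ex x by blast
          have "(LINT y:b|M. indicator (space M) y :: complex) = (LINT y:b|M. 1)"
            using cells_space[OF b(1)] unfolding set_lebesgue_integral_def
            by (intro Bochner_Integration.integral_cong refl) (auto simp: indicator_def)
          also have "\<dots> = measure M b *\<^sub>R 1" by (rule set_integral_const_cell[OF b(1)])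
          finally show ?thesis using measure_cells[OF b(1)] q_pos[of k] p_pos x by (simp add: avg_eq[OF b] mean_def)
        qed
        hence "(LINT x|M. cmod (indicator (space M) x - avg k (indicator (space M)) x)) = (LINT x|M. 0)"
          by (intro Bochner_Integration.integral_cong) auto
        thus "(LINT x|M. cmod (indicator (space M) x - avg k (indicator (space M)) x)) = 0" by simp
      qed
      thus ?thesis using integrable_complex_indicator[OF sets.top] by (simp add: avg_converges_def)
    qed
    have "indicator (space M - a) = (\<lambda>x. indicator (space M) x + (-1) * indicator a x :: complex)"
      using sets.sets_into_space[OF a] by (auto simp: indicator_def fun_eq_iff)
    thus ?case using avg_converges_add[OF sp avg_converges_cmult[OF compl.IH, of "-1"]] by simp
  next
    case (union A)
    have A: "A i \<in> sets M" for i using union.hyps(2) gen by auto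
    have U: "(\<Union>i. A i) \<in> sets M" using A by auto
    show ?case
    proof (rule avg_converges_closed[OF integrable_complex_indicator[OF U]])
      fix e :: real assume e: "e > 0"
      have fins: "avg_converges (indicator (\<Union>i<n. A i))" for n
      proof (induction n)
        case 0
        have "indicator {} = (\<lambda>x. 0 :: complex)" by auto
        thus ?case by (simp add: avg_converges_def avg_def mean_def set_lebesgue_integral_def)
      next
        case (Suc n)
        have "A n \<inter> A i = {}" if "i < n" for i
          using union.hyps(1) that by (simp add: disjoint_family_on_def)
        hence "A n \<inter> (\<Union>i<n. A i) = {}" by blast
        hence "indicator (\<Union>i<Suc n. A i) = (\<lambda>x. indicator (\<Union>i<n. A i) x + indicator (A n) x :: complex)"
          by (auto simp: indicator_def fun_eq_iff lessThan_Suc)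
        thus ?case using avg_converges_add[OF Suc union.IH[of n]] by simp
      qed
      have "(\<lambda>n. measure M (\<Union>i<n. A i)) \<longlonglongrightarrow> measure M (\<Union>n. \<Union>i<n. A i)"
        using A by (intro finite_Lim_measure_incseq) (auto simp: incseq_def intro: less_le_trans)
      moreover have "(\<Union>n. \<Union>i<n. A i) = (\<Union>i. A i)" by auto
      ultimately have "\<forall>\<^sub>F n in sequentially. measure M (\<Union>i. A i) - e < measure M (\<Union>i<n. A i)"
        using e by (intro order_tendstoD(1)) auto
      then obtain n where n: "measure M (\<Union>i. A i) - e < measure M (\<Union>i<n. A i)"
        by (auto simp: eventually_sequentially)
      have "(LINT x|M. cmod (indicator (\<Union>i. A i) x - indicator (\<Union>i<n. A i) x)) = (LINT x|M. indicator ((\<Union>i. A i) - (\<Union>i<n. A i)) x)"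
        by (intro Bochner_Integration.integral_cong refl) (auto simp: indicator_def)
      also have "\<dots> = measure M ((\<Union>i. A i) - (\<Union>i<n. A i))" using A by simp
      also have "\<dots> = measure M (\<Union>i. A i) - measure M (\<Union>i<n. A i)"
        using A by (intro finite_measure_Diff) auto
      finally show "\<exists>g. avg_converges g \<and> (LINT x|M. cmod (indicator (\<Union>i. A i) x - g x)) < e"
        using fins[of n] n by (intro exI[of _ "indicator (\<Union>i<n. A i)"]) auto
    qed
  qed
qed

text \<open>Takes the place of pointwise differentiation: in the decomposition below it disposes of
  the difference between f and its averages at points that are never stopped.\<close>

lemma avg_converges_integrable:
  assumes "integrable M f" shows "avg_converges f"
  using assms
proof (induction rule: integrable_induct)
  case (base A c)
  have "(\<lambda>x. indicator A x *\<^sub>R c) = (\<lambda>x. c * indicator A x)" by (auto simp: indicator_def)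
  thus ?case using avg_converges_cmult[OF avg_converges_indicator[OF base(1)], of c] by simp
next
  case (add f g)
  thus ?case using avg_converges_add by blast
next
  case (lim f s)
  show ?case
  proof (rule avg_converges_closed[OF lim.hyps(4)])
    fix e :: real assume e: "e > 0"
    have "(\<lambda>i. LINT x|M. cmod (f x - s i x)) \<longlonglongrightarrow> (LINT x|M. 0)"
    proof (rule integral_dominated_convergence[where w = "\<lambda>x. 3 * cmod (f x)"])
      show "AE x in M. (\<lambda>i. cmod (f x - s i x)) \<longlonglongrightarrow> 0"
      proof (rule AE_I2)
        fix x assume "x \<in> space M"
        have "(\<lambda>i. cmod (f x - s i x)) \<longlonglongrightarrow> cmod (f x - f x)" by (intro tendsto_intros lim.hyps(2) \<open>x \<in> space M\<close>)
        thus "(\<lambda>i. cmod (f x - s i x)) \<longlonglongrightarrow> 0" by simp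
      qed
      show "AE x in M. norm (cmod (f x - s i x)) \<le> 3 * cmod (f x)" for i
      proof (rule AE_I2)
        fix x assume "x \<in> space M"
        thus "norm (cmod (f x - s i x)) \<le> 3 * cmod (f x)" using lim.hyps(3)[of x i] norm_triangle_ineq4[of "f x" "s i x"] by simp
      qed
    qed (use lim.hyps(1,4) in \<open>auto intro: borel_measurable_integrable\<close>)
    hence "\<forall>\<^sub>F i in sequentially. (LINT x|M. cmod (f x - s i x)) < e"
      using e by (intro order_tendstoD(2)) auto
    then obtain i where "(LINT x|M. cmod (f x - s i x)) < e" by (auto simp: eventually_sequentially)
    thus "\<exists>g. avg_converges g \<and> (LINT x|M. cmod (f x - g x)) < e" using lim.IH by blast
  qed
qed

text \<open>
  Calderon--Zygmund: stop at the first level where the average of \<open>\<bar>f\<bar>\<close> exceeds \<open>q ^ s\<close>, \<open>q = 2 * p\<close>.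
  At most \<open>q ^ j * measure M S\<close> cells of level \<open>j\<close> make up the stopped set \<open>S\<close>, so they split into few
  admissible families, and no cell of level \<open>j \<le> s\<close> is stopped.
\<close>

theorem uniform_integrability:
  assumes f: "integrable M f" and f1: "(LINT x|M. cmod (f x)) \<le> 1"
    and osc: "\<And>j D. D \<subseteq> cells j \<Longrightarrow> card D \<le> p ^ j \<Longrightarrow> sum (osc f) D \<le> 1 / 2 ^ j"
    and E: "E \<in> sets M"
  shows "(LINT x:E|M. cmod (f x)) \<le> (2 * real p) ^ Suc s * measure M E + 2 / 2 ^ s"
proof -
  let ?q = "2 * real p"
  have q: "?q \<ge> 2" using p_pos by simp
  \<comment> \<open>The height. A cell of level j \<le> s has average at most q ^ j, because the
    integral of |f| is at most 1, and so cannot exceed it.\<close>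
  define \<tau> where "\<tau> = ?q ^ s"
  have lam: "\<tau> > 0" "2 ^ s \<le> \<tau>" using q by (auto simp: \<tau>_def intro: power_mono)
  define a where "a j x = avg j (\<lambda>x. cmod (f x)) x" for j x
  have af: "integrable M (\<lambda>x. cmod (f x))" using f by simp
  have am: "a j \<in> borel_measurable M" for j unfolding a_def by measurable
  have ai: "integrable M (a j)" for j unfolding a_def by (rule integrable_avg)
  have cell_le: "(LINT x:c|M. cmod (f x)) \<le> (LINT x:c'|M. cmod (f x))" if "c \<in> cells j" "c' \<in> cells i" "c \<subseteq> c'" for c c' i j
    unfolding set_lebesgue_integral_def
    using that set_integrable_cells[OF af that(1)] set_integrable_cells[OF af that(2)]
    by (intro integral_mono) (auto simp: set_integrable_def indicator_def)
  have a_cell: "a j x = ?q ^ j * (LINT x:c|M. cmod (f x))" if "c \<in> cells j" "x \<in> c" for j c x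
    using measure_cells[OF that(1)] by (simp add: a_def mean_def avg_eq[OF that])
  have cell_1: "(LINT x:c|M. cmod (f x)) \<le> 1" if "c \<in> cells j" for c j
  proof -
    have "(LINT x:c|M. cmod (f x)) \<le> (LINT x|M. cmod (f x))"
      unfolding set_lebesgue_integral_def using set_integrable_cells[OF af that] af
      by (intro integral_mono) (auto simp: set_integrable_def indicator_def)
    thus ?thesis using f1 by simp
  qed
  have a_small: "a j x \<le> \<tau>" if js: "j \<le> s" "x \<in> space M" for j x
  proof -
    obtain c where c: "c \<in> cells j" "x \<in> c" using cells_ex js(2) by blast
    have "a j x \<le> ?q ^ j * 1" unfolding a_cell[OF c] using cell_1[OF c(1)] q by (intro mult_left_mono) auto
    also have "\<dots> \<le> \<tau>" unfolding \<tau>_def mult_1_right using q js(1) by (intro power_increasing) auto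
    finally show ?thesis .
  qed
  \<comment> \<open>A parent has q times the measure of its child and at least its integral of |f|.
    This caps the average on a stopped cell by q * \<tau>, its parent being below the
    height.\<close>
  have a_step: "a (Suc i) x \<le> ?q * a i x" if x: "x \<in> space M" for i x
  proof -
    obtain c where c: "c \<in> cells (Suc i)" "x \<in> c" using cells_ex x by blast
    obtain c' where c': "c' \<in> cells i" "c \<subseteq> c'" using cells_Suc[OF c(1)] by blast
    have "a (Suc i) x \<le> ?q ^ Suc i * (LINT x:c'|M. cmod (f x))"
      unfolding a_cell[OF c] using cell_le[OF c(1) c'] q by (intro mult_left_mono) auto
    also have "\<dots> = ?q * a i x" using a_cell[of c' i x] c c' by auto
    finally show ?thesis .
  qed
  \<comment> \<open>The points stopped at level j; the sets are disjoint, since j is the first level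
    at which the average exceeds the height.\<close>
  define S where "S j = {x \<in> space M. a j x > \<tau> \<and> (\<forall>i<j. a i x \<le> \<tau>)}" for j
  have Sm: "S j \<in> sets M" for j unfolding S_def using am by measurable
  have S_empty: "S j = {}" if "j \<le> s" for j using a_small[OF that] by (force simp: S_def)
  have S_le: "a j x \<le> ?q * \<tau>" if x: "x \<in> S j" for j x
  proof (cases j)
    case 0
    thus ?thesis using S_empty[of 0] x by simp
  next
    case (Suc i)
    have "a j x \<le> ?q * a i x" using x a_step[of x i] Suc by (simp add: S_def)
    also have "\<dots> \<le> ?q * \<tau>" using x Suc by (intro mult_left_mono) (auto simp: S_def)
    finally show ?thesis .
  qed
  have S_ind: "(\<Sum>j\<in>J. indicator (S j) x) \<le> (1::real)" if "finite J" for J x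
  proof (cases "\<exists>j\<in>J. x \<in> S j")
    case True
    then obtain j where j: "j \<in> J" "x \<in> S j" by blast
    have ij: "i = j" if "x \<in> S i" for i using that j(2) unfolding S_def by (cases i j rule: linorder_cases) force+
    have "x \<in> S i \<longleftrightarrow> i = j" for i using ij[of i] j(2) by blast
    hence "(\<Sum>j\<in>J. indicator (S j) x) = (\<Sum>i\<in>J. if i = j then 1 else 0 :: real)"
      by (simp add: indicator_def of_bool_def)
    thus ?thesis using that j by simp
  next
    case False
    hence "(\<Sum>j\<in>J. indicator (S j) x) = (0::real)" by (intro sum.neutral) (auto simp: indicator_def)
    thus ?thesis by simp
  qed
  \<comment> \<open>First a weak type bound for the stopped set, then the size of the bad part on
    it: on a stopped cell \<open>avg j f\<close> is the mean of f, so the integral is a sum of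
    oscillations.\<close>
  have S_meas: "\<tau> * measure M (S j) \<le> (LINT x:S j|M. cmod (f x))" and
    S_osc: "(LINT x:S j|M. cmod (f x - avg j f x)) \<le> (if s < j then 1 / 2 ^ j else 0) + measure M (S j)" for j
  proof -
    define D where "D = {c \<in> cells j. c \<subseteq> S j}"
    have D: "D \<subseteq> cells j" by (auto simp: D_def)
    have SD: "S j = \<Union>D"
    proof
      show "S j \<subseteq> \<Union>D"
      proof
        fix x assume x: "x \<in> S j"
        then obtain c where c: "c \<in> cells j" "x \<in> c" using cells_ex[of x j] by (auto simp: S_def)
        have "y \<in> S j" if y: "y \<in> c" for y
        proof -
          have "a i y = a i x" if "i \<le> j" for i unfolding a_def using avg_const[OF c(1) y c(2) that] .
          thus ?thesis using x cells_space[OF c(1)] y by (auto simp: S_def)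
        qed
        thus "x \<in> \<Union>D" using c by (auto simp: D_def)
      qed
    qed (auto simp: D_def)
    have "\<tau> * measure M (S j) = (LINT x|M. indicator (S j) x *\<^sub>R \<tau>)" using Sm by simp
    also have "\<dots> \<le> (LINT x:S j|M. a j x)"
      unfolding set_lebesgue_integral_def using Sm ai
      by (intro integral_mono integrable_mult_indicator) (auto simp: S_def indicator_def emeasure_eq_measure)
    also have "\<dots> = (LINT x:S j|M. cmod (f x))"
      unfolding SD a_def by (rule integral_avg_Union[OF D af])
    finally show "\<tau> * measure M (S j) \<le> (LINT x:S j|M. cmod (f x))" .
    show "(LINT x:S j|M. cmod (f x - avg j f x)) \<le> (if s < j then 1 / 2 ^ j else 0) + measure M (S j)"
    proof (cases "s < j")
      case False
      thus ?thesis using S_empty[of j] by (simp add: set_lebesgue_integral_def)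
    next
      case True
      have "integrable M (\<lambda>x. cmod (f x - avg j f x))" using f integrable_avg by (intro integrable_norm Bochner_Integration.integrable_diff)
      hence "(LINT x:S j|M. cmod (f x - avg j f x)) = (\<Sum>c\<in>D. LINT x:c|M. cmod (f x - avg j f x))"
        unfolding SD by (rule integral_Union_cells[OF D])
      also have "\<dots> = sum (osc f) D"
      proof (intro sum.cong refl)
        fix c assume "c \<in> D"
        hence c: "c \<in> cells j" using D by auto
        show "(LINT x:c|M. cmod (f x - avg j f x)) = osc f c"
          unfolding osc_def set_lebesgue_integral_def
          by (intro Bochner_Integration.integral_cong refl) (auto simp: indicator_def avg_eq[OF c])
      qed
      \<comment> \<open>D splits into groups of at most p ^ j cells, each of total at most 2 ^ -j.
        As card D = q ^ j * measure M (S j) and q = 2 * p, the factor 2 ^ j from q ^ j / p ^ j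
        cancels and the measure enters with factor 1.\<close>
      also have "\<dots> \<le> 1 / 2 ^ j * (real (card D) / real (p ^ j) + 1)"
        using finite_subset[OF D] p_pos D by (intro sum_le_of_small_subset_sums) (auto intro!: osc)
      also have "real (card D) = measure M (S j) * ?q ^ j"
      proof -
        have "measure M (S j) = (LINT x:\<Union>D|M. 1)" using Sm[of j] SD by (simp add: set_lebesgue_integral_def)
        also have "\<dots> = (\<Sum>c\<in>D. LINT x:c|M. 1)" by (rule integral_Union_cells[OF D]) simp
        also have "\<dots> = (\<Sum>c\<in>D. 1 / ?q ^ j)"
          using D set_integral_const_cell[of _ j "1::real"] measure_cells[of _ j] by (intro sum.cong refl) (auto simp: subset_iff)
        finally show ?thesis using p_pos by simp
      qed
      also have "1 / 2 ^ j * (measure M (S j) * ?q ^ j / real (p ^ j) + 1) = measure M (S j) + 1 / 2 ^ j"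
        using p_pos by (simp add: field_simps power_mult_distrib)
      finally show ?thesis using True by simp
    qed
  qed
  \<comment> \<open>Up to the averaging error at level k, |f| is at most q * \<tau> plus the bad
    part on the stopped sets; the first term gives the measure of E, the second is bounded
    independently of E.\<close>
  have main: "(LINT x:E|M. cmod (f x)) \<le> ?q ^ Suc s * measure M E + 2 / 2 ^ s + (LINT x|M. cmod (f x - avg k f x))" for k
  proof -
    let ?g = "\<lambda>x. ?q * \<tau> * indicator E x + (\<Sum>j\<le>k. indicator (S j) x * cmod (f x - avg j f x)) + cmod (f x - avg k f x)"
    have di: "integrable M (\<lambda>x. cmod (f x - avg j f x))" for j
      using f integrable_avg by (intro integrable_norm Bochner_Integration.integrable_diff)
    have Si: "integrable M (\<lambda>x. indicator (S j) x * cmod (f x - avg j f x))" for j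
      using integrable_mult_indicator[OF Sm[of j] di[of j]] by simp
    have Ei: "integrable M (\<lambda>x. indicator E x :: real)" using E by (simp add: emeasure_eq_measure)
    have "indicator E x * cmod (f x) \<le> ?g x" if x: "x \<in> space M" for x
    proof (cases "\<exists>j\<le>k. x \<in> S j")
      case True
      then obtain j where j: "j \<le> k" "x \<in> S j" by blast
      have "cmod (f x) \<le> cmod (avg j f x) + cmod (f x - avg j f x)"
        using norm_triangle_ineq[of "avg j f x" "f x - avg j f x"] by simp
      also have "cmod (avg j f x) \<le> ?q * \<tau>"
        using norm_avg_le[OF x, of j f] S_le[OF j(2)] by (simp add: a_def)
      finally have 1: "cmod (f x) \<le> ?q * \<tau> + cmod (f x - avg j f x)" by simp
      have "indicator (S j) x * cmod (f x - avg j f x) \<le> (\<Sum>j\<le>k. indicator (S j) x * cmod (f x - avg j f x))"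
        using j(1) by (intro member_le_sum) auto
      hence 2: "cmod (f x - avg j f x) \<le> (\<Sum>j\<le>k. indicator (S j) x * cmod (f x - avg j f x))" using j(2) by simp
      have 3: "0 \<le> (\<Sum>j\<le>k. indicator (S j) x * cmod (f x - avg j f x))" by (intro sum_nonneg) auto
      show ?thesis
      proof (cases "x \<in> E")
        case True
        thus ?thesis using 1 2 norm_ge_zero[of "f x - avg k f x"] by (simp only: indicator_simps)
      next
        case False
        thus ?thesis using 3 by simp
      qed
    next
      case False
      \<comment> \<open>A point that is not stopped up to level k: if its average at level k
        exceeded the height, the least such level would be at most k and would stop it.\<close>
      have "a k x \<le> \<tau>"
      proof (rule ccontr)
        assume "\<not> a k x \<le> \<tau>"
        hence k: "a k x > \<tau>" by simp
        define i where "i = (LEAST i. a i x > \<tau>)"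
        have "a i x > \<tau>" unfolding i_def by (rule LeastI[of _ k]) (rule k)
        moreover have "a l x \<le> \<tau>" if "l < i" for l using not_less_Least[of l "\<lambda>i. a i x > \<tau>"] that unfolding i_def by simp
        moreover have "i \<le> k" unfolding i_def by (rule Least_le) (rule k)
        ultimately show False using False x by (auto simp: S_def)
      qed
      hence "cmod (avg k f x) \<le> \<tau>" using norm_avg_le[OF x, of k f] by (simp add: a_def)
      also have "\<tau> \<le> ?q * \<tau>" using lam q by simp
      finally have "cmod (f x) \<le> ?q * \<tau> + cmod (f x - avg k f x)"
        using norm_triangle_ineq[of "avg k f x" "f x - avg k f x"] by simp
      moreover have 3: "0 \<le> (\<Sum>j\<le>k. indicator (S j) x * cmod (f x - avg j f x))" by (intro sum_nonneg) auto
      ultimately show ?thesis by (cases "x \<in> E") (simp_all add: add_nonneg_nonneg)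
    qed
    note le = this
    have i1: "integrable M (\<lambda>x. ?q * \<tau> * indicator E x)" using Ei by (rule integrable_mult_right)
    have i2: "integrable M (\<lambda>x. \<Sum>j\<le>k. indicator (S j) x * cmod (f x - avg j f x))"
      using Si by (rule Bochner_Integration.integrable_sum)
    have i12: "integrable M (\<lambda>x. ?q * \<tau> * indicator E x + (\<Sum>j\<le>k. indicator (S j) x * cmod (f x - avg j f x)))"
      using i1 i2 by (rule Bochner_Integration.integrable_add)
    have "(LINT x:E|M. cmod (f x)) \<le> (LINT x|M. ?g x)"
      unfolding set_lebesgue_integral_def
    proof (rule integral_mono)
      show "integrable M (\<lambda>x. indicator E x *\<^sub>R cmod (f x))" by (rule integrable_mult_indicator[OF E af])
      show "integrable M ?g" using i12 di by (rule Bochner_Integration.integrable_add)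
    qed (use le in simp)
    also have "\<dots> = ?q * \<tau> * measure M E + (\<Sum>j\<le>k. LINT x:S j|M. cmod (f x - avg j f x)) + (LINT x|M. cmod (f x - avg k f x))"
      unfolding Bochner_Integration.integral_add[OF i12 di] Bochner_Integration.integral_add[OF i1 i2]
        Bochner_Integration.integral_sum[OF Si]
      using E by (simp add: set_lebesgue_integral_def)
    also have "(\<Sum>j\<le>k. LINT x:S j|M. cmod (f x - avg j f x)) \<le> (\<Sum>j\<le>k. (if s < j then 1 / 2 ^ j else 0) + measure M (S j))"
      by (intro sum_mono S_osc)
    also have "\<dots> = (\<Sum>j\<le>k. if s < j then 1 / 2 ^ j else 0) + (\<Sum>j\<le>k. measure M (S j))" by (rule sum.distrib)
    also have "(\<Sum>j\<le>k. if s < j then 1 / 2 ^ j else 0) \<le> (1 / 2 ^ s :: real)"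
    proof -
      \<comment> \<open>The geometric sum over s < j \<le> k with its remainder subtracted, the form
        in which induction on k goes through.\<close>
      have "(\<Sum>j\<le>k. if s < j then 1 / 2 ^ j else 0) \<le> (1 / 2 ^ s - (if s < k then 1 / 2 ^ k else 0) :: real)"
        by (induction k) (auto simp: field_simps less_Suc_eq)
      also have "\<dots> \<le> 1 / 2 ^ s" by simp
      finally show ?thesis .
    qed
    also have "(\<Sum>j\<le>k. measure M (S j)) \<le> 1 / 2 ^ s"
    proof -
      \<comment> \<open>The weak type bounds are added up; by disjointness the integrals of |f| over
        the stopped sets sum to at most 1.\<close>
      have "\<tau> * (\<Sum>j\<le>k. measure M (S j)) \<le> (\<Sum>j\<le>k. LINT x:S j|M. cmod (f x))"
        unfolding sum_distrib_left by (intro sum_mono S_meas)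
      also have "\<dots> = (LINT x|M. (\<Sum>j\<le>k. indicator (S j) x *\<^sub>R cmod (f x)))"
        unfolding set_lebesgue_integral_def
        by (intro Bochner_Integration.integral_sum[symmetric] integrable_mult_indicator Sm af)
      also have "\<dots> \<le> (LINT x|M. cmod (f x))"
      proof (rule integral_mono)
        show "integrable M (\<lambda>x. \<Sum>j\<le>k. indicator (S j) x *\<^sub>R cmod (f x))"
          by (intro Bochner_Integration.integrable_sum integrable_mult_indicator Sm af)
        show "(\<Sum>j\<le>k. indicator (S j) x *\<^sub>R cmod (f x)) \<le> cmod (f x)" for x
          using mult_right_mono[OF S_ind[of "{..k}" x], of "cmod (f x)"] by (simp only: sum_distrib_right real_scaleR_def) simp
      qed (rule af)
      also have "\<dots> \<le> 1" by (rule f1)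
      finally have "(\<Sum>j\<le>k. measure M (S j)) \<le> 1 / \<tau>" using lam by (simp add: field_simps)
      also have "\<dots> \<le> 1 / 2 ^ s" using lam by (intro divide_left_mono) auto
      finally show ?thesis .
    qed
    finally show ?thesis by (simp add: \<tau>_def)
  qed
  have "(\<lambda>k. ?q ^ Suc s * measure M E + 2 / 2 ^ s + (LINT x|M. cmod (f x - avg k f x))) \<longlonglongrightarrow>
      ?q ^ Suc s * measure M E + 2 / 2 ^ s + 0"
    using avg_converges_integrable[OF f] unfolding avg_converges_def by (intro tendsto_intros) auto
  from LIMSEQ_le_const[OF this] main show ?thesis by auto
qed

end

section \<open>Dyadic cells of the unit cube\<close>

lemma space_cube_measure: "space (cube_measure d) = (\<Pi>\<^sub>E i\<in>{..<d}. {0<..<1})"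
  by (simp add: cube_measure_def space_PiM space_restrict_space)

lemma sets_interval [measurable]: "A \<in> sets borel \<Longrightarrow> A \<subseteq> {0<..<1} \<Longrightarrow> A \<in> sets (restrict_space lborel {0<..<1::real})"
  by (subst sets_restrict_space_iff) auto

lemma prob_unit_interval: "emeasure (restrict_space lborel {0<..<1::real}) (space (restrict_space lborel {0<..<1})) = 1"
  by (simp add: emeasure_restrict_space space_restrict_space)

lemma finite_product_sigma_finite_interval:
  "finite_product_sigma_finite (\<lambda>i. restrict_space lborel {0<..<1::real}) {..<d::nat}"
proof -
  interpret finite_measure "restrict_space lborel {0<..<1::real}"
    by (rule finite_measureI) (simp only: prob_unit_interval, simp)
  show ?thesis by unfold_locales auto
qed

lemma sets_box:
  assumes "\<And>i. i < d \<Longrightarrow> A i \<in> sets borel" "\<And>i. i < d \<Longrightarrow> A i \<subseteq> {0<..<1}"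
  shows "(\<Pi>\<^sub>E i\<in>{..<d}. A i) \<in> sets (cube_measure d)"
  unfolding cube_measure_def using assms by (intro sets_PiM_I_finite sets_interval) auto

lemma measure_box:
  assumes "\<And>i. i < d \<Longrightarrow> A i \<in> sets borel" "\<And>i. i < d \<Longrightarrow> A i \<subseteq> {0<..<1}"
  shows "measure (cube_measure d) (\<Pi>\<^sub>E i\<in>{..<d}. A i) = (\<Prod>i<d. measure lborel (A i))"
proof -
  interpret finite_product_sigma_finite "\<lambda>i. restrict_space lborel {0<..<1::real}" "{..<d}"
    by (rule finite_product_sigma_finite_interval)
  have "emeasure (cube_measure d) (\<Pi>\<^sub>E i\<in>{..<d}. A i) = (\<Prod>i<d. emeasure (restrict_space lborel {0<..<1}) (A i))"
    unfolding cube_measure_def using assms by (intro emeasure_PiM) (auto intro: sets_interval)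
  also have "\<dots> = (\<Prod>i<d. ennreal (measure lborel (A i)))"
  proof (intro prod.cong refl)
    fix i assume "i \<in> {..<d}"
    hence A: "A i \<in> sets borel" "A i \<subseteq> {0<..<1}" using assms by auto
    have "emeasure lborel (A i) \<le> emeasure lborel {0<..<1::real}" using A by (intro emeasure_mono) auto
    hence "emeasure lborel (A i) < \<infinity>" by (auto intro: le_less_trans)
    thus "emeasure (restrict_space lborel {0<..<1}) (A i) = ennreal (measure lborel (A i))"
      using A emeasure_eq_ennreal_measure[of lborel "A i"] by (simp add: emeasure_restrict_space)
  qed
  also have "\<dots> = ennreal (\<Prod>i<d. measure lborel (A i))" by (rule prod_ennreal) simp
  finally show ?thesis by (simp add: measure_def prod_nonneg)
qed

lemma finite_measure_cube: "finite_measure (cube_measure d)"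
  and measure_cube_space: "measure (cube_measure d) (space (cube_measure d)) = 1"
proof -
  interpret finite_product_sigma_finite "\<lambda>i. restrict_space lborel {0<..<1::real}" "{..<d}"
    by (rule finite_product_sigma_finite_interval)
  have "emeasure (cube_measure d) (\<Pi>\<^sub>E i\<in>{..<d}. {0<..<1}) = (\<Prod>i<d. emeasure (restrict_space lborel {0<..<1::real}) {0<..<1})"
    unfolding cube_measure_def by (intro emeasure_PiM) (auto intro: sets_interval)
  also have "\<dots> = 1" using prob_unit_interval by (simp add: space_restrict_space)
  finally have 1: "emeasure (cube_measure d) (space (cube_measure d)) = 1" by (simp add: space_cube_measure)
  thus "finite_measure (cube_measure d)" by (intro finite_measureI) simp
  show "measure (cube_measure d) (space (cube_measure d)) = 1" using 1 by (simp add: measure_def)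
qed

text \<open>For positive \<epsilon> the box is nonempty, and only then does containment of the boxes
  give containment of their sides.\<close>

lemma eps_cubes_E:
  assumes "Q \<in> eps_cubes d \<epsilon>" "\<epsilon> > 0"
  obtains a where "Q = (\<Pi>\<^sub>E i\<in>{..<d}. {a i<..<a i + \<epsilon>})" "\<And>i. i < d \<Longrightarrow> {a i<..<a i + \<epsilon>} \<subseteq> {0<..<1}"
proof -
  obtain a where a: "Q = (\<Pi>\<^sub>E i\<in>{..<d}. {a i<..<a i + \<epsilon>})" "Q \<subseteq> (\<Pi>\<^sub>E i\<in>{..<d}. {0<..<1})"
    using assms(1) by (auto simp: eps_cubes_def)
  have "(\<Pi>\<^sub>E i\<in>{..<d}. {a i<..<a i + \<epsilon>}) \<noteq> {}" using assms(2) by (simp add: PiE_eq_empty_iff)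
  hence "\<forall>i\<in>{..<d}. {a i<..<a i + \<epsilon>} \<subseteq> {0<..<1}"
    using a(2) unfolding a(1) subset_PiE by blast
  thus ?thesis using that a(1) by auto
qed

lemma sets_eps_cube: "Q \<in> eps_cubes d \<epsilon> \<Longrightarrow> \<epsilon> > 0 \<Longrightarrow> Q \<in> sets (cube_measure d)"
  by (erule eps_cubes_E) (auto intro!: sets_box)

lemma measure_eps_cube: "Q \<in> eps_cubes d \<epsilon> \<Longrightarrow> \<epsilon> > 0 \<Longrightarrow> measure (cube_measure d) Q = \<epsilon> ^ d"
  by (erule eps_cubes_E) (auto simp: measure_box)

section \<open>Half-open cells and open cubes of the dyadic grid\<close>

definition dyadic_cell :: "nat \<Rightarrow> nat \<Rightarrow> (nat \<Rightarrow> nat) \<Rightarrow> (nat \<Rightarrow> real) set" where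
  "dyadic_cell d k n = (\<Pi>\<^sub>E i\<in>{..<d}. {real (n i) / 2 ^ k ..< (real (n i) + 1) / 2 ^ k} \<inter> {0<..<1})"

text \<open>The open counterpart of \<open>dyadic_cell\<close>. The cells partition the space at
  each level, which averaging needs; the open cubes are what an admissible family may contain. The
  right end is written in the form used by \<open>eps_cubes\<close>.\<close>

definition dyadic_cube :: "nat \<Rightarrow> nat \<Rightarrow> (nat \<Rightarrow> nat) \<Rightarrow> (nat \<Rightarrow> real) set" where
  "dyadic_cube d k n = (\<Pi>\<^sub>E i\<in>{..<d}. {real (n i) / 2 ^ k <..< real (n i) / 2 ^ k + 1 / 2 ^ k})"

definition dyadic_indices :: "nat \<Rightarrow> nat \<Rightarrow> (nat \<Rightarrow> nat) set" where
  "dyadic_indices d k = (\<Pi>\<^sub>E i\<in>{..<d}. {..<2 ^ k})"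

lemma finite_dyadic_indices: "finite (dyadic_indices d k)"
  unfolding dyadic_indices_def by (intro finite_PiE) auto

text \<open>Any point of a cell determines its index, so that distinct cells of one level are
  disjoint.\<close>

lemma dyadic_cell_index:
  assumes "x \<in> dyadic_cell d k n" "i < d" shows "n i = nat \<lfloor>2 ^ k * x i\<rfloor>"
proof -
  have "real (n i) / 2 ^ k \<le> x i" "x i < (real (n i) + 1) / 2 ^ k"
    using assms by (auto simp: dyadic_cell_def PiE_def Pi_def)
  hence "real (n i) \<le> 2 ^ k * x i" "2 ^ k * x i < real (n i) + 1"
    by (simp_all add: field_simps)
  hence "\<lfloor>2 ^ k * x i\<rfloor> = int (n i)" by linarith
  thus ?thesis by simp
qed

lemma dyadic_cell_ex:
  assumes "x \<in> space (cube_measure d)" 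
  shows "(\<lambda>i\<in>{..<d}. nat \<lfloor>2 ^ k * x i\<rfloor>) \<in> dyadic_indices d k" "x \<in> dyadic_cell d k (\<lambda>i\<in>{..<d}. nat \<lfloor>2 ^ k * x i\<rfloor>)"
proof -
  have x: "0 < x i" "x i < 1" if "i < d" for i using assms that by (auto simp: space_cube_measure PiE_def Pi_def)
  have f: "real (nat \<lfloor>2 ^ k * x i\<rfloor>) \<le> 2 ^ k * x i" "2 ^ k * x i < real (nat \<lfloor>2 ^ k * x i\<rfloor>) + 1"
    "nat \<lfloor>2 ^ k * x i\<rfloor> < 2 ^ k" if "i < d" for i
  proof -
    have "0 \<le> 2 ^ k * x i" using x[OF that] by simp
    thus 1: "real (nat \<lfloor>2 ^ k * x i\<rfloor>) \<le> 2 ^ k * x i" and "2 ^ k * x i < real (nat \<lfloor>2 ^ k * x i\<rfloor>) + 1" by linarith+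
    have "2 ^ k * x i < 2 ^ k * 1" using x[OF that] by (intro mult_strict_left_mono) auto
    hence "real (nat \<lfloor>2 ^ k * x i\<rfloor>) < 2 ^ k" using 1 by linarith
    hence "real (nat \<lfloor>2 ^ k * x i\<rfloor>) < real (2 ^ k)" by (simp only: of_nat_power of_nat_numeral)
    thus "nat \<lfloor>2 ^ k * x i\<rfloor> < 2 ^ k" by (simp only: of_nat_less_iff)
  qed
  show "(\<lambda>i\<in>{..<d}. nat \<lfloor>2 ^ k * x i\<rfloor>) \<in> dyadic_indices d k"
    using f(3) by (auto simp: dyadic_indices_def)
  show "x \<in> dyadic_cell d k (\<lambda>i\<in>{..<d}. nat \<lfloor>2 ^ k * x i\<rfloor>)"
    using assms x f unfolding dyadic_cell_def space_cube_measure
    by (auto simp: PiE_iff field_simps)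
qed

text \<open>Intersecting with the open unit interval removes only the endpoint 0 of the first
  interval, hence the case n i = 0.\<close>

lemma dyadic_cell_interval:
  assumes "n \<in> dyadic_indices d k" "i < d"
  shows "measure lborel ({real (n i) / 2 ^ k ..< (real (n i) + 1) / 2 ^ k} \<inter> {0<..<1}) = 1 / 2 ^ k"
    "{real (n i) / 2 ^ k <..< real (n i) / 2 ^ k + 1 / 2 ^ k} \<subseteq> {0<..<1}"
proof -
  have "n i < 2 ^ k" using assms by (auto simp: dyadic_indices_def)
  hence "n i + 1 \<le> 2 ^ k" by simp
  hence "real (n i + 1) \<le> real (2 ^ k)" by (simp only: of_nat_le_iff)
  hence le: "(real (n i) + 1) / 2 ^ k \<le> 1" by simp
  have ge: "0 \<le> real (n i) / 2 ^ k" by simp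
  show "{real (n i) / 2 ^ k <..< real (n i) / 2 ^ k + 1 / 2 ^ k} \<subseteq> {0<..<1}"
    using le order.strict_trans1[OF ge] by (auto simp: add_divide_distrib)
  have lt: "real (n i) / 2 ^ k \<le> (real (n i) + 1) / 2 ^ k" by (simp add: divide_right_mono)
  show "measure lborel ({real (n i) / 2 ^ k ..< (real (n i) + 1) / 2 ^ k} \<inter> {0<..<1}) = 1 / 2 ^ k"
  proof (cases "n i = 0")
    case True
    have "{real (n i) / 2 ^ k ..< (real (n i) + 1) / 2 ^ k} \<inter> {0<..<1} = {0<..<1 / 2 ^ k}"
      using True less_le_trans[of _ "1 / 2 ^ k" "1 :: real"] by auto
    thus ?thesis by simp
  next
    case False
    hence "0 < real (n i) / 2 ^ k" by simp
    hence "{real (n i) / 2 ^ k ..< (real (n i) + 1) / 2 ^ k} \<inter> {0<..<1} = {real (n i) / 2 ^ k ..< (real (n i) + 1) / 2 ^ k}"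
      by (auto intro: less_le_trans[OF _ le] order.strict_trans2)
    thus ?thesis using lt by (simp add: add_divide_distrib)
  qed
qed

lemma dyadic_cell_sets: "dyadic_cell d k n \<in> sets (cube_measure d)"
  unfolding dyadic_cell_def by (intro sets_box) auto

lemma measure_dyadic_cell:
  assumes "n \<in> dyadic_indices d k" shows "measure (cube_measure d) (dyadic_cell d k n) = (1 / 2 ^ k) ^ d"
  unfolding dyadic_cell_def using dyadic_cell_interval(1)[OF assms] by (subst measure_box) auto

lemma dyadic_cube_eps_cubes:
  assumes "n \<in> dyadic_indices d k" shows "dyadic_cube d k n \<in> eps_cubes d (1 / 2 ^ k)"
proof -
  have "dyadic_cube d k n \<subseteq> (\<Pi>\<^sub>E i\<in>{..<d}. {0<..<1})"
    unfolding dyadic_cube_def using dyadic_cell_interval(2)[OF assms] by (intro PiE_mono) auto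
  thus ?thesis unfolding eps_cubes_def dyadic_cube_def
    by (intro CollectI conjI exI[of _ "\<lambda>i. real (n i) / 2 ^ k"]) auto
qed

lemma dyadic_cube_subset_cell:
  assumes "n \<in> dyadic_indices d k" shows "dyadic_cube d k n \<subseteq> dyadic_cell d k n"
  unfolding dyadic_cube_def dyadic_cell_def using dyadic_cell_interval(2)[OF assms]
  by (intro PiE_mono) (auto simp: add_divide_distrib)

text \<open>Each coordinate is the pointwise limit of its roundings down to multiples of 2 ^ -k,
  which are step functions on the cells. So the coordinates are measurable for the \<sigma>-algebra
  of the cells, and with them the identity map into the product space.\<close>

lemma sets_cube_measure_sigma_cells:
  "sets (cube_measure d) = sigma_sets (space (cube_measure d)) (\<Union>k. dyadic_cell d k ` dyadic_indices d k)"
proof (rule antisym)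
  show "sigma_sets (space (cube_measure d)) (\<Union>k. dyadic_cell d k ` dyadic_indices d k) \<subseteq> sets (cube_measure d)"
    by (rule sets.sigma_sets_subset) (auto intro: dyadic_cell_sets)
  let ?\<Omega> = "space (cube_measure d)"
  define G where "G = (\<Union>k. dyadic_cell d k ` dyadic_indices d k)"
  define N where "N = sigma ?\<Omega> G"
  have G: "G \<subseteq> Pow ?\<Omega>" using dyadic_cell_sets[THEN sets.sets_into_space] by (auto simp: G_def)
  have N: "space N = ?\<Omega>" "sets N = sigma_sets ?\<Omega> G" using G by (simp_all add: N_def)
  have cellN: "dyadic_cell d k n \<in> sets N" if "n \<in> dyadic_indices d k" for k n
    using that unfolding N G_def by (intro sigma_sets.Basic) auto
  have coord: "(\<lambda>x. x i) \<in> borel_measurable N" if i: "i < d" for i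
  proof (rule borel_measurable_LIMSEQ_real[where u = "\<lambda>k x. \<Sum>n\<in>dyadic_indices d k. real (n i) / 2 ^ k * indicator (dyadic_cell d k n) x"])
    fix k
    show "(\<lambda>x. \<Sum>n\<in>dyadic_indices d k. real (n i) / 2 ^ k * indicator (dyadic_cell d k n) x) \<in> borel_measurable N"
      using cellN by (intro borel_measurable_sum borel_measurable_times borel_measurable_const borel_measurable_indicator)
  next
    fix x assume "x \<in> space N"
    hence x: "x \<in> space (cube_measure d)" using N by simp
    have eq: "(\<Sum>n\<in>dyadic_indices d k. real (n i) / 2 ^ k * indicator (dyadic_cell d k n) x) = real (nat \<lfloor>2 ^ k * x i\<rfloor>) / 2 ^ k" for k
    proof -
      define m where "m = (\<lambda>i\<in>{..<d}. nat \<lfloor>2 ^ k * x i\<rfloor>)"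
      have m: "m \<in> dyadic_indices d k" "x \<in> dyadic_cell d k m" using dyadic_cell_ex[OF x, of k] by (auto simp: m_def)
      have nm: "n = m" if "n \<in> dyadic_indices d k" "x \<in> dyadic_cell d k n" for n
        using that dyadic_cell_index[OF that(2)]
        by (intro extensionalityI[of _ "{..<d}"]) (auto simp: m_def dyadic_indices_def PiE_def)
      have "(\<Sum>n\<in>dyadic_indices d k. real (n i) / 2 ^ k * indicator (dyadic_cell d k n) x) =
          (\<Sum>n\<in>dyadic_indices d k. if n = m then real (m i) / 2 ^ k else 0)"
      proof (intro sum.cong refl)
        fix n assume "n \<in> dyadic_indices d k"
        hence "x \<in> dyadic_cell d k n \<longleftrightarrow> n = m" using nm[of n] m(2) by blast
        thus "real (n i) / 2 ^ k * indicator (dyadic_cell d k n) x = (if n = m then real (m i) / 2 ^ k else 0)"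
          by (simp add: indicator_def)
      qed
      also have "\<dots> = real (m i) / 2 ^ k" using m(1) finite_dyadic_indices by simp
      finally show ?thesis using i by (simp add: m_def)
    qed
    have xi: "0 < x i" using x i by (auto simp: space_cube_measure PiE_def Pi_def)
    have "(\<lambda>k. real (nat \<lfloor>2 ^ k * x i\<rfloor>) / 2 ^ k) \<longlonglongrightarrow> x i"
    proof (rule tendsto_sandwich[where f = "\<lambda>k. x i - (1 / 2) ^ k" and h = "\<lambda>k. x i"])
      have b: "2 ^ k * x i - 1 \<le> real (nat \<lfloor>2 ^ k * x i\<rfloor>)" "real (nat \<lfloor>2 ^ k * x i\<rfloor>) \<le> 2 ^ k * x i" for k
      proof -
        have "0 \<le> 2 ^ k * x i" using xi by simp
        thus "2 ^ k * x i - 1 \<le> real (nat \<lfloor>2 ^ k * x i\<rfloor>)" "real (nat \<lfloor>2 ^ k * x i\<rfloor>) \<le> 2 ^ k * x i" by linarith+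
      qed
      have "x i - (1 / 2) ^ k \<le> real (nat \<lfloor>2 ^ k * x i\<rfloor>) / 2 ^ k" "real (nat \<lfloor>2 ^ k * x i\<rfloor>) / 2 ^ k \<le> x i" for k
      proof -
        have "x i - (1 / 2) ^ k = (2 ^ k * x i - 1) / 2 ^ k" by (simp add: diff_divide_distrib power_one_over)
        thus "x i - (1 / 2) ^ k \<le> real (nat \<lfloor>2 ^ k * x i\<rfloor>) / 2 ^ k" using b(1)[of k] by (simp add: divide_right_mono)
        show "real (nat \<lfloor>2 ^ k * x i\<rfloor>) / 2 ^ k \<le> x i" using b(2)[of k] by (simp add: field_simps)
      qed
      thus "\<forall>\<^sub>F k in sequentially. x i - (1 / 2) ^ k \<le> real (nat \<lfloor>2 ^ k * x i\<rfloor>) / 2 ^ k"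
        "\<forall>\<^sub>F k in sequentially. real (nat \<lfloor>2 ^ k * x i\<rfloor>) / 2 ^ k \<le> x i" by auto
      have "(\<lambda>k. x i - (1 / 2) ^ k) \<longlonglongrightarrow> x i - 0" by (intro tendsto_intros LIMSEQ_realpow_zero) auto
      thus "(\<lambda>k. x i - (1 / 2) ^ k) \<longlonglongrightarrow> x i" by simp
    qed simp
    thus "(\<lambda>k. \<Sum>n\<in>dyadic_indices d k. real (n i) / 2 ^ k * indicator (dyadic_cell d k n) x) \<longlonglongrightarrow> x i"
      unfolding eq .
  qed
  have "(\<lambda>\<omega> i. \<omega> i) \<in> measurable N (cube_measure d)"
    unfolding cube_measure_def
  proof (rule measurable_PiM_single')
    fix i assume i: "i \<in> {..<d}"
    show "(\<lambda>\<omega>. \<omega> i) \<in> measurable N (restrict_space lborel {0<..<1})"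
      using coord[of i] i N(1) by (intro measurable_restrict_space2) (auto simp: space_cube_measure)
  qed (auto simp: N(1) space_cube_measure space_restrict_space)
  note id = this
  have "A \<in> sets N" if A: "A \<in> sets (cube_measure d)" for A
  proof -
    have "(\<lambda>\<omega> i. \<omega> i) -` A \<inter> space N = A" using sets.sets_into_space[OF A] N(1) by auto
    thus ?thesis using measurable_sets[OF id A] by simp
  qed
  thus "sets (cube_measure d) \<subseteq> sigma_sets ?\<Omega> (\<Union>k. dyadic_cell d k ` dyadic_indices d k)"
    using N by (auto simp: G_def)
qed

text \<open>With p = 2 ^ (d - 1) the measure 2 ^ -(d k) of a cell is (2 p) ^ -k, where d \<ge> 1
  makes d - 1 a true predecessor. The parent of a cell has its index halved in each
  coordinate.\<close>

lemma dyadic_cells_cube: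
  assumes d: "d \<ge> 1"
  shows "dyadic_cells (cube_measure d) (\<lambda>k. dyadic_cell d k ` dyadic_indices d k) (2 ^ (d - 1))"
proof -
  interpret finite_measure "cube_measure d" by (rule finite_measure_cube)
  show ?thesis
  proof
    show "finite (dyadic_cell d k ` dyadic_indices d k)" for k by (simp add: finite_dyadic_indices)
    show "\<Union>(dyadic_cell d k ` dyadic_indices d k) = space (cube_measure d)" for k
      using dyadic_cell_ex[of _ d k] dyadic_cell_sets[THEN sets.sets_into_space] by blast
    show "c = c'" if "c \<in> dyadic_cell d k ` dyadic_indices d k" "c' \<in> dyadic_cell d k ` dyadic_indices d k" "c \<inter> c' \<noteq> {}" for c c' k
    proof -
      from that obtain n n' x where n: "n \<in> dyadic_indices d k" "n' \<in> dyadic_indices d k" "c = dyadic_cell d k n" "c' = dyadic_cell d k n'"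
        "x \<in> dyadic_cell d k n" "x \<in> dyadic_cell d k n'" by blast
      have "n = n'" using n(1,2) dyadic_cell_index[OF n(5)] dyadic_cell_index[OF n(6)]
        by (intro extensionalityI[of _ "{..<d}"]) (auto simp: dyadic_indices_def PiE_def)
      thus ?thesis using n by simp
    qed
    show "c \<in> sets (cube_measure d)" if "c \<in> dyadic_cell d k ` dyadic_indices d k" for c k
      using that dyadic_cell_sets by auto
    show "measure (cube_measure d) c = 1 / (2 * real (2 ^ (d - 1))) ^ k" if "c \<in> dyadic_cell d k ` dyadic_indices d k" for c k
    proof -
      have "2 * real (2 ^ (d - 1)) = 2 ^ d" using d by (cases d) auto
      thus ?thesis using that by (auto simp: measure_dyadic_cell power_one_over power_mult[symmetric] mult.commute)
    qed
    show "\<exists>c'\<in>dyadic_cell d k ` dyadic_indices d k. c \<subseteq> c'" if "c \<in> dyadic_cell d (Suc k) ` dyadic_indices d (Suc k)" for c k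
    proof -
      from that obtain n where n: "n \<in> dyadic_indices d (Suc k)" "c = dyadic_cell d (Suc k) n" by blast
      define m where "m = (\<lambda>i\<in>{..<d}. n i div 2)"
      have m: "m \<in> dyadic_indices d k" using n(1) by (auto simp: dyadic_indices_def m_def PiE_iff less_mult_imp_div_less mult.commute)
      have "{real (n i) / 2 ^ Suc k ..< (real (n i) + 1) / 2 ^ Suc k} \<subseteq> {real (m i) / 2 ^ k ..< (real (m i) + 1) / 2 ^ k}" if i: "i < d" for i
      proof -
        have "n i = 2 * m i \<or> n i = 2 * m i + 1" using i by (auto simp: m_def)
        hence "real (n i) = 2 * real (m i) \<or> real (n i) = 2 * real (m i) + 1" by auto
        thus ?thesis by (auto simp: field_simps)
      qed
      hence "c \<subseteq> dyadic_cell d k m" unfolding n(2) dyadic_cell_def by (intro PiE_mono) blast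
      thus ?thesis using m by blast
    qed
  qed (use sets_cube_measure_sigma_cells in auto)
qed

section \<open>The Bourgain--Brezis--Mironescu space as a normed space\<close>

context dyadic_cells
begin

text \<open>With C = q * 2 ^ s the set where |f| > C has measure at most 1 / C, so
  \<open>uniform_integrability\<close> bounds the integral of |f| over it by q / C + 2 / 2 ^ s = 3 /
  2 ^ s, and the weight there is at most b. Elsewhere the integrand is at most C * w.\<close>

lemma uniform_integrability_bounded:
  fixes w :: "'a \<Rightarrow> real"
  assumes f: "integrable M f" and f1: "(LINT x|M. cmod (f x)) \<le> 1"
    and osc: "\<And>j D. D \<subseteq> cells j \<Longrightarrow> card D \<le> p ^ j \<Longrightarrow> sum (osc f) D \<le> 1 / 2 ^ j"
    and w: "w \<in> borel_measurable M" "\<And>x. x \<in> space M \<Longrightarrow> 0 \<le> w x" "\<And>x. x \<in> space M \<Longrightarrow> w x \<le> b" "b \<ge> 0"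
  shows "(LINT x|M. cmod (f x) * w x) \<le> (2 * real p) ^ Suc s * 2 ^ s * (LINT x|M. w x) + 3 / 2 ^ s * b"
proof -
  define q where "q = (2 * real p) ^ Suc s"
  define C where "C = q * 2 ^ s"
  have q: "q > 0" using p_pos by (simp add: q_def)
  hence C: "C > 0" by (simp add: C_def)
  define E where "E = {x \<in> space M. cmod (f x) > C}"
  have E: "E \<in> sets M" unfolding E_def using borel_measurable_integrable[OF f] by measurable
  have fi: "integrable M (\<lambda>x. cmod (f x))" using f by simp
  have Ef: "integrable M (\<lambda>x. indicator E x *\<^sub>R cmod (f x))" by (rule integrable_mult_indicator[OF E fi])
  have wi: "integrable M w" using w by (intro integrable_const_bound[where B = b]) auto
  have "C * measure M E = (LINT x|M. C * indicator E x)" using E by simp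
  also have "\<dots> \<le> (LINT x|M. cmod (f x))"
  proof (rule integral_mono)
    show "integrable M (\<lambda>x. C * indicator E x)"
      using E by (intro integrable_mult_right integrable_real_indicator) (auto simp: emeasure_eq_measure)
  qed (use fi in \<open>auto simp: E_def indicator_def\<close>)
  also have "\<dots> \<le> 1" by (rule f1)
  finally have mE: "measure M E \<le> 1 / C" using C by (simp add: field_simps)
  have "(LINT x:E|M. cmod (f x)) \<le> q * measure M E + 2 / 2 ^ s"
    unfolding q_def by (rule uniform_integrability[OF f f1 osc E])
  also have "q * measure M E \<le> q * (1 / C)" using mE q by (intro mult_left_mono) auto
  also have "q * (1 / C) + 2 / 2 ^ s = 3 / 2 ^ s" using q by (simp add: C_def field_simps)
  finally have fE: "(LINT x:E|M. cmod (f x)) \<le> 3 / 2 ^ s" by simp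
  have "(LINT x|M. cmod (f x) * w x) \<le> (LINT x|M. C * w x + b * (indicator E x *\<^sub>R cmod (f x)))"
  proof (rule integral_mono)
    show "integrable M (\<lambda>x. C * w x + b * (indicator E x *\<^sub>R cmod (f x)))"
      by (intro Bochner_Integration.integrable_add integrable_mult_right wi Ef)
    show "integrable M (\<lambda>x. cmod (f x) * w x)"
    proof (rule Bochner_Integration.integrable_bound[OF integrable_mult_right[OF fi]])
      show "(\<lambda>x. cmod (f x) * w x) \<in> borel_measurable M"
        using borel_measurable_integrable[OF fi] w(1) by (rule borel_measurable_times)
      show "AE x in M. norm (cmod (f x) * w x) \<le> norm (b * cmod (f x))"
        using w(2-4) by (intro AE_I2) (auto simp: abs_mult mult.commute intro!: mult_right_mono)
    qed
    fix x assume x: "x \<in> space M"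
    show "cmod (f x) * w x \<le> C * w x + b * (indicator E x *\<^sub>R cmod (f x))"
    proof (cases "x \<in> E")
      case True
      have "cmod (f x) * w x \<le> b * cmod (f x)"
        using w(3)[OF x] by (subst mult.commute) (intro mult_right_mono, auto)
      moreover have "0 \<le> C * w x" using C w(2)[OF x] by simp
      ultimately show ?thesis using True by simp
    next
      case False
      hence "cmod (f x) \<le> C" using x by (simp add: E_def)
      thus ?thesis using False w(2)[OF x] by (simp add: mult_right_mono)
    qed
  qed
  also have "\<dots> = C * (LINT x|M. w x) + b * (LINT x:E|M. cmod (f x))"
    unfolding set_lebesgue_integral_def
    by (subst Bochner_Integration.integral_add) (simp_all only: integrable_mult_right wi Ef integral_mult_right_zero)
  also have "\<dots> \<le> C * (LINT x|M. w x) + b * (3 / 2 ^ s)"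
    using fE w(4) by (intro add_left_mono mult_left_mono)
  finally show ?thesis by (simp add: C_def q_def mult.commute)
qed

end

locale unit_cube =
  fixes d :: nat
  assumes d_pos: "d \<ge> 1"

sublocale unit_cube \<subseteq> dyadic_cells "cube_measure d" "\<lambda>k. dyadic_cell d k ` dyadic_indices d k" "2 ^ (d - 1)"
  by (rule dyadic_cells_cube[OF d_pos])

context unit_cube
begin

abbreviation "M \<equiv> cube_measure d"

section \<open>Oscillation sums and the seminorm\<close>

definition osc_sum :: "real \<Rightarrow> (nat \<Rightarrow> real) set set \<Rightarrow> ((nat \<Rightarrow> real) \<Rightarrow> complex) \<Rightarrow> real" where
  "osc_sum \<epsilon> F f = \<epsilon> ^ (d - 1) * (\<Sum>Q\<in>F. mean_oscillation d f Q)"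

text \<open>The norm as a real number. It is meaningful on \<open>bbm_functions d\<close> only; an
  infinite extended norm is sent to 0.\<close>

definition N :: "((nat \<Rightarrow> real) \<Rightarrow> complex) \<Rightarrow> real" where
  "N f = enn2real (bbm_norm d f)"

lemma cube_families_simps:
  assumes "F \<in> cube_families d \<epsilon>" "\<epsilon> > 0"
  shows "finite F" "Q \<in> F \<Longrightarrow> Q \<in> sets M" "Q \<in> F \<Longrightarrow> measure M Q = \<epsilon> ^ d" "Q \<in> F \<Longrightarrow> Q \<in> eps_cubes d \<epsilon>"
proof -
  show "finite F" using assms(1) by (simp add: cube_families_def)
  have sub: "F \<subseteq> eps_cubes d \<epsilon>" using assms(1) by (simp add: cube_families_def)
  assume "Q \<in> F"
  hence Q: "Q \<in> eps_cubes d \<epsilon>" using sub by auto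
  show "Q \<in> eps_cubes d \<epsilon>" "Q \<in> sets M" "measure M Q = \<epsilon> ^ d"
    by (rule Q sets_eps_cube[OF Q assms(2)] measure_eps_cube[OF Q assms(2)])+
qed

lemma set_integrable_M: "integrable M f \<Longrightarrow> Q \<in> sets M \<Longrightarrow> set_integrable M Q f"
  for f :: "_ \<Rightarrow> 'b::{banach, second_countable_topology}"
  unfolding set_integrable_def by (rule integrable_mult_indicator)

lemma set_integrable_const_M: "Q \<in> sets M \<Longrightarrow> set_integrable M Q (\<lambda>x. c)"
  for c :: "'b::{banach, second_countable_topology}"
  by (rule set_integrable_M) auto

lemma set_integral_const_M: "Q \<in> sets M \<Longrightarrow> (LINT x:Q|M. c) = measure M Q *\<^sub>R c"
  for c :: "'b::{banach, second_countable_topology}"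
  unfolding set_lebesgue_integral_def
  by (rule has_bochner_integral_integral_eq[OF has_bochner_integral_indicator]) (simp_all add: emeasure_eq_measure)

lemma set_integrable_osc: "integrable M f \<Longrightarrow> Q \<in> sets M \<Longrightarrow> set_integrable M Q (\<lambda>x. cmod (f x - c))"
  for f :: "_ \<Rightarrow> complex"
  by (rule set_integrable_M[OF integrable_norm]) auto

lemma set_integral_nonneg_M: "(\<And>x. 0 \<le> f x) \<Longrightarrow> 0 \<le> (LINT x:Q|M. f x)" for f :: "_ \<Rightarrow> real"
  unfolding set_lebesgue_integral_def by (rule Bochner_Integration.integral_nonneg) (simp add: indicator_def)

lemma mean_oscillation_nonneg: "0 \<le> mean_oscillation d f Q"
  unfolding mean_oscillation_def by (intro mult_nonneg_nonneg set_integral_nonneg_M) auto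

lemma mean_oscillation_add:
  assumes "integrable M f" "integrable M g" "Q \<in> sets M"
  shows "mean_oscillation d (\<lambda>x. f x + g x) Q \<le> mean_oscillation d f Q + mean_oscillation d g Q"
proof -
  note i = set_integrable_M[OF assms(1,3)] set_integrable_M[OF assms(2,3)]
  have m: "cube_mean d (\<lambda>x. f x + g x) Q = cube_mean d f Q + cube_mean d g Q"
    unfolding cube_mean_def set_integral_add(2)[OF i] by (simp add: add_divide_distrib)
  have "(LINT x:Q|M. cmod (f x + g x - cube_mean d (\<lambda>x. f x + g x) Q)) \<le>
      (LINT x:Q|M. cmod (f x - cube_mean d f Q) + cmod (g x - cube_mean d g Q))"
    unfolding m using assms
    by (intro set_integral_mono set_integrable_osc set_integral_add(1) Bochner_Integration.integrable_add)
      (auto intro: order_trans[OF eq_refl norm_triangle_ineq] simp: add_diff_add)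
  also have "\<dots> = (LINT x:Q|M. cmod (f x - cube_mean d f Q)) + (LINT x:Q|M. cmod (g x - cube_mean d g Q))"
    by (intro set_integral_add(2) set_integrable_osc assms)
  finally have "1 / measure M Q * (LINT x:Q|M. cmod (f x + g x - cube_mean d (\<lambda>x. f x + g x) Q)) \<le>
     1 / measure M Q * ((LINT x:Q|M. cmod (f x - cube_mean d f Q)) + (LINT x:Q|M. cmod (g x - cube_mean d g Q)))"
    by (rule mult_left_mono) simp
  thus ?thesis by (simp only: mean_oscillation_def distrib_left)
qed

lemma mean_oscillation_cmult: "mean_oscillation d (\<lambda>x. c * f x) Q = cmod c * mean_oscillation d f Q"
proof -
  have m: "cube_mean d (\<lambda>x. c * f x) Q = c * cube_mean d f Q"
    unfolding cube_mean_def set_lebesgue_integral_def mult_scaleR_right[symmetric] integral_mult_right_zero by simp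
  have "(LINT x:Q|M. cmod (c * f x - c * cube_mean d f Q)) = cmod c * (LINT x:Q|M. cmod (f x - cube_mean d f Q))"
    unfolding set_lebesgue_integral_def right_diff_distrib[symmetric] norm_mult mult_scaleR_right[symmetric] integral_mult_right_zero ..
  thus ?thesis by (simp add: mean_oscillation_def m)
qed

text \<open>Adding a constant shifts the function and its cube mean alike. This makes the norm well
  defined on classes.\<close>

lemma mean_oscillation_cong:
  assumes "integrable M f" "integrable M g" "Q \<in> sets M" "measure M Q > 0" "AE x in M. f x = g x + c"
  shows "mean_oscillation d f Q = mean_oscillation d g Q"
proof -
  have "(LINT x:Q|M. f x) = (LINT x:Q|M. g x + c)"
    unfolding set_lebesgue_integral_def
  proof (rule integral_cong_AE)
    show "AE x in M. indicator Q x *\<^sub>R f x = indicator Q x *\<^sub>R (g x + c)" using assms(5) by eventually_elim simp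
  qed (use assms set_integrable_M[OF assms(1,3)] set_integrable_M[of "\<lambda>x. g x + c" Q] in \<open>auto simp: set_integrable_def\<close>)
  also have "\<dots> = (LINT x:Q|M. g x) + measure M Q *\<^sub>R c"
    unfolding set_integral_add(2)[OF set_integrable_M[OF assms(2,3)] set_integrable_const_M[OF assms(3)]]
      set_integral_const_M[OF assms(3)] ..
  finally have m: "cube_mean d f Q = cube_mean d g Q + c"
    using assms(4) by (simp add: cube_mean_def add_divide_distrib scaleR_conv_of_real)
  have "(LINT x:Q|M. cmod (f x - cube_mean d f Q)) = (LINT x:Q|M. cmod (g x - cube_mean d g Q))"
    unfolding set_lebesgue_integral_def
  proof (rule integral_cong_AE)
    show "AE x in M. indicator Q x *\<^sub>R cmod (f x - cube_mean d f Q) = indicator Q x *\<^sub>R cmod (g x - cube_mean d g Q)"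
      using assms(5) by eventually_elim (simp add: m)
  qed (use set_integrable_osc[OF assms(1,3)] set_integrable_osc[OF assms(2,3)] in \<open>auto simp: set_integrable_def\<close>)
  thus ?thesis by (simp add: mean_oscillation_def)
qed

lemma osc_sum_nonneg: "\<epsilon> > 0 \<Longrightarrow> 0 \<le> osc_sum \<epsilon> F f"
  unfolding osc_sum_def by (intro mult_nonneg_nonneg sum_nonneg mean_oscillation_nonneg) auto

lemma osc_sum_add:
  assumes "integrable M f" "integrable M g" "F \<in> cube_families d \<epsilon>" "\<epsilon> > 0"
  shows "osc_sum \<epsilon> F (\<lambda>x. f x + g x) \<le> osc_sum \<epsilon> F f + osc_sum \<epsilon> F g"
  unfolding osc_sum_def distrib_left[symmetric] sum.distrib[symmetric]
  by (intro mult_left_mono sum_mono mean_oscillation_add assms(1,2) cube_families_simps(2)[OF assms(3,4)])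
    (use assms(4) in auto)

lemma osc_sum_cmult: "osc_sum \<epsilon> F (\<lambda>x. c * f x) = cmod c * osc_sum \<epsilon> F f"
  by (simp add: osc_sum_def mean_oscillation_cmult sum_distrib_left[symmetric])

lemma osc_sum_cong:
  assumes "integrable M f" "integrable M g" "F \<in> cube_families d \<epsilon>" "\<epsilon> > 0" "AE x in M. f x = g x + c"
  shows "osc_sum \<epsilon> F f = osc_sum \<epsilon> F g"
proof -
  have "mean_oscillation d f Q = mean_oscillation d g Q" if "Q \<in> F" for Q
    using cube_families_simps(2,3)[OF assms(3,4) that] assms(4)
    by (intro mean_oscillation_cong[OF assms(1,2) _ _ assms(5)]) auto
  thus ?thesis by (simp add: osc_sum_def)
qed

text \<open>Replaces the extended suprema by real inequalities, one for each scale and family;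
  \<open>N_le\<close> and \<open>osc_sum_le_N\<close> rest on it.\<close>

lemma bbm_norm_le_iff:
  assumes "K \<ge> 0"
  shows "bbm_norm d f \<le> ennreal K \<longleftrightarrow> (\<forall>\<epsilon>\<in>{0<..1}. \<forall>F\<in>cube_families d \<epsilon>. osc_sum \<epsilon> F f \<le> K)"
proof -
  have "ennreal (\<epsilon> ^ (d - 1)) * ennreal (\<Sum>Q\<in>F. mean_oscillation d f Q) = ennreal (osc_sum \<epsilon> F f)" if "\<epsilon> > 0" for \<epsilon> F
    unfolding osc_sum_def using that by (intro ennreal_mult'[symmetric]) auto
  hence "bbm_norm d f \<le> ennreal K \<longleftrightarrow> (\<forall>\<epsilon>\<in>{0<..1}. \<forall>F\<in>cube_families d \<epsilon>. ennreal (osc_sum \<epsilon> F f) \<le> ennreal K)"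
    unfolding bbm_norm_def bbm_eps_def SUP_mult_left_ennreal SUP_le_iff by simp
  thus ?thesis using assms by (simp add: ennreal_le_iff)
qed

lemma bbm_functions_integrable: "f \<in> bbm_functions d \<Longrightarrow> integrable M f"
  by (simp add: bbm_functions_def)

lemma N_nonneg: "0 \<le> N f"
  by (simp add: N_def)

lemma osc_sum_le_N:
  assumes "f \<in> bbm_functions d" "\<epsilon> \<in> {0<..1}" "F \<in> cube_families d \<epsilon>" shows "osc_sum \<epsilon> F f \<le> N f"
proof -
  have "bbm_norm d f \<le> ennreal (N f)" using assms(1) by (simp add: N_def bbm_functions_def)
  thus ?thesis using bbm_norm_le_iff[OF N_nonneg, of f] assms by blast
qed

lemma N_le:
  assumes "K \<ge> 0" "\<And>\<epsilon> F. \<epsilon> \<in> {0<..1} \<Longrightarrow> F \<in> cube_families d \<epsilon> \<Longrightarrow> osc_sum \<epsilon> F f \<le> K"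
  shows "N f \<le> K"
  unfolding N_def by (rule enn2real_leI[OF assms(1)]) (simp add: bbm_norm_le_iff[OF assms(1)] assms(2))

lemma bbm_functionsI:
  assumes "integrable M f" "K \<ge> 0" "\<And>\<epsilon> F. \<epsilon> \<in> {0<..1} \<Longrightarrow> F \<in> cube_families d \<epsilon> \<Longrightarrow> osc_sum \<epsilon> F f \<le> K"
  shows "f \<in> bbm_functions d"
proof -
  have "bbm_norm d f \<le> ennreal K" using assms bbm_norm_le_iff[OF assms(2), of f] by blast
  hence "bbm_norm d f < \<infinity>" by (rule le_less_trans) simp
  thus ?thesis using assms(1) by (simp add: bbm_functions_def)
qed

lemma
  assumes f: "f \<in> bbm_functions d" and g: "g \<in> bbm_functions d"
  shows bbm_functions_add: "(\<lambda>x. f x + g x) \<in> bbm_functions d" and N_add: "N (\<lambda>x. f x + g x) \<le> N f + N g"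
proof -
  have le: "osc_sum \<epsilon> F (\<lambda>x. f x + g x) \<le> N f + N g" if "\<epsilon> \<in> {0<..1}" "F \<in> cube_families d \<epsilon>" for \<epsilon> F
    using osc_sum_add[OF bbm_functions_integrable[OF f] bbm_functions_integrable[OF g] that(2)] that(1)
      osc_sum_le_N[OF f that] osc_sum_le_N[OF g that] by auto
  show "(\<lambda>x. f x + g x) \<in> bbm_functions d"
    using bbm_functions_integrable[OF f] bbm_functions_integrable[OF g] N_nonneg[of f] N_nonneg[of g]
    by (intro bbm_functionsI[OF _ _ le]) auto
  show "N (\<lambda>x. f x + g x) \<le> N f + N g" using N_nonneg[of f] N_nonneg[of g] by (intro N_le[OF _ le]) auto
qed

lemma
  assumes f: "f \<in> bbm_functions d"
  shows bbm_functions_cmult: "(\<lambda>x. c * f x) \<in> bbm_functions d" and N_cmult_le: "N (\<lambda>x. c * f x) \<le> cmod c * N f"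
proof -
  have le: "osc_sum \<epsilon> F (\<lambda>x. c * f x) \<le> cmod c * N f" if "\<epsilon> \<in> {0<..1}" "F \<in> cube_families d \<epsilon>" for \<epsilon> F
    unfolding osc_sum_cmult using osc_sum_le_N[OF f that] by (intro mult_left_mono) auto
  show "(\<lambda>x. c * f x) \<in> bbm_functions d"
    using bbm_functions_integrable[OF f] N_nonneg[of f] by (intro bbm_functionsI[OF _ _ le]) auto
  show "N (\<lambda>x. c * f x) \<le> cmod c * N f" using N_nonneg[of f] by (intro N_le[OF _ le]) auto
qed

lemma N_cmult:
  assumes f: "f \<in> bbm_functions d" shows "N (\<lambda>x. c * f x) = cmod c * N f"
proof (cases "c = 0")
  case True
  thus ?thesis using N_cmult_le[OF f, of c] N_nonneg[of "\<lambda>x. c * f x"] by simp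
next
  case False
  have "N (\<lambda>x. (1 / c) * (c * f x)) \<le> cmod (1 / c) * N (\<lambda>x. c * f x)"
    by (rule N_cmult_le[OF bbm_functions_cmult[OF f]])
  hence "cmod c * N f \<le> N (\<lambda>x. c * f x)" using False by (simp add: norm_divide field_simps)
  thus ?thesis using N_cmult_le[OF f, of c] by simp
qed

lemma bbm_functions_const: "(\<lambda>x. c) \<in> bbm_functions d"
proof (rule bbm_functionsI[where K = 0])
  fix \<epsilon> :: real and F assume e: "\<epsilon> \<in> {0<..1}" and F: "F \<in> cube_families d \<epsilon>"
  have "osc_sum \<epsilon> F (\<lambda>x. c) = osc_sum \<epsilon> F (\<lambda>x. 0 * c)"
    by (rule osc_sum_cong[OF _ _ F, where c = c]) (use e in auto)
  also have "\<dots> = 0" using osc_sum_cmult[of \<epsilon> F 0 "\<lambda>_. c"] by simp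
  finally show "osc_sum \<epsilon> F (\<lambda>x. c) \<le> 0" by simp
qed auto

section \<open>Classes modulo constants and null sets\<close>

lemma bbm_relI:
  "f \<in> bbm_functions d \<Longrightarrow> g \<in> bbm_functions d \<Longrightarrow> AE x in M. f x = g x + c \<Longrightarrow> (f, g) \<in> bbm_rel d"
  by (auto simp: bbm_rel_def)

lemma equiv_bbm_rel: "equiv (bbm_functions d) (bbm_rel d)"
proof (rule equivI)
  show "bbm_rel d \<subseteq> bbm_functions d \<times> bbm_functions d" by (auto simp: bbm_rel_def)
  show "refl_on (bbm_functions d) (bbm_rel d)"
    by (auto simp: refl_on_def intro!: bbm_relI[where c = 0])
  show "sym (bbm_rel d)"
  proof (rule symI)
    fix f g assume "(f, g) \<in> bbm_rel d"
    then obtain c where "f \<in> bbm_functions d" "g \<in> bbm_functions d" "AE x in M. f x = g x + c"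
      by (auto simp: bbm_rel_def)
    thus "(g, f) \<in> bbm_rel d" by (auto intro!: bbm_relI[where c = "- c"])
  qed
  show "trans (bbm_rel d)"
  proof (rule transI)
    fix f g h assume "(f, g) \<in> bbm_rel d" "(g, h) \<in> bbm_rel d"
    then obtain c c' where 1: "f \<in> bbm_functions d" "h \<in> bbm_functions d" "AE x in M. f x = g x + c" "AE x in M. g x = h x + c'"
      by (auto simp: bbm_rel_def)
    have "AE x in M. f x = h x + (c + c')" using 1(3,4) by eventually_elim simp
    thus "(f, h) \<in> bbm_rel d" using 1 by (intro bbm_relI)
  qed
qed

lemma bbm_space_simps:
  "carrier (bbm_space d) = bbm_functions d // bbm_rel d"
  "\<zero>\<^bsub>bbm_space d\<^esub> = bbm_class d (\<lambda>x. 0)"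
  "X \<oplus>\<^bsub>bbm_space d\<^esub> Y = bbm_class d (\<lambda>x. bbm_rep X x + bbm_rep Y x)"
  "c \<odot>\<^bsub>bbm_space d\<^esub> X = bbm_class d (\<lambda>x. c * bbm_rep X x)"
  "nrm (bbm_space d) X = N (bbm_rep X)"
  by (simp_all add: bbm_space_def N_def)

lemma bbm_class_carrier: "f \<in> bbm_functions d \<Longrightarrow> bbm_class d f \<in> carrier (bbm_space d)"
  by (simp add: bbm_space_simps bbm_class_def quotientI)

lemma bbm_class_eqI:
  "f \<in> bbm_functions d \<Longrightarrow> g \<in> bbm_functions d \<Longrightarrow> AE x in M. f x = g x + c \<Longrightarrow> bbm_class d f = bbm_class d g"
  unfolding bbm_class_def by (rule equiv_class_eq[OF equiv_bbm_rel bbm_relI])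

text \<open>\<open>bbm_rep\<close> is an arbitrary choice from the class and can be off by a
  constant almost everywhere; the operations, the norm and the pairing with atoms do not see
  this.\<close>

lemma bbm_rep_class:
  assumes f: "f \<in> bbm_functions d"
  obtains c where "bbm_rep (bbm_class d f) \<in> bbm_functions d" "AE x in M. bbm_rep (bbm_class d f) x = f x + c"
proof -
  have "f \<in> bbm_class d f" unfolding bbm_class_def by (rule equiv_class_self[OF equiv_bbm_rel f])
  hence "bbm_rep (bbm_class d f) \<in> bbm_class d f" unfolding bbm_rep_def by (rule someI[where P = "\<lambda>h. h \<in> bbm_class d f"])
  hence "(f, bbm_rep (bbm_class d f)) \<in> bbm_rel d" by (simp add: bbm_class_def)
  then obtain c where c: "bbm_rep (bbm_class d f) \<in> bbm_functions d" "AE x in M. f x = bbm_rep (bbm_class d f) x + c"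
    by (auto simp: bbm_rel_def)
  have "AE x in M. bbm_rep (bbm_class d f) x = f x + - c" using c(2) by eventually_elim simp
  thus ?thesis using that c(1) by blast
qed

lemma bbm_carrier_E:
  assumes "X \<in> carrier (bbm_space d)"
  obtains f where "f \<in> bbm_functions d" "X = bbm_class d f"
proof -
  from assms have "X \<in> bbm_functions d // bbm_rel d" by (simp only: bbm_space_simps)
  thus ?thesis by (rule quotientE) (use that in \<open>simp add: bbm_class_def\<close>)
qed

lemma bbm_class_add:
  assumes f: "f \<in> bbm_functions d" and g: "g \<in> bbm_functions d"
  shows "bbm_class d f \<oplus>\<^bsub>bbm_space d\<^esub> bbm_class d g = bbm_class d (\<lambda>x. f x + g x)"
proof -
  obtain c where c: "bbm_rep (bbm_class d f) \<in> bbm_functions d" "AE x in M. bbm_rep (bbm_class d f) x = f x + c"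
    using bbm_rep_class[OF f] .
  obtain c' where c': "bbm_rep (bbm_class d g) \<in> bbm_functions d" "AE x in M. bbm_rep (bbm_class d g) x = g x + c'"
    using bbm_rep_class[OF g] .
  have "AE x in M. bbm_rep (bbm_class d f) x + bbm_rep (bbm_class d g) x = (f x + g x) + (c + c')"
    using c(2) c'(2) by eventually_elim simp
  thus ?thesis unfolding bbm_space_simps
    by (rule bbm_class_eqI[OF bbm_functions_add[OF c(1) c'(1)] bbm_functions_add[OF f g]])
qed

lemma bbm_class_smult:
  assumes f: "f \<in> bbm_functions d"
  shows "a \<odot>\<^bsub>bbm_space d\<^esub> bbm_class d f = bbm_class d (\<lambda>x. a * f x)"
proof -
  obtain c where c: "bbm_rep (bbm_class d f) \<in> bbm_functions d" "AE x in M. bbm_rep (bbm_class d f) x = f x + c"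
    using bbm_rep_class[OF f] .
  have "AE x in M. a * bbm_rep (bbm_class d f) x = a * f x + a * c"
    using c(2) by eventually_elim (simp add: distrib_left)
  thus ?thesis unfolding bbm_space_simps
    by (rule bbm_class_eqI[OF bbm_functions_cmult[OF c(1)] bbm_functions_cmult[OF f]])
qed

lemma nrm_bbm_class:
  assumes f: "f \<in> bbm_functions d" shows "nrm (bbm_space d) (bbm_class d f) = N f"
proof -
  obtain c where c: "bbm_rep (bbm_class d f) \<in> bbm_functions d" "AE x in M. bbm_rep (bbm_class d f) x = f x + c"
    using bbm_rep_class[OF f] .
  note i = bbm_functions_integrable[OF c(1)] bbm_functions_integrable[OF f]
  have "osc_sum \<epsilon> F (bbm_rep (bbm_class d f)) = osc_sum \<epsilon> F f" if "\<epsilon> \<in> {0<..1}" "F \<in> cube_families d \<epsilon>" for \<epsilon> F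
    by (rule osc_sum_cong[OF i that(2) _ c(2)]) (use that in simp)
  hence "N (bbm_rep (bbm_class d f)) \<le> N f" "N f \<le> N (bbm_rep (bbm_class d f))"
    using osc_sum_le_N[OF f] osc_sum_le_N[OF c(1)] by (auto intro!: N_le N_nonneg)
  thus ?thesis by (simp add: bbm_space_simps)
qed

lemma unit_cube_family: "{space M} \<in> cube_families d 1"
proof -
  have "space M \<in> eps_cubes d 1"
    unfolding eps_cubes_def space_cube_measure
    by (intro CollectI conjI exI[of _ "\<lambda>_. 0"]) simp_all
  thus ?thesis by (simp add: cube_families_def)
qed

text \<open>The whole cube alone is an admissible family at scale 1, and its oscillation is the L1
  distance to the mean. This makes the norm definite and later normalises f for the uniform
  integrability estimate.\<close>

lemma L1_le_N:
  assumes f: "f \<in> bbm_functions d"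
  shows "(LINT x|M. cmod (f x - (LINT x|M. f x))) \<le> N f"
proof -
  note i = bbm_functions_integrable[OF f]
  have "osc_sum 1 {space M} f \<le> N f" by (rule osc_sum_le_N[OF f _ unit_cube_family]) simp
  moreover have "cube_mean d f (space M) = (LINT x|M. f x)"
    by (simp add: cube_mean_def measure_cube_space set_integral_space[OF i])
  ultimately show ?thesis
    using i by (simp add: osc_sum_def mean_oscillation_def measure_cube_space set_integral_space)
qed

lemma N_eq_0:
  assumes f: "f \<in> bbm_functions d" and "N f = 0" shows "bbm_class d f = bbm_class d (\<lambda>x. 0)"
proof -
  note i = bbm_functions_integrable[OF f]
  have "(LINT x|M. cmod (f x - (LINT x|M. f x))) \<le> 0" using L1_le_N[OF f] assms(2) by simp
  moreover have "0 \<le> (LINT x|M. cmod (f x - (LINT x|M. f x)))" by simp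
  ultimately have "(LINT x|M. cmod (f x - (LINT x|M. f x))) = 0" by linarith
  hence "AE x in M. cmod (f x - (LINT x|M. f x)) = 0"
    using i by (subst (asm) integral_nonneg_eq_0_iff_AE) auto
  hence "AE x in M. f x = 0 + (LINT x|M. f x)" by eventually_elim simp
  thus ?thesis by (rule bbm_class_eqI[OF f bbm_functions_const])
qed

lemma complex_normed_space_bbm: "complex_normed_space (bbm_space d)"
proof -
  note simps = bbm_class_add bbm_class_smult bbm_functions_add bbm_functions_cmult bbm_functions_const bbm_class_carrier nrm_bbm_class
  have "abelian_group (bbm_space d)"
  proof (rule abelian_groupI)
    show "\<zero>\<^bsub>bbm_space d\<^esub> \<in> carrier (bbm_space d)" by (simp only: bbm_space_simps(2) simps)
  next
    fix X Y assume "X \<in> carrier (bbm_space d)" "Y \<in> carrier (bbm_space d)"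
    then obtain f g where "f \<in> bbm_functions d" "X = bbm_class d f" "g \<in> bbm_functions d" "Y = bbm_class d g"
      by (metis bbm_carrier_E)
    thus "X \<oplus>\<^bsub>bbm_space d\<^esub> Y \<in> carrier (bbm_space d)" "X \<oplus>\<^bsub>bbm_space d\<^esub> Y = Y \<oplus>\<^bsub>bbm_space d\<^esub> X"
      by (simp_all add: simps add.commute)
  next
    fix X Y Z assume "X \<in> carrier (bbm_space d)" "Y \<in> carrier (bbm_space d)" "Z \<in> carrier (bbm_space d)"
    then obtain f g h where "f \<in> bbm_functions d" "X = bbm_class d f" "g \<in> bbm_functions d" "Y = bbm_class d g"
      "h \<in> bbm_functions d" "Z = bbm_class d h"
      by (metis bbm_carrier_E)
    thus "X \<oplus>\<^bsub>bbm_space d\<^esub> Y \<oplus>\<^bsub>bbm_space d\<^esub> Z = X \<oplus>\<^bsub>bbm_space d\<^esub> (Y \<oplus>\<^bsub>bbm_space d\<^esub> Z)"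
      by (simp add: simps add.assoc)
  next
    fix X assume "X \<in> carrier (bbm_space d)"
    then obtain f where f: "f \<in> bbm_functions d" "X = bbm_class d f" by (metis bbm_carrier_E)
    thus "\<zero>\<^bsub>bbm_space d\<^esub> \<oplus>\<^bsub>bbm_space d\<^esub> X = X" by (simp add: bbm_space_simps(2) simps)
    have "bbm_class d (\<lambda>x. (-1) * f x) \<oplus>\<^bsub>bbm_space d\<^esub> X = bbm_class d (\<lambda>x. (-1) * f x + f x)"
      unfolding f(2) by (rule bbm_class_add[OF bbm_functions_cmult[OF f(1)] f(1)])
    also have "\<dots> = \<zero>\<^bsub>bbm_space d\<^esub>" by (simp add: bbm_space_simps(2))
    finally show "\<exists>Y\<in>carrier (bbm_space d). Y \<oplus>\<^bsub>bbm_space d\<^esub> X = \<zero>\<^bsub>bbm_space d\<^esub>"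
      using bbm_class_carrier[OF bbm_functions_cmult[OF f(1), of "-1"]] by blast
  qed
  hence mod: "module complex_ring (bbm_space d)"
  proof (rule moduleI[OF cring_complex_ring])
    fix a b X assume "X \<in> carrier (bbm_space d)"
    then obtain f where f: "f \<in> bbm_functions d" "X = bbm_class d f" by (metis bbm_carrier_E)
    show "a \<odot>\<^bsub>bbm_space d\<^esub> X \<in> carrier (bbm_space d)"
      "\<one>\<^bsub>complex_ring\<^esub> \<odot>\<^bsub>bbm_space d\<^esub> X = X"
      "(a \<oplus>\<^bsub>complex_ring\<^esub> b) \<odot>\<^bsub>bbm_space d\<^esub> X = a \<odot>\<^bsub>bbm_space d\<^esub> X \<oplus>\<^bsub>bbm_space d\<^esub> b \<odot>\<^bsub>bbm_space d\<^esub> X"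
      "(a \<otimes>\<^bsub>complex_ring\<^esub> b) \<odot>\<^bsub>bbm_space d\<^esub> X = a \<odot>\<^bsub>bbm_space d\<^esub> (b \<odot>\<^bsub>bbm_space d\<^esub> X)"
      using f by (simp_all add: simps distrib_right mult.assoc)
    fix Y assume "Y \<in> carrier (bbm_space d)"
    then obtain g where g: "g \<in> bbm_functions d" "Y = bbm_class d g" by (metis bbm_carrier_E)
    show "a \<odot>\<^bsub>bbm_space d\<^esub> (X \<oplus>\<^bsub>bbm_space d\<^esub> Y) = a \<odot>\<^bsub>bbm_space d\<^esub> X \<oplus>\<^bsub>bbm_space d\<^esub> a \<odot>\<^bsub>bbm_space d\<^esub> Y"
      using f g by (simp add: simps distrib_left)
  qed
  then interpret B: module complex_ring "bbm_space d" .
  show ?thesis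
  proof
    fix X assume X: "X \<in> carrier (bbm_space d)"
    then obtain f where f: "f \<in> bbm_functions d" "X = bbm_class d f" by (metis bbm_carrier_E)
    show "0 \<le> nrm (bbm_space d) X" by (simp add: f nrm_bbm_class N_nonneg)
    show "(nrm (bbm_space d) X = 0) = (X = \<zero>\<^bsub>bbm_space d\<^esub>)"
    proof
      assume "nrm (bbm_space d) X = 0"
      thus "X = \<zero>\<^bsub>bbm_space d\<^esub>" using N_eq_0[OF f(1)] by (simp add: f nrm_bbm_class bbm_space_simps(2))
    next
      assume "X = \<zero>\<^bsub>bbm_space d\<^esub>"
      thus "nrm (bbm_space d) X = 0"
        using N_cmult[OF bbm_functions_const, of 0 0] nrm_bbm_class[OF bbm_functions_const, of 0] by (simp add: bbm_space_simps(2))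
    qed
    show "nrm (bbm_space d) (c \<odot>\<^bsub>bbm_space d\<^esub> X) = cmod c * nrm (bbm_space d) X" for c
      using f by (simp add: simps N_cmult)
    fix Y assume "Y \<in> carrier (bbm_space d)"
    then obtain g where g: "g \<in> bbm_functions d" "Y = bbm_class d g" by (metis bbm_carrier_E)
    show "nrm (bbm_space d) (X \<oplus>\<^bsub>bbm_space d\<^esub> Y) \<le> nrm (bbm_space d) X + nrm (bbm_space d) Y"
      using f g by (simp add: simps N_add)
  qed
qed

end

section \<open>Atoms\<close>

context unit_cube
begin

abbreviation "V \<equiv> bbm_space d"

lemma space_M_nonempty: "space M \<noteq> {}"
  using measure_cube_space[of d] by force

lemma integrable_bm: "h \<in> bounded_measurable M \<Longrightarrow> integrable M h"
  using integrable_bounded_measurable[of M "\<lambda>_. 1" h] by simp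

text \<open>Pairing with a mean-zero function ignores constants; with the cube mean as c,
  oscillations appear.\<close>

lemma set_integral_mult_mean_zero:
  assumes f: "integrable M f" and g: "g \<in> bounded_measurable M" and Q: "Q \<in> sets M" and 0: "(LINT x:Q|M. g x) = 0"
  shows "(LINT x:Q|M. f x * g x) = (LINT x:Q|M. (f x - c) * g x)"
proof -
  note i1 = set_integrable_M[OF integrable_bounded_measurable[OF f g] Q]
  note i2 = set_integrable_M[OF integrable_bounded_measurable[OF _ g] Q, of "\<lambda>_. c"]
  have "(LINT x:Q|M. (f x - c) * g x) = (LINT x:Q|M. f x * g x) - (LINT x:Q|M. c * g x)"
    unfolding left_diff_distrib using i1 i2 by (intro set_integral_diff(2)) auto
  moreover have "(LINT x:Q|M. c * g x) = c * (LINT x:Q|M. g x)"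
    unfolding set_lebesgue_integral_def mult_scaleR_right[symmetric] integral_mult_right_zero ..
  ultimately show ?thesis using 0 by simp
qed

lemma norm_set_integral_mult_le:
  assumes f: "integrable M f" and g: "g \<in> bounded_measurable M" and Q: "Q \<in> sets M"
    and B: "\<And>x. x \<in> space M \<Longrightarrow> cmod (g x) \<le> B"
  shows "cmod (LINT x:Q|M. f x * g x) \<le> B * (LINT x:Q|M. cmod (f x))"
proof -
  have i: "set_integrable M Q (\<lambda>x. f x * g x)" by (rule set_integrable_M[OF integrable_bounded_measurable[OF f g] Q])
  have "cmod (LINT x:Q|M. f x * g x) \<le> (LINT x|M. cmod (indicator Q x *\<^sub>R (f x * g x)))"
    unfolding set_lebesgue_integral_def by (rule integral_norm_bound)
  also have "\<dots> \<le> (LINT x|M. B * (indicator Q x *\<^sub>R cmod (f x)))"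
  proof (rule integral_mono)
    show "integrable M (\<lambda>x. cmod (indicator Q x *\<^sub>R (f x * g x)))" using i unfolding set_integrable_def by (rule integrable_norm)
    show "integrable M (\<lambda>x. B * (indicator Q x *\<^sub>R cmod (f x)))"
      using set_integrable_M[OF integrable_norm[OF f] Q] by (intro integrable_mult_right) (simp add: set_integrable_def)
    show "cmod (indicator Q x *\<^sub>R (f x * g x)) \<le> B * (indicator Q x *\<^sub>R cmod (f x))" if "x \<in> space M" for x
      using mult_left_mono[OF B[OF that], of "cmod (f x)"] by (simp add: indicator_def norm_mult mult.commute)
  qed
  also have "\<dots> = B * (LINT x:Q|M. cmod (f x))" unfolding set_lebesgue_integral_def by simp
  finally show ?thesis .
qed

text \<open>
  Atoms satisfy their bounds only almost everywhere; a cube atom is a representative that satisfies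
  them everywhere.
\<close>

definition cube_atom :: "real \<Rightarrow> (nat \<Rightarrow> real) set set \<Rightarrow> ((nat \<Rightarrow> real) \<Rightarrow> complex) \<Rightarrow> bool" where
  "cube_atom \<epsilon> F g \<longleftrightarrow> \<epsilon> \<in> {0<..1} \<and> F \<in> cube_families d \<epsilon> \<and> g \<in> borel_measurable M \<and>
    (\<forall>x. cmod (g x) \<le> 1 / \<epsilon>) \<and> (\<forall>x. x \<notin> \<Union>F \<longrightarrow> g x = 0) \<and> (\<forall>Q\<in>F. (LINT x:Q|M. g x) = 0)"

text \<open>As a cube has measure \<epsilon> ^ d, the size bound for atoms is 1 / \<epsilon> in
  every dimension.\<close>

lemma powers_eps: "\<epsilon> > 0 \<Longrightarrow> \<epsilon> ^ (d - 1) * (1 / \<epsilon> ^ d) = 1 / \<epsilon>" for \<epsilon> :: real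
  using d_pos by (cases d) auto

lemma bbm_atom_cube_atom:
  assumes "bbm_atom d g"
  obtains g' \<epsilon> F where "cube_atom \<epsilon> F g'" "AE x in M. g x = g' x"
proof -
  obtain \<epsilon> F where g: "g \<in> borel_measurable M" and e: "\<epsilon> \<in> {0<..1}" and F: "F \<in> cube_families d \<epsilon>"
    and off: "AE x in M. x \<notin> \<Union>F \<longrightarrow> g x = 0"
    and bd: "\<forall>Q\<in>F. AE x in M. cmod (g x) * indicator Q x \<le> \<epsilon> ^ (d - 1) * (1 / measure M Q)"
    and 0: "\<forall>Q\<in>F. (LINT x:Q|M. g x) = 0"
    using assms unfolding bbm_atom_def by blast
  have e0: "\<epsilon> > 0" using e by simp
  note Fs = cube_families_simps[OF F e0]
  have U: "\<Union>F \<in> sets M" using Fs(1,2) by (intro sets.finite_Union) auto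
  \<comment> \<open>Set to 0 wherever the support or the size condition fails. Almost everywhere
    this changes nothing, so the integrals over the cubes stay 0.\<close>
  define g' where "g' x = (if x \<in> \<Union>F \<and> cmod (g x) \<le> 1 / \<epsilon> then g x else 0)" for x
  have g'm: "g' \<in> borel_measurable M"
  proof -
    have "{x \<in> space M. x \<in> \<Union>F \<and> cmod (g x) \<le> 1 / \<epsilon>} \<in> sets M"
      using U g by measurable
    thus ?thesis unfolding g'_def[abs_def] using g by (intro measurable_If) auto
  qed
  have "AE x in M. \<forall>Q\<in>F. cmod (g x) * indicator Q x \<le> \<epsilon> ^ (d - 1) * (1 / measure M Q)"
    using bd Fs(1) by (simp add: AE_finite_all)
  hence ae: "AE x in M. g x = g' x"
    using off
  proof eventually_elim
    case (elim x)
    show ?case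
    proof (cases "x \<in> \<Union>F")
      case True
      then obtain Q where Q: "Q \<in> F" "x \<in> Q" by blast
      hence "cmod (g x) \<le> 1 / \<epsilon>" using bspec[OF elim(1) Q(1)] Fs(3)[OF Q(1)] powers_eps[OF e0] by simp
      thus ?thesis using True by (simp add: g'_def)
    next
      case False
      thus ?thesis using elim(2) by (simp add: g'_def)
    qed
  qed
  have "(LINT x:Q|M. g' x) = 0" if "Q \<in> F" for Q
  proof -
    have "(LINT x:Q|M. g' x) = (LINT x:Q|M. g x)"
      unfolding set_lebesgue_integral_def
    proof (rule integral_cong_AE)
      show "AE x in M. indicator Q x *\<^sub>R g' x = indicator Q x *\<^sub>R g x" using ae by eventually_elim simp
    qed (use g g'm Fs(2)[OF that] in auto)
    thus ?thesis using 0 that by simp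
  qed
  moreover have "\<forall>x. cmod (g' x) \<le> 1 / \<epsilon>" "\<forall>x. x \<notin> \<Union>F \<longrightarrow> g' x = 0"
    using e0 by (auto simp: g'_def)
  ultimately have "cube_atom \<epsilon> F g'"
    unfolding cube_atom_def using e F g'm by blast
  thus ?thesis using that ae by blast
qed

lemma cube_atom_bm: "cube_atom \<epsilon> F g \<Longrightarrow> g \<in> bounded_measurable M"
  by (rule bounded_measurableI[where b = "1 / \<epsilon>"]) (simp_all add: cube_atom_def)

lemma cube_atom_integral:
  assumes g: "cube_atom \<epsilon> F g" and f: "integrable M f"
  shows "(LINT x|M. f x * g x) = (\<Sum>Q\<in>F. LINT x:Q|M. f x * g x)"
proof -
  have F: "F \<in> cube_families d \<epsilon>" "\<epsilon> > 0" using g by (auto simp: cube_atom_def)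
  note Fs = cube_families_simps[OF F]
  have fg: "integrable M (\<lambda>x. f x * g x)" by (rule integrable_bounded_measurable[OF f cube_atom_bm[OF g]])
  have "(\<Sum>Q\<in>F. LINT x:Q|M. f x * g x) = (LINT x|M. (\<Sum>Q\<in>F. indicator Q x *\<^sub>R (f x * g x)))"
    unfolding set_lebesgue_integral_def
    by (intro Bochner_Integration.integral_sum[symmetric] integrable_mult_indicator Fs(2) fg)
  also have "\<dots> = (LINT x|M. f x * g x)"
  proof (intro Bochner_Integration.integral_cong refl)
    fix x
    have dj: "disjoint_family_on (\<lambda>Q. Q) F" using F(1) by (auto simp: cube_families_def disjoint_def disjoint_family_on_def)
    have "(\<Sum>Q\<in>F. indicator Q x :: real) = indicator (\<Union>((\<lambda>Q. Q) ` F)) x"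
      by (rule indicator_UN_disjoint[OF Fs(1) dj, symmetric])
    hence "(\<Sum>Q\<in>F. indicator Q x *\<^sub>R (f x * g x)) = indicator (\<Union>F) x *\<^sub>R (f x * g x)"
      by (simp add: scaleR_left.sum[symmetric])
    also have "\<dots> = f x * g x" using g by (auto simp: cube_atom_def indicator_def)
    finally show "(\<Sum>Q\<in>F. indicator Q x *\<^sub>R (f x * g x)) = f x * g x" .
  qed
  finally show ?thesis ..
qed

lemma cube_atom_integral_0:
  assumes g: "cube_atom \<epsilon> F g" shows "(LINT x|M. g x) = 0"
  using cube_atom_integral[OF g, of "\<lambda>_. 1"] g by (simp add: cube_atom_def)

text \<open>On each cube f may be replaced by f minus its mean, and the size bound 1 / \<epsilon> of
  the atom is precisely the weight that \<open>osc_sum\<close> puts on the integral of |f -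
  mean|.\<close>

lemma cube_atom_integral_le:
  assumes g: "cube_atom \<epsilon> F g" and f: "integrable M f"
  shows "cmod (LINT x|M. f x * g x) \<le> osc_sum \<epsilon> F f"
proof -
  have F: "F \<in> cube_families d \<epsilon>" "\<epsilon> > 0" using g by (auto simp: cube_atom_def)
  note Fs = cube_families_simps[OF F]
  have "cmod (LINT x|M. f x * g x) \<le> (\<Sum>Q\<in>F. cmod (LINT x:Q|M. f x * g x))"
    unfolding cube_atom_integral[OF g f] by (rule norm_sum)
  also have "\<dots> \<le> (\<Sum>Q\<in>F. \<epsilon> ^ (d - 1) * mean_oscillation d f Q)"
  proof (rule sum_mono)
    fix Q assume Q: "Q \<in> F"
    have "(LINT x:Q|M. f x * g x) = (LINT x:Q|M. (f x - cube_mean d f Q) * g x)"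
      using g Q by (intro set_integral_mult_mean_zero f cube_atom_bm[OF g] Fs(2)) (auto simp: cube_atom_def)
    also have "cmod \<dots> \<le> 1 / \<epsilon> * (LINT x:Q|M. cmod (f x - cube_mean d f Q))"
      using g Q f by (intro norm_set_integral_mult_le cube_atom_bm[OF g] Fs(2)) (auto simp: cube_atom_def)
    also have "\<dots> = \<epsilon> ^ (d - 1) * mean_oscillation d f Q"
      unfolding mean_oscillation_def Fs(3)[OF Q] mult.assoc[symmetric] powers_eps[OF F(2)] ..
    finally show "cmod (LINT x:Q|M. f x * g x) \<le> \<epsilon> ^ (d - 1) * mean_oscillation d f Q" .
  qed
  also have "\<dots> = osc_sum \<epsilon> F f" by (simp add: osc_sum_def sum_distrib_left)
  finally show ?thesis .
qed

lemma cube_atom_bbm_atom: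
  assumes "cube_atom \<epsilon> F g" shows "bbm_atom d g"
proof -
  have F: "F \<in> cube_families d \<epsilon>" "\<epsilon> > 0" "\<epsilon> \<in> {0<..1}" using assms by (auto simp: cube_atom_def)
  have "cmod (g x) * indicator Q x \<le> \<epsilon> ^ (d - 1) * (1 / measure M Q)" if Q: "Q \<in> F" for Q x
  proof -
    have "cmod (g x) * indicator Q x \<le> cmod (g x)" by (simp add: indicator_def)
    also have "\<dots> \<le> 1 / \<epsilon>" using assms by (simp add: cube_atom_def)
    finally show ?thesis using powers_eps[OF F(2)] cube_families_simps(3)[OF F(1,2) Q] by simp
  qed
  moreover have "g \<in> borel_measurable M" "\<And>x. x \<notin> \<Union>F \<Longrightarrow> g x = 0" "\<forall>Q\<in>F. (LINT x:Q|M. g x) = 0"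
    using assms unfolding cube_atom_def by blast+
  ultimately show ?thesis
    unfolding bbm_atom_def by (intro conjI bexI[of _ \<epsilon>] bexI[of _ F] ballI AE_I2 F impI) simp_all
qed

lemma bbm_rep_in:
  assumes "X \<in> carrier V" shows "bbm_rep X \<in> bbm_functions d"
  using assms bbm_rep_class by (metis bbm_carrier_E)

text \<open>The constant by which the chosen representative differs from f is annihilated, since h
  has mean zero.\<close>

lemma atom_functional_class:
  assumes f: "f \<in> bbm_functions d" and h: "h \<in> bounded_measurable M" "(LINT x|M. h x) = 0"
  shows "atom_functional d h (bbm_class d f) = (LINT x|M. f x * h x)"
proof -
  obtain c where c: "bbm_rep (bbm_class d f) \<in> bbm_functions d" "AE x in M. bbm_rep (bbm_class d f) x = f x + c"
    using bbm_rep_class[OF f] .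
  note i = bbm_functions_integrable[OF f] bbm_functions_integrable[OF c(1)]
  have "(LINT x|M. bbm_rep (bbm_class d f) x * h x) = (LINT x|M. f x * h x + c * h x)"
  proof (rule integral_cong_AE)
    show "AE x in M. bbm_rep (bbm_class d f) x * h x = f x * h x + c * h x"
      using c(2) by eventually_elim (simp add: distrib_right)
  qed (use i bounded_measurableD[OF h(1)] in auto)
  also have "\<dots> = (LINT x|M. f x * h x)"
    using integrable_bounded_measurable[OF i(1) h(1)] integrable_bm[OF h(1)] h(2) by simp
  finally show ?thesis using bbm_class_carrier[OF f] by (simp add: atom_functional_def)
qed

lemma atom_functional_cong_AE:
  assumes "g \<in> borel_measurable M" "g' \<in> borel_measurable M" "AE x in M. g x = g' x"
  shows "atom_functional d g = atom_functional d g'"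
  unfolding atom_functional_def
proof (rule restrict_ext)
  fix X assume "X \<in> carrier V"
  hence "bbm_rep X \<in> borel_measurable M" using bbm_functions_integrable[OF bbm_rep_in] by auto
  thus "(LINT x|M. bbm_rep X x * g x) = (LINT x|M. bbm_rep X x * g' x)"
    using assms by (intro integral_cong_AE) auto
qed

lemma bbm_atom_representative:
  assumes "bbm_atom d g"
  obtains g' \<epsilon> F where "cube_atom \<epsilon> F g'" "atom_functional d g = atom_functional d g'"
    "\<And>f. integrable M f \<Longrightarrow> (LINT x|M. f x * g x) = (LINT x|M. f x * g' x)"
proof -
  obtain g' \<epsilon> F where g': "cube_atom \<epsilon> F g'" "AE x in M. g x = g' x" using bbm_atom_cube_atom[OF assms] .
  have m: "g \<in> borel_measurable M" "g' \<in> borel_measurable M"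
    using assms g' by (auto simp: bbm_atom_def cube_atom_def)
  have "(LINT x|M. f x * g x) = (LINT x|M. f x * g' x)" if "integrable M f" for f
  proof (rule integral_cong_AE)
    show "AE x in M. f x * g x = f x * g' x" using g'(2) by eventually_elim simp
  qed (use that m in auto)
  thus ?thesis using that[OF g'(1) atom_functional_cong_AE[OF m g'(2)]] by blast
qed

lemma atom_functional_dual:
  assumes h: "h \<in> bounded_measurable M" "(LINT x|M. h x) = 0"
    and K: "\<And>f. f \<in> bbm_functions d \<Longrightarrow> cmod (LINT x|M. f x * h x) \<le> K * N f"
  shows "atom_functional d h \<in> dual_carrier V"
proof (rule dual_carrierI[where K = K])
  note af = atom_functional_class[OF _ h]
  show "atom_functional d h \<in> extensional (carrier V)" by (simp add: atom_functional_def)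
  fix X assume "X \<in> carrier V"
  then obtain f where f: "f \<in> bbm_functions d" "X = bbm_class d f" by (metis bbm_carrier_E)
  note fi = integrable_bounded_measurable[OF bbm_functions_integrable[OF f(1)] h(1)]
  show "cmod (atom_functional d h X) \<le> K * nrm V X" using f K by (simp add: af nrm_bbm_class)
  show "atom_functional d h (c \<odot>\<^bsub>V\<^esub> X) = c * atom_functional d h X" for c
    using f bbm_functions_cmult[OF f(1), of c] by (simp add: af bbm_class_smult mult.assoc)
  fix Y assume "Y \<in> carrier V"
  then obtain g where g: "g \<in> bbm_functions d" "Y = bbm_class d g" by (metis bbm_carrier_E)
  show "atom_functional d h (X \<oplus>\<^bsub>V\<^esub> Y) = atom_functional d h X + atom_functional d h Y"
    using f g bbm_functions_add[OF f(1) g(1)] fi integrable_bounded_measurable[OF bbm_functions_integrable[OF g(1)] h(1)]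
    by (simp add: af bbm_class_add distrib_right)
qed

lemma cube_atom_le_N:
  assumes g: "cube_atom \<epsilon> F g" and f: "f \<in> bbm_functions d"
  shows "cmod (LINT x|M. f x * g x) \<le> N f"
  using cube_atom_integral_le[OF g bbm_functions_integrable[OF f]] osc_sum_le_N[OF f, of \<epsilon> F] g
  by (auto simp: cube_atom_def)

lemma bbm_atom_dual:
  assumes "bbm_atom d g" shows "atom_functional d g \<in> dual_carrier V" "nrm (dual V) (atom_functional d g) \<le> 1"
proof -
  interpret V: complex_normed_space V by (rule complex_normed_space_bbm)
  obtain g' \<epsilon> F where g': "cube_atom \<epsilon> F g'" "atom_functional d g = atom_functional d g'"
    using bbm_atom_representative[OF assms] by metis
  note h = cube_atom_bm[OF g'(1)] cube_atom_integral_0[OF g'(1)]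
  show "atom_functional d g \<in> dual_carrier V" unfolding g'(2)
    by (rule atom_functional_dual[OF h, where K = 1]) (use cube_atom_le_N[OF g'(1)] in simp)
  show "nrm (dual V) (atom_functional d g) \<le> 1" unfolding g'(2)
  proof (rule V.dual_nrm_le)
    fix X assume "X \<in> carrier V"
    then obtain f where f: "f \<in> bbm_functions d" "X = bbm_class d f" by (metis bbm_carrier_E)
    show "cmod (atom_functional d g' X) \<le> 1 * nrm V X"
      using cube_atom_le_N[OF g'(1) f(1)] f by (simp add: atom_functional_class[OF _ h] nrm_bbm_class)
  qed simp
qed

text \<open>Test \<open>f\<close> against the conjugate signs of \<open>f - cube_mean d f Q\<close>, made mean zero on each cube.\<close>

lemma norming_cube_atom:
  assumes f: "integrable M f" and e: "\<epsilon> \<in> {0<..1}" and F: "F \<in> cube_families d \<epsilon>"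
  obtains g where "cube_atom \<epsilon> F g" "2 * (LINT x|M. f x * g x) = complex_of_real (osc_sum \<epsilon> F f)"
    "\<And>h. integrable M h \<Longrightarrow> 2 * cmod (LINT x|M. h x * g x) \<le> osc_sum \<epsilon> F h"
proof -
  have e0: "\<epsilon> > 0" using e by simp
  note Fs = cube_families_simps[OF F e0]
  have fm: "f \<in> borel_measurable M" using f by auto
  define s where "s Q x = cnj (sgn (f x - cube_mean d f Q))" for Q x
  have s1: "cmod (s Q x) \<le> 1" for Q x by (simp add: s_def norm_sgn)
  have sm: "s Q \<in> borel_measurable M" for Q
  proof -
    have "(\<lambda>x. sgn (f x - cube_mean d f Q)) \<in> borel_measurable M"
      unfolding sgn_div_norm using fm by (intro borel_measurable_scaleR) auto
    moreover have "cnj \<in> borel_measurable borel" by (intro borel_measurable_continuous_onI continuous_intros)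
    ultimately show ?thesis unfolding s_def[abs_def] by (rule measurable_compose)
  qed
  have sb: "s Q \<in> bounded_measurable M" for Q by (rule bounded_measurableI[OF sm s1])
  define m where "m Q = cube_mean d (s Q) Q" for Q
  have m_int: "(LINT x:Q|M. s Q x) = measure M Q *\<^sub>R m Q" if Q: "Q \<in> F" for Q
    using Fs(3)[OF Q] e0 by (simp add: m_def cube_mean_def scaleR_conv_of_real)
  have m1: "cmod (m Q) \<le> 1" if Q: "Q \<in> F" for Q
  proof -
    have "cmod (LINT x:Q|M. 1 * s Q x) \<le> 1 * (LINT x:Q|M. cmod 1)"
      by (rule norm_set_integral_mult_le[OF _ sb Fs(2)[OF Q]]) (use s1 in auto)
    hence "cmod (LINT x:Q|M. s Q x) \<le> measure M Q"
      using set_integral_const_M[OF Fs(2)[OF Q], of "1::real"] by simp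
    moreover have "measure M Q > 0" using Fs(3)[OF Q] e0 by simp
    ultimately show ?thesis by (simp add: m_def cube_mean_def norm_divide)
  qed
  \<comment> \<open>Subtracting m can raise the modulus from 1 to 2; the factor 1/2 restores the
    size bound 1 / \<epsilon>.\<close>
  define t where "t Q x = complex_of_real (1 / (2 * \<epsilon>)) * (s Q x - m Q)" for Q x
  have tb: "t Q \<in> bounded_measurable M" for Q
    unfolding t_def[abs_def] by (intro bounded_measurable_mult bounded_measurable_diff bounded_measurable_const sb)
  have t_le: "cmod (t Q x) \<le> 1 / \<epsilon>" if Q: "Q \<in> F" for Q x
  proof -
    have "cmod (s Q x - m Q) \<le> 2" using norm_triangle_ineq4[of "s Q x" "m Q"] s1[of Q x] m1[OF Q] by linarith
    hence "1 / (2 * \<epsilon>) * cmod (s Q x - m Q) \<le> 1 / (2 * \<epsilon>) * 2" using e0 by (intro mult_left_mono) auto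
    thus ?thesis using e0 by (simp add: t_def norm_mult norm_divide)
  qed
  define g where "g x = (\<Sum>Q\<in>F. indicator Q x * t Q x)" for x
  have dj: "Q = Q'" if "Q \<in> F" "Q' \<in> F" "x \<in> Q" "x \<in> Q'" for Q Q' x
    using F that unfolding cube_families_def disjoint_def by blast
  have g_on: "g x = t Q x" if Q: "Q \<in> F" "x \<in> Q" for Q x
  proof -
    have "g x = (\<Sum>Q'\<in>F. if Q' = Q then t Q x else 0)"
      unfolding g_def
    proof (rule sum.cong)
      fix Q' assume Q': "Q' \<in> F"
      have "x \<in> Q' \<longleftrightarrow> Q' = Q" using dj[OF Q' Q(1) _ Q(2)] Q(2) by blast
      thus "indicator Q' x * t Q' x = (if Q' = Q then t Q x else 0)" by (simp add: indicator_def)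
    qed simp
    thus ?thesis using Fs(1) Q by simp
  qed
  have g_off: "g x = 0" if "x \<notin> \<Union>F" for x
    unfolding g_def using that by (intro sum.neutral) (auto simp: indicator_def)
  have g_le: "cmod (g x) \<le> 1 / \<epsilon>" for x
  proof (cases "x \<in> \<Union>F")
    case True
    then obtain Q where "Q \<in> F" "x \<in> Q" by blast
    thus ?thesis using g_on t_le by simp
  next
    case False thus ?thesis using g_off e0 by simp
  qed
  have gm: "g \<in> borel_measurable M"
    unfolding g_def[abs_def]
    by (intro borel_measurable_sum borel_measurable_times borel_measurable_indicator Fs(2) bounded_measurableD[OF tb])
  have gQ: "(LINT x:Q|M. h x * g x) = (LINT x:Q|M. h x * t Q x)" if Q: "Q \<in> F" for Q h
    unfolding set_lebesgue_integral_def
    by (intro Bochner_Integration.integral_cong refl) (auto simp: indicator_def g_on[OF Q])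
  \<comment> \<open>First h is replaced by h minus its mean, as s - m has mean zero; then m drops
    out, as h minus its mean has mean zero too. So the correction costs nothing beyond the factor
    1/2.\<close>
  have s_int: "(LINT x:Q|M. h x * t Q x) = complex_of_real (1 / (2 * \<epsilon>)) * (LINT x:Q|M. (h x - cube_mean d h Q) * s Q x)"
    if Q: "Q \<in> F" and h: "integrable M h" for Q h
  proof -
    note QM = Fs(2)[OF Q]
    have si: "set_integrable M Q (s Q)" by (rule set_integrable_M[OF integrable_bm[OF sb] QM])
    have st: "(\<lambda>x. s Q x - m Q) \<in> bounded_measurable M"
      by (intro bounded_measurable_diff bounded_measurable_const sb)
    have 0: "(LINT x:Q|M. s Q x - m Q) = 0"
      unfolding set_integral_diff(2)[OF si set_integrable_const_M[OF QM]] set_integral_const_M[OF QM] m_int[OF Q] by simp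
    have hc: "integrable M (\<lambda>x. h x - cube_mean d h Q)" using h by auto
    have hz: "(LINT x:Q|M. h x - cube_mean d h Q) = 0"
      unfolding set_integral_diff(2)[OF set_integrable_M[OF h QM] set_integrable_const_M[OF QM]] set_integral_const_M[OF QM]
      using Fs(3)[OF Q] e0 by (simp add: cube_mean_def scaleR_conv_of_real)
    have "(LINT x:Q|M. h x * (s Q x - m Q)) = (LINT x:Q|M. (h x - cube_mean d h Q) * (s Q x - m Q))"
      by (rule set_integral_mult_mean_zero[OF h st QM 0])
    also have "\<dots> = (LINT x:Q|M. (h x - cube_mean d h Q) * s Q x) - (LINT x:Q|M. m Q * (h x - cube_mean d h Q))"
      unfolding right_diff_distrib mult.commute[of _ "m Q"]
      using set_integrable_M[OF integrable_bounded_measurable[OF hc sb[of Q]] QM]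
        set_integrable_M[OF integrable_mult_right[OF hc, of "m Q"] QM]
      by (intro set_integral_diff(2)) (simp_all add: right_diff_distrib)
    also have "(LINT x:Q|M. m Q * (h x - cube_mean d h Q)) = 0"
      using hz unfolding set_lebesgue_integral_def mult_scaleR_right[symmetric] integral_mult_right_zero by simp
    finally have "(LINT x:Q|M. h x * (s Q x - m Q)) = (LINT x:Q|M. (h x - cube_mean d h Q) * s Q x)" by simp
    moreover have "(LINT x:Q|M. h x * t Q x) = complex_of_real (1 / (2 * \<epsilon>)) * (LINT x:Q|M. h x * (s Q x - m Q))"
      unfolding t_def set_lebesgue_integral_def mult.left_commute[of _ "complex_of_real (1 / (2 * \<epsilon>))"]
        mult_scaleR_right[symmetric] integral_mult_right_zero ..
    ultimately show ?thesis by simp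
  qed
  have "(LINT x:Q|M. g x) = 0" if Q: "Q \<in> F" for Q
  proof -
    have "cube_mean d (\<lambda>x. 1) Q = 1"
      using Fs(3)[OF Q] e0 set_integral_const_M[OF Fs(2)[OF Q], of "1::complex"] by (simp add: cube_mean_def scaleR_conv_of_real)
    thus ?thesis using gQ[OF Q, of "\<lambda>_. 1"] s_int[OF Q, of "\<lambda>_. 1"] by (simp add: set_lebesgue_integral_def)
  qed
  hence ca: "cube_atom \<epsilon> F g" unfolding cube_atom_def using e F gm g_le g_off by blast
  have eq: "2 * (LINT x|M. h x * g x) = (\<Sum>Q\<in>F. complex_of_real (1 / \<epsilon>) * (LINT x:Q|M. (h x - cube_mean d h Q) * s Q x))"
    if h: "integrable M h" for h
    unfolding cube_atom_integral[OF ca h] sum_distrib_left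
    using gQ s_int[OF _ h] by (intro sum.cong refl) simp
  have osc_eq: "osc_sum \<epsilon> F h = (\<Sum>Q\<in>F. 1 / \<epsilon> * (LINT x:Q|M. cmod (h x - cube_mean d h Q)))" for h
    unfolding osc_sum_def sum_distrib_left mean_oscillation_def mult.assoc[symmetric]
    using Fs(3) powers_eps[OF e0] by (intro sum.cong refl) simp
  show ?thesis
  proof (rule that[OF ca])
    have "(LINT x:Q|M. (f x - cube_mean d f Q) * s Q x) = complex_of_real (LINT x:Q|M. cmod (f x - cube_mean d f Q))" for Q
    proof -
      have "(f x - cube_mean d f Q) * s Q x = complex_of_real (cmod (f x - cube_mean d f Q))" for x
      proof -
        have "z * cnj (sgn z) = complex_of_real (cmod z)" for z :: complex
          by (cases "z = 0") (auto simp: sgn_div_norm scaleR_conv_of_real complex_norm_square[symmetric] power2_eq_square divide_simps)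
        thus ?thesis by (simp add: s_def)
      qed
      hence "(LINT x:Q|M. (f x - cube_mean d f Q) * s Q x) = (LINT x|M. complex_of_real (indicator Q x * cmod (f x - cube_mean d f Q)))"
        unfolding set_lebesgue_integral_def by (simp add: scaleR_conv_of_real)
      also have "\<dots> = complex_of_real (LINT x:Q|M. cmod (f x - cube_mean d f Q))"
        unfolding set_lebesgue_integral_def by (simp only: integral_complex_of_real real_scaleR_def)
      finally show ?thesis .
    qed
    thus "2 * (LINT x|M. f x * g x) = complex_of_real (osc_sum \<epsilon> F f)"
      unfolding eq[OF f] osc_eq by simp
    \<comment> \<open>For general h only |s| \<le> 1 is available; this keeps twice the atom in the
      unit ball of the dual.\<close>
    fix h :: "(nat \<Rightarrow> real) \<Rightarrow> complex" assume h: "integrable M h"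
    have "2 * cmod (LINT x|M. h x * g x) = cmod (2 * (LINT x|M. h x * g x))" by (simp add: norm_mult)
    also have "\<dots> \<le> (\<Sum>Q\<in>F. cmod (complex_of_real (1 / \<epsilon>) * (LINT x:Q|M. (h x - cube_mean d h Q) * s Q x)))"
      unfolding eq[OF h] by (rule norm_sum)
    also have "\<dots> \<le> (\<Sum>Q\<in>F. 1 / \<epsilon> * (LINT x:Q|M. cmod (h x - cube_mean d h Q)))"
    proof (rule sum_mono)
      fix Q assume Q: "Q \<in> F"
      have "cmod (LINT x:Q|M. (h x - cube_mean d h Q) * s Q x) \<le> 1 * (LINT x:Q|M. cmod (h x - cube_mean d h Q))"
        by (rule norm_set_integral_mult_le[OF _ sb Fs(2)[OF Q]]) (use h s1 in auto)
      hence "1 / \<epsilon> * cmod (LINT x:Q|M. (h x - cube_mean d h Q) * s Q x) \<le> 1 / \<epsilon> * (LINT x:Q|M. cmod (h x - cube_mean d h Q))"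
        using e0 by (intro mult_left_mono) auto
      thus "cmod (complex_of_real (1 / \<epsilon>) * (LINT x:Q|M. (h x - cube_mean d h Q) * s Q x)) \<le> 1 / \<epsilon> * (LINT x:Q|M. cmod (h x - cube_mean d h Q))"
        using e0 by (simp add: norm_mult norm_divide)
    qed
    finally show "2 * cmod (LINT x|M. h x * g x) \<le> osc_sum \<epsilon> F h" unfolding osc_eq .
  qed
qed

end

section \<open>The predual\<close>

context unit_cube
begin

section \<open>From dyadic cells to admissible families\<close>

lemma dyadic_cell_unique:
  assumes "n \<in> dyadic_indices d k" "n' \<in> dyadic_indices d k" "x \<in> dyadic_cell d k n" "x \<in> dyadic_cell d k n'"
  shows "n = n'"
proof (rule extensionalityI[of _ "{..<d}"])
  show "n i = n' i" if "i \<in> {..<d}" for i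
    using dyadic_cell_index[OF assms(3), of i] dyadic_cell_index[OF assms(4), of i] that by simp
qed (use assms in \<open>auto simp: dyadic_indices_def PiE_def\<close>)

lemma dyadic_cube_simps:
  assumes "n \<in> dyadic_indices d k"
  shows "dyadic_cube d k n \<in> sets M" "measure M (dyadic_cube d k n) = (1 / 2 ^ k) ^ d" "dyadic_cube d k n \<noteq> {}"
proof -
  have e: "(0::real) < 1 / 2 ^ k" by simp
  note Q = dyadic_cube_eps_cubes[OF assms]
  show "dyadic_cube d k n \<in> sets M" by (rule sets_eps_cube[OF Q e])
  show m: "measure M (dyadic_cube d k n) = (1 / 2 ^ k) ^ d" by (rule measure_eps_cube[OF Q e])
  have "0 < (1 / 2 ^ k :: real) ^ d" by simp
  thus "dyadic_cube d k n \<noteq> {}" unfolding m[symmetric] by (metis less_irrefl measure_empty)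
qed

text \<open>The cell and the open cube inside it have equal measure, so their difference is
  null.\<close>

lemma set_integral_dyadic_cell:
  fixes h :: "_ \<Rightarrow> 'b::{banach, second_countable_topology}"
  assumes n: "n \<in> dyadic_indices d k" and h: "h \<in> borel_measurable M"
  shows "(LINT x:dyadic_cell d k n|M. h x) = (LINT x:dyadic_cube d k n|M. h x)"
proof -
  let ?c = "dyadic_cell d k n" and ?Q = "dyadic_cube d k n"
  note sub = dyadic_cube_subset_cell[OF n] and sets = dyadic_cell_sets[of d k n] dyadic_cube_simps(1)[OF n]
  have "measure M (?c - ?Q) = 0"
    using finite_measure_Diff[OF sets sub] measure_dyadic_cell[OF n] dyadic_cube_simps(2)[OF n] by simp
  hence "?c - ?Q \<in> null_sets M" using sets by (intro null_setsI) (auto simp: emeasure_eq_measure)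
  hence ae: "AE x in M. x \<notin> ?c - ?Q" by (rule AE_not_in)
  show ?thesis unfolding set_lebesgue_integral_def
  proof (rule integral_cong_AE)
    show "AE x in M. indicator ?c x *\<^sub>R h x = indicator ?Q x *\<^sub>R h x"
      using ae by eventually_elim (use sub in \<open>auto simp: indicator_def\<close>)
  qed (use h sets in auto)
qed

lemma osc_dyadic_cell:
  assumes n: "n \<in> dyadic_indices d k" and f: "integrable M f"
  shows "osc f (dyadic_cell d k n) = (1 / 2 ^ k) ^ d * mean_oscillation d f (dyadic_cube d k n)"
proof -
  have fm: "f \<in> borel_measurable M" using f by auto
  have m: "mean f (dyadic_cell d k n) = cube_mean d f (dyadic_cube d k n)"
    unfolding mean_def cube_mean_def set_integral_dyadic_cell[OF n fm] measure_dyadic_cell[OF n] dyadic_cube_simps(2)[OF n]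
    by (simp add: scaleR_conv_of_real field_simps)
  have "osc f (dyadic_cell d k n) = (LINT x:dyadic_cube d k n|M. cmod (f x - cube_mean d f (dyadic_cube d k n)))"
    unfolding osc_def m using fm by (intro set_integral_dyadic_cell[OF n]) auto
  thus ?thesis by (simp add: mean_oscillation_def dyadic_cube_simps(2)[OF n])
qed

lemma sum_osc_dyadic_cells_le:
  assumes f: "f \<in> bbm_functions d" and N1: "N f \<le> 1"
    and D: "D \<subseteq> dyadic_cell d j ` dyadic_indices d j" "card D \<le> (2 ^ (d - 1)) ^ j"
  shows "sum (osc f) D \<le> 1 / 2 ^ j"
proof -
  let ?e = "1 / 2 ^ j :: real"
  have e: "?e \<in> {0<..1}" by simp
  obtain I where I: "I \<subseteq> dyadic_indices d j" "D = dyadic_cell d j ` I" using D(1) by (auto simp: subset_image_iff)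
  note fin = finite_subset[OF I(1) finite_dyadic_indices]
  have inj: "n = n'" if "n \<in> I" "n' \<in> I" "x \<in> dyadic_cube d j n" "x \<in> dyadic_cube d j n'" for n n' x
    using that I(1) dyadic_cube_subset_cell dyadic_cell_unique[of n j n' x] by blast
  \<comment> \<open>The cardinality is given for the cells and needed for the cubes, so both
    indexings must be injective.\<close>
  have cube_inj: "inj_on (dyadic_cube d j) I"
  proof (rule inj_onI)
    fix n n' assume n: "n \<in> I" "n' \<in> I" "dyadic_cube d j n = dyadic_cube d j n'"
    obtain x where "x \<in> dyadic_cube d j n" using dyadic_cube_simps(3)[of n j] n I by blast
    thus "n = n'" using inj n by metis
  qed
  have cell_inj: "inj_on (dyadic_cell d j) I"
  proof (rule inj_onI)
    fix n n' assume n: "n \<in> I" "n' \<in> I" "dyadic_cell d j n = dyadic_cell d j n'"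
    hence ni: "n \<in> dyadic_indices d j" "n' \<in> dyadic_indices d j" using I(1) by auto
    obtain x where "x \<in> dyadic_cube d j n" using dyadic_cube_simps(3)[OF ni(1)] by blast
    hence "x \<in> dyadic_cell d j n" using dyadic_cube_subset_cell[OF ni(1)] by blast
    thus "n = n'" using n(3) dyadic_cell_unique[OF ni, of x] by simp
  qed
  let ?F = "dyadic_cube d j ` I"
  have "?F \<in> cube_families d ?e"
  proof -
    have "card ?F \<le> (2 ^ (d - 1)) ^ j"
      using D(2) card_image[OF cell_inj] card_image[OF cube_inj] I(2) by simp
    hence "real (card ?F) \<le> real ((2 ^ (d - 1)) ^ j)" by (rule of_nat_mono)
    also have "\<dots> = ?e powi (1 - int d)"
    proof -
      have "?e powi (1 - int d) = ?e powi (- int (d - 1))" using d_pos by (simp add: of_nat_diff)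
      also have "\<dots> = (2 ^ j) ^ (d - 1)" by (simp add: power_int_minus power_inverse divide_inverse)
      also have "\<dots> = real ((2 ^ (d - 1)) ^ j)" by (simp add: power_mult[symmetric] mult.commute)
      finally show ?thesis by simp
    qed
    finally have c: "real (card ?F) \<le> ?e powi (1 - int d)" .
    have "disjoint ?F"
    proof (rule disjointI)
      fix a b assume "a \<in> ?F" "b \<in> ?F" "a \<noteq> b"
      then obtain n n' where "n \<in> I" "n' \<in> I" "a = dyadic_cube d j n" "b = dyadic_cube d j n'" by blast
      thus "a \<inter> b = {}" using inj[of n n'] \<open>a \<noteq> b\<close> by blast
    qed
    moreover have "?F \<subseteq> eps_cubes d ?e" using dyadic_cube_eps_cubes I(1) by blast
    ultimately show ?thesis using c fin by (simp add: cube_families_def)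
  qed
  hence "osc_sum ?e ?F f \<le> 1" using osc_sum_le_N[OF f e] N1 by fastforce
  moreover have "sum (osc f) D = (\<Sum>n\<in>I. (1 / 2 ^ j) ^ d * mean_oscillation d f (dyadic_cube d j n))"
    unfolding I(2) sum.reindex[OF cell_inj] o_def
    using osc_dyadic_cell[OF _ bbm_functions_integrable[OF f]] I(1) by (intro sum.cong refl) blast
  moreover have "\<dots> = ?e * osc_sum ?e ?F f"
  proof -
    have "?e ^ d = ?e * ?e ^ (d - 1)" using d_pos by (cases d) auto
    thus ?thesis unfolding osc_sum_def sum.reindex[OF cube_inj] o_def
      by (simp only: sum_distrib_left[symmetric] mult.assoc)
  qed
  moreover have "?e * osc_sum ?e ?F f \<le> ?e * 1" by (rule mult_left_mono) (use calculation(1) in auto)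
  ultimately show ?thesis by simp
qed

text \<open>Pairing f with h minus its mean equals pairing f0, which is f minus its mean, with h.
  The L1 norm of f0 is at most N f by \<open>L1_le_N\<close>, so
  \<open>uniform_integrability_bounded\<close> applies with the weight |h|.\<close>

lemma bbm_test_bound:
  assumes f: "f \<in> bbm_functions d" and N1: "N f \<le> 1"
    and h: "h \<in> borel_measurable M" "\<And>x. x \<in> space M \<Longrightarrow> cmod (h x) \<le> b"
  shows "cmod (LINT x|M. f x * (h x - (LINT y|M. h y))) \<le>
    (2 * real (2 ^ (d - 1))) ^ Suc s * 2 ^ s * (LINT x|M. cmod (h x)) + 3 / 2 ^ s * b"
proof -
  define m where "m = (LINT y|M. f y)"
  define f0 where "f0 x = f x + - m" for x
  note fi = bbm_functions_integrable[OF f]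
  have f0B: "f0 \<in> bbm_functions d" unfolding f0_def[abs_def] by (rule bbm_functions_add[OF f bbm_functions_const])
  note f0i = bbm_functions_integrable[OF f0B]
  have "N f0 \<le> N f + N (\<lambda>x. - m)" unfolding f0_def[abs_def] by (rule N_add[OF f bbm_functions_const])
  also have "N (\<lambda>x. - m) = 0" using N_cmult[OF bbm_functions_const[of "- m"], of 0] nrm_bbm_class[OF bbm_functions_const, of "- m"]
      nrm_bbm_class[OF bbm_functions_const, of 0] bbm_class_eqI[OF bbm_functions_const bbm_functions_const, of "- m" 0 "- m"] by simp
  finally have N0: "N f0 \<le> 1" using N1 by simp
  have f01: "(LINT x|M. cmod (f0 x)) \<le> 1" using L1_le_N[OF f] N1 by (simp add: f0_def m_def)
  have hb: "h \<in> bounded_measurable M" by (rule bounded_measurableI[OF h])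
  obtain x0 where "x0 \<in> space M" using space_M_nonempty by blast
  hence b0: "b \<ge> 0" using h(2)[of x0] norm_ge_zero[of "h x0"] by linarith
  have f00: "(LINT x|M. f0 x) = 0" using fi by (simp add: f0_def m_def measure_cube_space)
  have hi: "integrable M h" by (rule integrable_bm[OF hb])
  define mh where "mh = (LINT y|M. h y)"
  have hb': "(\<lambda>x. h x - mh) \<in> bounded_measurable M" by (intro bounded_measurable_diff hb bounded_measurable_const)
  have "(LINT x|M. h x - mh) = 0" using hi by (simp add: mh_def measure_cube_space)
  hence "(LINT x|M. f x * (h x - mh)) = (LINT x|M. f0 x * (h x - mh))"
    using integrable_bounded_measurable[OF fi hb'] integrable_bm[OF hb']
    by (simp add: f0_def left_diff_distrib)
  also have "\<dots> = (LINT x|M. f0 x * h x)"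
    using integrable_bounded_measurable[OF f0i hb] f0i f00 by (simp add: right_diff_distrib)
  finally have "cmod (LINT x|M. f x * (h x - mh)) \<le> (LINT x|M. cmod (f0 x * h x))"
    using integral_norm_bound[of M "\<lambda>x. f0 x * h x"] by simp
  also have "\<dots> = (LINT x|M. cmod (f0 x) * cmod (h x))" by (simp add: norm_mult)
  also have "\<dots> \<le> (2 * real (2 ^ (d - 1))) ^ Suc s * 2 ^ s * (LINT x|M. cmod (h x)) + 3 / 2 ^ s * b"
    using sum_osc_dyadic_cells_le[OF f0B N0] h b0
    by (intro uniform_integrability_bounded f0i f01) auto
  finally show ?thesis by (simp add: mh_def)
qed

section \<open>Functionals given by bounded mean-zero functions\<close>

abbreviation "atom_functionals \<equiv> atom_functional d ` {g. bbm_atom d g}"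

abbreviation "predual \<equiv> complex_normed_space.closed_span (dual V) atom_functionals"

lemma complex_normed_space_dual_V: "complex_normed_space (dual V)"
  by (rule complex_normed_space.complex_normed_space_dual[OF complex_normed_space_bbm])

lemma atom_functionals_dual: "atom_functionals \<subseteq> carrier (dual V)"
  using bbm_atom_dual by auto

lemma atom_functional_add:
  assumes "g \<in> bounded_measurable M" "h \<in> bounded_measurable M"
  shows "atom_functional d (\<lambda>x. g x + h x) = atom_functional d g \<oplus>\<^bsub>dual V\<^esub> atom_functional d h"
  using integrable_bounded_measurable[OF bbm_functions_integrable[OF bbm_rep_in] assms(1)]
    integrable_bounded_measurable[OF bbm_functions_integrable[OF bbm_rep_in] assms(2)]
  by (auto simp: atom_functional_def distrib_left intro!: restrict_ext)

lemma atom_functional_cmult: "atom_functional d (\<lambda>x. c * h x) = c \<odot>\<^bsub>dual V\<^esub> atom_functional d h"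
  by (auto simp: atom_functional_def mult.left_commute[of _ c] intro!: restrict_ext)

text \<open>The whole cube is an admissible family at scale 1, so every bounded mean-zero function
  is, up to a null set, a multiple of an atom.\<close>

lemma atom_functional_predual:
  assumes h: "h \<in> bounded_measurable M" "(LINT x|M. h x) = 0"
  shows "atom_functional d h \<in> predual"
proof -
  interpret D: complex_normed_space "dual V" by (rule complex_normed_space_dual_V)
  obtain b where b: "\<And>x. x \<in> space M \<Longrightarrow> cmod (h x) \<le> b" using h(1) by (auto simp: bounded_measurable_def)
  define B where "B = \<bar>b\<bar> + 1"
  have B: "B > 0" by (simp add: B_def)
  \<comment> \<open>\<open>cube_atom\<close> asks for its bounds at all points, including those
    outside the space, hence the cut-off.\<close>
  define g where "g x = (if x \<in> space M then complex_of_real (1 / B) * h x else 0)" for x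
  have gm: "g \<in> borel_measurable M" unfolding g_def[abs_def] using bounded_measurableD[OF h(1)] by measurable
  have eq: "AE x in M. h x = complex_of_real B * g x" using B by (intro AE_I2) (simp add: g_def)
  have "cmod (g x) \<le> 1" for x
    using b[of x] B by (auto simp: g_def norm_mult norm_divide B_def)
  moreover have "(LINT x:space M|M. g x) = 0"
  proof -
    have "(LINT x:space M|M. g x) = (LINT x|M. complex_of_real (1 / B) * h x)"
      unfolding set_lebesgue_integral_def by (intro Bochner_Integration.integral_cong) (auto simp: g_def)
    thus ?thesis using h(2) by simp
  qed
  moreover have "g x = 0" if "x \<notin> \<Union>{space M}" for x using that by (simp add: g_def)
  ultimately have "cube_atom 1 {space M} g"
    unfolding cube_atom_def using gm unit_cube_family by simp
  hence "atom_functional d g \<in> predual"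
    using D.closed_span_superset[OF atom_functionals_dual] cube_atom_bbm_atom by blast
  hence "complex_of_real B \<odot>\<^bsub>dual V\<^esub> atom_functional d g \<in> predual"
    by (rule D.submodule_simps(4)[OF D.submodule_closed_span[OF atom_functionals_dual]])
  moreover have "atom_functional d h = complex_of_real B \<odot>\<^bsub>dual V\<^esub> atom_functional d g"
    unfolding atom_functional_cmult[symmetric]
    by (rule atom_functional_cong_AE[OF _ _ eq]) (use gm bounded_measurableD[OF h(1)] in auto)
  ultimately show ?thesis by simp
qed

text \<open>The supremum of \<open>bbm_test_bound\<close> over the unit ball. A large s makes the
  coefficient of b small at the expense of that of the L1 norm, the trade that the representation
  theorem asks for.\<close>

lemma nrm_atom_functional_le:
  assumes h: "h \<in> borel_measurable M" "\<And>x. x \<in> space M \<Longrightarrow> cmod (h x) \<le> b"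
  shows "nrm (dual V) (atom_functional d (\<lambda>x. h x - (LINT y|M. h y))) \<le>
    (2 * real (2 ^ (d - 1))) ^ Suc s * 2 ^ s * (LINT x|M. cmod (h x)) + 3 / 2 ^ s * b"
proof -
  interpret V: complex_normed_space V by (rule complex_normed_space_bbm)
  have hb: "h \<in> bounded_measurable M" by (rule bounded_measurableI[OF h])
  have hb': "(\<lambda>x. h x - (LINT y|M. h y)) \<in> bounded_measurable M" by (intro bounded_measurable_diff hb bounded_measurable_const)
  have 0: "(LINT x|M. h x - (LINT y|M. h y)) = 0" using integrable_bm[OF hb] by (simp add: measure_cube_space)
  have "cmod (atom_functional d (\<lambda>x. h x - (LINT y|M. h y)) X) \<le>
      (2 * real (2 ^ (d - 1))) ^ Suc s * 2 ^ s * (LINT x|M. cmod (h x)) + 3 / 2 ^ s * b"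
    if X: "X \<in> carrier V" "nrm V X \<le> 1" for X
  proof -
    obtain f where f: "f \<in> bbm_functions d" "X = bbm_class d f" using bbm_carrier_E[OF X(1)] .
    have "N f \<le> 1" using X(2) f by (simp add: nrm_bbm_class)
    from bbm_test_bound[OF f(1) this h] show ?thesis
      by (simp add: f(2) atom_functional_class[OF f(1) hb' 0])
  qed
  moreover have "\<zero>\<^bsub>V\<^esub> \<in> {X \<in> carrier V. nrm V X \<le> 1}" by simp
  ultimately show ?thesis unfolding dual_def by (auto intro!: cSUP_least)
qed

lemma predual_functional_representation:
  assumes L: "\<And>\<phi> \<psi>. \<phi> \<in> predual \<Longrightarrow> \<psi> \<in> predual \<Longrightarrow> L (\<phi> \<oplus>\<^bsub>dual V\<^esub> \<psi>) = L \<phi> + L \<psi>"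
    "\<And>c \<phi>. \<phi> \<in> predual \<Longrightarrow> L (c \<odot>\<^bsub>dual V\<^esub> \<phi>) = c * L \<phi>"
    "\<And>\<phi>. \<phi> \<in> predual \<Longrightarrow> cmod (L \<phi>) \<le> K * nrm (dual V) \<phi>"
  shows "\<exists>X\<in>carrier V. \<forall>a\<in>atom_functionals. L a = a X"
proof -
  interpret V: complex_normed_space V by (rule complex_normed_space_bbm)
  interpret D: complex_normed_space "dual V" by (rule complex_normed_space_dual_V)
  note sup = D.closed_span_superset[OF atom_functionals_dual]
    and S = D.submodule_simps[OF D.submodule_closed_span[OF atom_functionals_dual]]
  have LK: "cmod (L \<phi>) \<le> \<bar>K\<bar> * nrm (dual V) \<phi>" if "\<phi> \<in> predual" for \<phi>
  proof -
    have "0 \<le> nrm (dual V) \<phi>" using S(1) that by (intro D.nrm_nonneg) auto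
    hence "K * nrm (dual V) \<phi> \<le> \<bar>K\<bar> * nrm (dual V) \<phi>" by (intro mult_right_mono) auto
    thus ?thesis using L(3)[OF that] by simp
  qed
  define mz where "mz g x = g x - (LINT y|M. g y)" for g :: "(nat \<Rightarrow> real) \<Rightarrow> complex" and x
  have mzb: "mz g \<in> bounded_measurable M" if "g \<in> bounded_measurable M" for g
    unfolding mz_def[abs_def] using that by (intro bounded_measurable_diff bounded_measurable_const)
  have mz0: "(LINT x|M. mz g x) = 0" if "g \<in> bounded_measurable M" for g
    unfolding mz_def using integrable_bm[OF that] by (simp add: measure_cube_space)
  note mzP = atom_functional_predual[OF mzb mz0]
  \<comment> \<open>Subtracting the mean extends the functional to all bounded functions; on atoms,
    whose mean is 0, it changes nothing.\<close>
  define \<Lambda> where "\<Lambda> g = L (atom_functional d (mz g))" for g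
  obtain f where f: "integrable M f" "\<And>g. g \<in> bounded_measurable M \<Longrightarrow> \<Lambda> g = (LINT x|M. f x * g x)"
  proof (rule bounded_measurable_functional_representation[of \<Lambda>])
    fix g h assume gh: "g \<in> bounded_measurable M" "h \<in> bounded_measurable M"
    have "mz (\<lambda>x. g x + h x) = (\<lambda>x. mz g x + mz h x)"
      using integrable_bm[OF gh(1)] integrable_bm[OF gh(2)] by (simp add: mz_def fun_eq_iff)
    thus "\<Lambda> (\<lambda>x. g x + h x) = \<Lambda> g + \<Lambda> h"
      unfolding \<Lambda>_def by (simp only: atom_functional_add[OF mzb[OF gh(1)] mzb[OF gh(2)]] L(1)[OF mzP[OF gh(1) gh(1)] mzP[OF gh(2) gh(2)]])
  next
    fix c g assume g: "g \<in> bounded_measurable M"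
    have "mz (\<lambda>x. c * g x) = (\<lambda>x. c * mz g x)" by (simp add: mz_def fun_eq_iff right_diff_distrib)
    thus "\<Lambda> (\<lambda>x. c * g x) = c * \<Lambda> g"
      unfolding \<Lambda>_def by (simp only: atom_functional_cmult L(2)[OF mzP[OF g g]])
  next
    fix \<delta> :: real assume \<delta>: "\<delta> > 0"
    \<comment> \<open>Makes the coefficient 3 * |K| / 2 ^ s of b at most \<delta>; the summand 1
      avoids division by 0.\<close>
    obtain s where s: "(1 / 2) ^ s < \<delta> / (3 * (\<bar>K\<bar> + 1))" using \<delta> real_arch_pow_inv[of "\<delta> / (3 * (\<bar>K\<bar> + 1))" "1 / 2"] by auto
    define C where "C = (2 * real (2 ^ (d - 1))) ^ Suc s * 2 ^ s"
    have "cmod (\<Lambda> g) \<le> \<bar>K\<bar> * C * (LINT x|M. cmod (g x)) + \<delta> * b"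
      if g: "g \<in> borel_measurable M" "\<forall>x\<in>space M. cmod (g x) \<le> b" for g b
    proof -
      have gb: "g \<in> bounded_measurable M" using g by (intro bounded_measurableI[where b = b]) auto
      obtain x0 where "x0 \<in> space M" using space_M_nonempty by blast
      hence b0: "b \<ge> 0" using g(2) norm_ge_zero[of "g x0"] by (meson order_trans)
      have "cmod (\<Lambda> g) \<le> \<bar>K\<bar> * nrm (dual V) (atom_functional d (mz g))"
        unfolding \<Lambda>_def by (rule LK[OF mzP[OF gb gb]])
      also have "\<dots> \<le> \<bar>K\<bar> * (C * (LINT x|M. cmod (g x)) + 3 / 2 ^ s * b)"
        unfolding C_def mz_def[abs_def] using g by (intro mult_left_mono nrm_atom_functional_le) auto
      also have "\<dots> = \<bar>K\<bar> * C * (LINT x|M. cmod (g x)) + \<bar>K\<bar> * 3 / 2 ^ s * b" by (simp add: algebra_simps)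
      also have "\<bar>K\<bar> * 3 / 2 ^ s * b \<le> \<delta> * b"
      proof (rule mult_right_mono[OF _ b0])
        have "\<bar>K\<bar> * 3 / 2 ^ s \<le> (3 * (\<bar>K\<bar> + 1)) * (1 / 2) ^ s" by (simp add: power_one_over divide_right_mono)
        also have "\<dots> \<le> (3 * (\<bar>K\<bar> + 1)) * (\<delta> / (3 * (\<bar>K\<bar> + 1)))" using s by (intro mult_left_mono) auto
        also have "\<dots> = \<delta>" by (simp add: add_nonneg_eq_0_iff)
        finally show "\<bar>K\<bar> * 3 / 2 ^ s \<le> \<delta>" .
      qed
      finally show ?thesis by simp
    qed
    thus "\<exists>C. \<forall>g b. g \<in> borel_measurable M \<longrightarrow> (\<forall>x\<in>space M. cmod (g x) \<le> b) \<longrightarrow>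
        cmod (\<Lambda> g) \<le> C * (LINT x|M. cmod (g x)) + \<delta> * b" by blast
  qed (rule that)
  have atom: "L (atom_functional d g) = (LINT x|M. f x * g x)" if g: "cube_atom \<epsilon> F g" for \<epsilon> F g
  proof -
    have "mz g = g" using cube_atom_integral_0[OF g] by (simp add: mz_def fun_eq_iff)
    thus ?thesis using f(2)[OF cube_atom_bm[OF g]] by (simp add: \<Lambda>_def)
  qed
  \<comment> \<open>So far f is merely integrable, which is why \<open>norming_cube_atom\<close> is
    stated for integrable functions. Its atom turns each \<open>osc_sum \<epsilon> F f\<close> into
    twice a value of L at a functional of norm at most 1.\<close>
  have fB: "f \<in> bbm_functions d"
  proof (rule bbm_functionsI[OF f(1), where K = "2 * \<bar>K\<bar>"])
    fix \<epsilon> F assume e: "\<epsilon> \<in> {0<..1}" "F \<in> cube_families d \<epsilon>"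
    obtain g where g: "cube_atom \<epsilon> F g" "2 * (LINT x|M. f x * g x) = complex_of_real (osc_sum \<epsilon> F f)"
      using norming_cube_atom[OF f(1) e] by metis
    have a: "atom_functional d g \<in> predual" using sup cube_atom_bbm_atom[OF g(1)] by blast
    have "osc_sum \<epsilon> F f = Re (complex_of_real (osc_sum \<epsilon> F f))" by simp
    also have "\<dots> = 2 * Re (L (atom_functional d g))" unfolding g(2)[symmetric] atom[OF g(1)] by simp
    also have "\<dots> \<le> 2 * cmod (L (atom_functional d g))" using complex_Re_le_cmod by simp
    also have "\<dots> \<le> 2 * (\<bar>K\<bar> * nrm (dual V) (atom_functional d g))" using LK[OF a] by simp
    also have "\<dots> \<le> 2 * (\<bar>K\<bar> * 1)"
      using bbm_atom_dual(2)[OF cube_atom_bbm_atom[OF g(1)]] by (intro mult_left_mono) auto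
    finally show "osc_sum \<epsilon> F f \<le> 2 * \<bar>K\<bar>" by simp
  qed simp
  show ?thesis
  proof (rule bexI[OF _ bbm_class_carrier[OF fB]], rule ballI)
    fix a assume "a \<in> atom_functionals"
    then obtain g where g: "bbm_atom d g" "a = atom_functional d g" by blast
    obtain g' \<epsilon> F where g': "cube_atom \<epsilon> F g'" "atom_functional d g = atom_functional d g'"
      using bbm_atom_representative[OF g(1)] by metis
    show "L a = a (bbm_class d f)"
      unfolding g(2) g'(2) atom[OF g'(1)]
      using atom_functional_class[OF fB cube_atom_bm[OF g'(1)] cube_atom_integral_0[OF g'(1)]] by simp
  qed
qed

lemma predual_norming:
  assumes X: "X \<in> carrier V" and r: "r < nrm V X"
  shows "\<exists>a\<in>atom_functionals. (\<forall>Y\<in>carrier V. 2 * cmod (a Y) \<le> nrm V Y) \<and> r < 2 * cmod (a X)"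
proof -
  obtain f where f: "f \<in> bbm_functions d" "X = bbm_class d f" using bbm_carrier_E[OF X] .
  note fi = bbm_functions_integrable[OF f(1)]
  have rN: "r < N f" using r f by (simp add: nrm_bbm_class)
  have "\<exists>\<epsilon>\<in>{0<..1}. \<exists>F\<in>cube_families d \<epsilon>. r < osc_sum \<epsilon> F f"
  proof (rule ccontr)
    assume "\<not> ?thesis"
    hence le: "osc_sum \<epsilon> F f \<le> r" if "\<epsilon> \<in> {0<..1}" "F \<in> cube_families d \<epsilon>" for \<epsilon> F using that by force
    \<comment> \<open>\<open>N_le\<close> wants a nonnegative bound; the family of the whole cube
      shows that r is one.\<close>
    have "0 \<le> osc_sum 1 {space M} f" by (rule osc_sum_nonneg) simp
    hence "0 \<le> r" using le[OF _ unit_cube_family] by simp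
    hence "N f \<le> r" using le by (rule N_le)
    thus False using rN by simp
  qed
  then obtain \<epsilon> F where e: "\<epsilon> \<in> {0<..1}" "F \<in> cube_families d \<epsilon>" "r < osc_sum \<epsilon> F f" by blast
  obtain g where g: "cube_atom \<epsilon> F g" "2 * (LINT x|M. f x * g x) = complex_of_real (osc_sum \<epsilon> F f)"
    "\<And>h. integrable M h \<Longrightarrow> 2 * cmod (LINT x|M. h x * g x) \<le> osc_sum \<epsilon> F h"
    using norming_cube_atom[OF fi e(1,2)] by metis
  note af = atom_functional_class[OF _ cube_atom_bm[OF g(1)] cube_atom_integral_0[OF g(1)]]
  show ?thesis
  proof (intro bexI conjI ballI)
    show "atom_functional d g \<in> atom_functionals" using cube_atom_bbm_atom[OF g(1)] by blast
    have "osc_sum \<epsilon> F f \<le> cmod (complex_of_real (osc_sum \<epsilon> F f))" by simp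
    also have "\<dots> = 2 * cmod (atom_functional d g X)"
      unfolding g(2)[symmetric] f(2) af[OF f(1)] by (simp add: norm_mult)
    finally show "r < 2 * cmod (atom_functional d g X)" using e(3) by simp
    fix Y assume "Y \<in> carrier V"
    then obtain h where h: "h \<in> bbm_functions d" "Y = bbm_class d h" by (metis bbm_carrier_E)
    show "2 * cmod (atom_functional d g Y) \<le> nrm V Y"
      unfolding h(2) af[OF h(1)] nrm_bbm_class[OF h(1)]
      using g(3)[OF bbm_functions_integrable[OF h(1)]] osc_sum_le_N[OF h(1) e(1,2)] by simp
  qed
qed

text \<open>Makes the set of atom functionals nonempty, on which the padding in
  \<open>atomic_decomposition\<close> relies.\<close>

lemma bbm_atom_zero: "bbm_atom d (\<lambda>x. 0)"
  by (rule cube_atom_bbm_atom[of 1 "{space M}"]) (simp add: cube_atom_def unit_cube_family set_lebesgue_integral_def)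

section \<open>Atomic series\<close>

lemma atomic_representation_apply:
  assumes rep: "atomic_representation d \<phi> c g" and X: "X \<in> carrier V"
  shows "(\<lambda>n. c n * atom_functional d (g n) X) sums \<phi> X"
proof -
  interpret V: complex_normed_space V by (rule complex_normed_space_bbm)
  interpret D: complex_normed_space "dual V" by (rule complex_normed_space_dual_V)
  let ?u = "\<lambda>n. c n \<odot>\<^bsub>dual V\<^esub> atom_functional d (g n)"
  have u: "?u n \<in> carrier (dual V)" for n
    using rep bbm_atom_dual(1)[of "g n"] by (intro D.smult_closed') (auto simp: atomic_representation_def)
  have \<phi>: "\<phi> \<in> carrier (dual V)" and lim: "(\<lambda>N. nrm (dual V) (\<phi> \<ominus>\<^bsub>dual V\<^esub> finsum (dual V) ?u {..<N})) \<longlonglongrightarrow> 0"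
    using rep unfolding atomic_representation_def nrm_sums_def by blast+
  have s: "finsum (dual V) ?u {..<N} \<in> carrier (dual V)" for N using u by (intro D.finsum_closed) auto
  have "(\<lambda>N. (\<Sum>n<N. c n * atom_functional d (g n) X) - \<phi> X) \<longlonglongrightarrow> 0"
  proof (rule Lim_null_comparison)
    show "(\<lambda>N. nrm (dual V) (\<phi> \<ominus>\<^bsub>dual V\<^esub> finsum (dual V) ?u {..<N}) * nrm V X) \<longlonglongrightarrow> 0"
      using lim by (rule tendsto_mult_left_zero)
    have "cmod ((\<Sum>n<N. c n * atom_functional d (g n) X) - \<phi> X) \<le> nrm (dual V) (\<phi> \<ominus>\<^bsub>dual V\<^esub> finsum (dual V) ?u {..<N}) * nrm V X" for N
    proof -
      have "finsum (dual V) ?u {..<N} X = (\<Sum>n<N. ?u n X)"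
        using u X by (intro V.dual_finsum_apply) auto
      also have "\<dots> = (\<Sum>n<N. c n * atom_functional d (g n) X)" using X by simp
      finally have "(\<phi> \<ominus>\<^bsub>dual V\<^esub> finsum (dual V) ?u {..<N}) X = \<phi> X - (\<Sum>n<N. c n * atom_functional d (g n) X)"
        using V.dual_minus_apply[of \<phi> "finsum (dual V) ?u {..<N}" X] \<phi> s X by (simp del: dual_simps(2-))
      thus ?thesis using V.dual_apply_le[of "\<phi> \<ominus>\<^bsub>dual V\<^esub> finsum (dual V) ?u {..<N}" X] D.minus_closed[OF \<phi> s[of N]] X
        by (simp add: norm_minus_commute del: dual_simps(2-))
    qed
    thus "\<forall>\<^sub>F N in sequentially. norm ((\<Sum>n<N. c n * atom_functional d (g n) X) - \<phi> X) \<le> nrm (dual V) (\<phi> \<ominus>\<^bsub>dual V\<^esub> finsum (dual V) ?u {..<N}) * nrm V X"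
      by simp
  qed
  thus ?thesis unfolding sums_def by (rule LIM_zero_cancel)
qed

text \<open>Atom functionals have norm at most 1, so at each X the series is dominated termwise by
  |c n| times the norm of X.\<close>

lemma nrm_le_atomic_representation:
  assumes rep: "atomic_representation d \<phi> c g"
  shows "nrm (dual V) \<phi> \<le> (\<Sum>n. cmod (c n))"
proof -
  interpret V: complex_normed_space V by (rule complex_normed_space_bbm)
  have sm: "summable (\<lambda>n. cmod (c n))" and at: "\<And>n. bbm_atom d (g n)"
    using rep by (auto simp: atomic_representation_def)
  show ?thesis
  proof (rule V.dual_nrm_le)
    show "0 \<le> (\<Sum>n. cmod (c n))" using sm by (intro suminf_nonneg) auto
    fix X assume X: "X \<in> carrier V"
    have le: "norm (c n * atom_functional d (g n) X) \<le> cmod (c n) * nrm V X" for n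
    proof -
      have "cmod (atom_functional d (g n) X) \<le> nrm (dual V) (atom_functional d (g n)) * nrm V X"
        by (rule V.dual_apply_le[OF bbm_atom_dual(1)[OF at] X])
      also have "\<dots> \<le> 1 * nrm V X" using bbm_atom_dual(2)[OF at] V.nrm_nonneg[OF X] by (intro mult_right_mono)
      finally show ?thesis by (simp add: norm_mult mult_left_mono)
    qed
    have sm': "summable (\<lambda>n. cmod (c n) * nrm V X)" using sm by (rule summable_mult2)
    have "\<phi> X = (\<Sum>n. c n * atom_functional d (g n) X)" using atomic_representation_apply[OF rep X] by (rule sums_unique)
    also have "cmod \<dots> \<le> (\<Sum>n. cmod (c n) * nrm V X)" by (rule norm_suminf_le[OF le sm'])
    also have "\<dots> = (\<Sum>n. cmod (c n)) * nrm V X" using sm by (rule suminf_mult2[symmetric])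
    finally show "cmod (\<phi> X) \<le> (\<Sum>n. cmod (c n)) * nrm V X" .
  qed
qed

lemma isometric_predual_predual: "isometric_predual V predual"
  by (rule isometric_predual_closed_span(1)[OF complex_normed_space_bbm atom_functionals_dual[unfolded dual_simps(1)]
      predual_norming predual_functional_representation])

lemma predual_atomic_representation:
  assumes "\<phi> \<in> predual" "\<eta> > 0"
  shows "\<exists>c g. atomic_representation d \<phi> c g \<and> (\<Sum>n. cmod (c n)) \<le> 2 * nrm (dual V) \<phi> + \<eta>"
proof -
  have "\<exists>c a. range a \<subseteq> atom_functionals \<and> summable (\<lambda>n. cmod (c n)) \<and>
      (\<Sum>n. cmod (c n)) \<le> 2 * nrm (dual V) \<phi> + \<eta> \<and> nrm_sums (dual V) (\<lambda>n. c n \<odot>\<^bsub>dual V\<^esub> a n) \<phi>"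
  proof (rule isometric_predual_closed_span(2)[OF complex_normed_space_bbm atom_functionals_dual[unfolded dual_simps(1)]
      predual_norming predual_functional_representation _ _ assms])
    show "atom_functionals \<noteq> {}" using bbm_atom_zero by blast
    show "nrm (dual V) a \<le> 1" if "a \<in> atom_functionals" for a using that bbm_atom_dual(2) by blast
  qed
  then obtain c a where ca: "range a \<subseteq> atom_functionals" "summable (\<lambda>n. cmod (c n))"
    "(\<Sum>n. cmod (c n)) \<le> 2 * nrm (dual V) \<phi> + \<eta>" "nrm_sums (dual V) (\<lambda>n. c n \<odot>\<^bsub>dual V\<^esub> a n) \<phi>" by blast
  have "\<forall>n. \<exists>g. bbm_atom d g \<and> a n = atom_functional d g" using ca(1) by blast
  then obtain g where g: "\<And>n. bbm_atom d (g n)" "\<And>n. a n = atom_functional d (g n)" by metis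
  have "atomic_representation d \<phi> c g"
    unfolding atomic_representation_def using ca(2,4) g(1) unfolding g(2) by blast
  thus ?thesis using ca(3) by blast
qed

text \<open>Every representation has coefficient sum at least the norm, and for each \<eta> > 0 some
  representation has sum at most twice the norm plus \<eta>. The former bounds the set of sums
  below, the latter shows it nonempty.\<close>

lemma atomic_norm_bounds:
  assumes \<phi>: "\<phi> \<in> predual"
  shows "1 / 2 * atomic_norm d \<phi> \<le> nrm (dual V) \<phi>" "nrm (dual V) \<phi> \<le> atomic_norm d \<phi>"
proof -
  let ?S = "{\<Sum>n. cmod (c n) | c. \<exists>g. atomic_representation d \<phi> c g}"
  have low: "nrm (dual V) \<phi> \<le> s" if "s \<in> ?S" for s using that nrm_le_atomic_representation by blast
  have ne: "?S \<noteq> {}" using predual_atomic_representation[OF \<phi> zero_less_one] by blast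
  show "nrm (dual V) \<phi> \<le> atomic_norm d \<phi>"
    unfolding atomic_norm_def using ne low by (rule cInf_greatest)
  have "atomic_norm d \<phi> \<le> 2 * nrm (dual V) \<phi> + \<eta>" if \<eta>: "\<eta> > 0" for \<eta>
  proof -
    obtain c g where cg: "atomic_representation d \<phi> c g" "(\<Sum>n. cmod (c n)) \<le> 2 * nrm (dual V) \<phi> + \<eta>"
      using predual_atomic_representation[OF \<phi> \<eta>] by blast
    have "atomic_norm d \<phi> \<le> (\<Sum>n. cmod (c n))"
      unfolding atomic_norm_def using cg(1) low by (intro cInf_lower bdd_belowI[of _ "nrm (dual V) \<phi>"]) blast+
    thus ?thesis using cg(2) by simp
  qed
  hence "atomic_norm d \<phi> \<le> 2 * nrm (dual V) \<phi>" by (rule field_le_epsilon)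
  thus "1 / 2 * atomic_norm d \<phi> \<le> nrm (dual V) \<phi>" by simp
qed

text \<open>An atom satisfies its bounds only almost everywhere, so both the functional and the
  integral pass through its cube atom.\<close>

lemma atomic_representation_sums:
  assumes rep: "atomic_representation d \<phi> c g" and f: "f \<in> bbm_functions d"
  shows "(\<lambda>n. c n * (LINT x|M. f x * g n x)) sums \<phi> (bbm_class d f)"
proof -
  have "atom_functional d (g n) (bbm_class d f) = (LINT x|M. f x * g n x)" for n
  proof -
    have "bbm_atom d (g n)" using rep by (simp add: atomic_representation_def)
    then obtain g' \<epsilon> F where g': "cube_atom \<epsilon> F g'" "atom_functional d (g n) = atom_functional d g'"
      "\<And>f. integrable M f \<Longrightarrow> (LINT x|M. f x * g n x) = (LINT x|M. f x * g' x)"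
      using bbm_atom_representative by metis
    show ?thesis
      unfolding g'(2) g'(3)[OF bbm_functions_integrable[OF f]]
      by (rule atom_functional_class[OF f cube_atom_bm[OF g'(1)] cube_atom_integral_0[OF g'(1)]])
  qed
  thus ?thesis using atomic_representation_apply[OF rep bbm_class_carrier[OF f]] by simp
qed

end

theorem theorem1:
  shows "\<exists>C::real. C > 0 \<and> (\<forall>d::nat. d \<ge> 1 \<longrightarrow>
    (\<exists>P. isometric_predual (bbm_space d) P \<and>
      (\<forall>\<phi>\<in>P.
        (\<exists>c g. atomic_representation d \<phi> c g) \<and>
        (\<forall>c g. atomic_representation d \<phi> c g \<longrightarrow>
          (\<forall>f\<in>bbm_functions d.
            (\<lambda>n. c n * (LINT x|cube_measure d. f x * g n x)) sums \<phi> (bbm_class d f))) \<and>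
        C * atomic_norm d \<phi> \<le> nrm (dual (bbm_space d)) \<phi> \<and>
        nrm (dual (bbm_space d)) \<phi> \<le> atomic_norm d \<phi>)))"
proof (intro exI[of _ "1 / 2 :: real"] conjI allI impI)
  fix d :: nat assume "d \<ge> 1"
  then interpret unit_cube d by unfold_locales
  show "\<exists>P. isometric_predual (bbm_space d) P \<and>
      (\<forall>\<phi>\<in>P.
        (\<exists>c g. atomic_representation d \<phi> c g) \<and>
        (\<forall>c g. atomic_representation d \<phi> c g \<longrightarrow>
          (\<forall>f\<in>bbm_functions d.
            (\<lambda>n. c n * (LINT x|cube_measure d. f x * g n x)) sums \<phi> (bbm_class d f))) \<and>
        1 / 2 * atomic_norm d \<phi> \<le> nrm (dual (bbm_space d)) \<phi> \<and>
        nrm (dual (bbm_space d)) \<phi> \<le> atomic_norm d \<phi>)"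
  proof (intro exI[of _ predual] conjI ballI isometric_predual_predual)
    fix \<phi> assume \<phi>: "\<phi> \<in> predual"
    show "\<exists>c g. atomic_representation d \<phi> c g"
      using predual_atomic_representation[OF \<phi> zero_less_one] by blast
    show "\<forall>c g. atomic_representation d \<phi> c g \<longrightarrow> (\<forall>f\<in>bbm_functions d.
        (\<lambda>n. c n * (LINT x|cube_measure d. f x * g n x)) sums \<phi> (bbm_class d f))"
      using atomic_representation_sums by blast
    show "1 / 2 * atomic_norm d \<phi> \<le> nrm (dual (bbm_space d)) \<phi>"
      "nrm (dual (bbm_space d)) \<phi> \<le> atomic_norm d \<phi>"
      by (rule atomic_norm_bounds[OF \<phi>])+
  qed
qed simp

end
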